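(* Let $\gamma\subset\mathbf{R}^2$ be a $C^2$-smooth, centrally symmetric, simple closed convex curve of positive curvature whose billiard map $T:\mathbf{A}\to\mathbf{A}$ has a continuous rotational invariant curve $\alpha\subset\mathbf{A}$ of rotation number $1/4$ consisting of $4$-periodic orbits. Let $\bar\alpha$ be the corresponding invariant curve of rotation number $3/4$, and let $\mathcal{B}\subset\mathbf{A}$ be the domain between $\alpha$ and $\bar\alpha$. Suppose that the restriction of $T$ to $\mathcal{B}$ has an invariant measurable field of non-vertical oriented lines, with the orientation chosen on the lines coherently by the condition $ds>0$. Then $\gamma$ is a circle.
   Context: Fix the counterclockwise orientation on $\gamma$ and let $s$ be the arclength parameter. The phase cylinder $\mathbf{A}$ is the space of all oriented lines intersecting (the interior of the domain bounded by) $\gamma$. An oriented line is given coordinates $(\cos\delta,s)$, $\delta\in(0,\pi)$, where $\gamma(s)$ is the point at which the line enters the domain and $\delta$ is the angle between the line and the tangent vector $\gamma'(s)$. The billiard map $T:\mathbf{A}\to\mathbf{A}$ sends an oriented line to the line obtained by reflecting it in $\gamma$ (angle of incidence equals angle of reflection) at the point where it exits the domain. An invariant curve is called rotational if it is a simple closed curve winding once around the cylinder $\mathbf{A}$. If $\alpha$ is the invariant curve of rotation number $1/4$ consisting of $4$-periodic orbits, then $\bar\alpha$ is the invariant curve of rotation number $3/4$ consisting of the same lines with reversed orientation. $\mathcal{B}$ is the (closed) region of $\mathbf{A}$ bounded by $\alpha$ and $\bar\alpha$; it is $T$-invariant. A tangent vector to $\mathbf{A}$ is vertical if $ds$ vanishes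 on it (i.e. it is tangent to the foliation $\{s=\mathrm{const}\}$). A field of non-vertical oriented lines on $\mathcal{B}$ assigns to each $x\in\mathcal{B}$ a non-vertical one-dimensional subspace $\ell(x)\subset T_x\mathbf{A}$, depending measurably on $x$ and oriented by the direction in which $ds>0$; it is invariant if $DT$ maps $\ell(x)$ to $\ell(Tx)$ preserving these orientations. *)

theory Defs
  imports "HOL-Complex_Analysis.Complex_Analysis"
begin

section \<open>The table\<close>

text \<open>
  The Euclidean plane is the type \<^typ>\<open>complex\<close>, so that the rotation by an angle \<open>\<delta>\<close> is
  multiplication by \<open>cis \<delta>\<close>.  A closed curve of length \<open>L\<close> is given by its arclength
  parametrisation, an \<open>L\<close>-periodic function of a real variable.
\<close>

definition tangent :: "(real \<Rightarrow> complex) \<Rightarrow> real \<Rightarrow> complex" where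
  "tangent \<gamma> s = vector_derivative \<gamma> (at s)"

definition acceleration :: "(real \<Rightarrow> complex) \<Rightarrow> real \<Rightarrow> complex" where
  "acceleration \<gamma> s = vector_derivative (tangent \<gamma>) (at s)"

definition C2_curve :: "(real \<Rightarrow> complex) \<Rightarrow> bool" where
  "C2_curve \<gamma> \<longleftrightarrow>
     (\<forall>s. \<gamma> differentiable (at s)) \<and> (\<forall>s. tangent \<gamma> differentiable (at s)) \<and>
     continuous_on UNIV (acceleration \<gamma>)"

definition arclength_parametrised :: "(real \<Rightarrow> complex) \<Rightarrow> bool" where
  "arclength_parametrised \<gamma> \<longleftrightarrow> (\<forall>s. norm (tangent \<gamma> s) = 1)"

definition simple_closed_curve :: "(real \<Rightarrow> complex) \<Rightarrow> real \<Rightarrow> bool" where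
  "simple_closed_curve \<gamma> L \<longleftrightarrow>
     L > 0 \<and> (\<forall>s t. \<gamma> s = \<gamma> t \<longleftrightarrow> (\<exists>k::int. t = s + of_int k * L))"

definition counterclockwise :: "(real \<Rightarrow> complex) \<Rightarrow> real \<Rightarrow> bool" where
  "counterclockwise \<gamma> L \<longleftrightarrow>
     (\<forall>z \<in> inside (range \<gamma>). winding_number (\<lambda>t. \<gamma> (L * t)) z = 1)"

definition convex_curve :: "(real \<Rightarrow> complex) \<Rightarrow> bool" where
  "convex_curve \<gamma> \<longleftrightarrow> convex (inside (range \<gamma>))"

text \<open>
  The signed curvature with respect to the left normal \<open>\<i> * tangent \<gamma> s\<close>, which is the inner
  normal of a counterclockwise curve.
\<close>

definition curvature :: "(real \<Rightarrow> complex) \<Rightarrow> real \<Rightarrow> real" where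
  "curvature \<gamma> s = acceleration \<gamma> s \<bullet> (\<i> * tangent \<gamma> s)"

definition centrally_symmetric :: "complex set \<Rightarrow> bool" where
  "centrally_symmetric S \<longleftrightarrow> (\<exists>c. (\<lambda>z. 2 * c - z) ` S = S)"

definition is_circle :: "complex set \<Rightarrow> bool" where
  "is_circle S \<longleftrightarrow> (\<exists>c r. r > 0 \<and> S = sphere c r)"


section \<open>The phase cylinder\<close>

text \<open>
  The phase cylinder, in the coordinates \<open>(p, s) = (cos \<delta>, s)\<close>, is the quotient of the strip
  \<open>(-1, 1) \<times> \<real>\<close> by the translation \<open>(p, s) \<mapsto> (p, s + L)\<close>.  We work on the strip: a subset of
  the cylinder is represented by its full preimage, and maps and fields on the cylinder by lifts
  that commute with, or are invariant under, the translation.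
\<close>

definition strip :: "(real \<times> real) set" where
  "strip = {-1<..<1} \<times> UNIV"

definition line_direction :: "(real \<Rightarrow> complex) \<Rightarrow> real \<times> real \<Rightarrow> complex" where
  "line_direction \<gamma> = (\<lambda>(p, s). tangent \<gamma> s * cis (arccos p))"

text \<open>
  The parameter of the point at which the line leaves the domain, normalised to lie in
  \<open>(s, s + L)\<close>.  This normalisation selects the lift of the billiard map for which the rotation
  numbers lie in \<open>[0, 1]\<close>.
\<close>

definition exit_parameter :: "(real \<Rightarrow> complex) \<Rightarrow> real \<Rightarrow> real \<times> real \<Rightarrow> real" where
  "exit_parameter \<gamma> L x =
     (THE t. snd x < t \<and> t < snd x + L \<and>
             (\<exists>r>0. \<gamma> t = \<gamma> (snd x) + r *\<^sub>R line_direction \<gamma> x))"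

text \<open>Reflection of a vector \<open>u\<close> in the line spanned by the unit vector \<open>\<tau>\<close>.\<close>

definition reflect :: "complex \<Rightarrow> complex \<Rightarrow> complex" where
  "reflect \<tau> u = (2 * (u \<bullet> \<tau>)) *\<^sub>R \<tau> - u"

definition billiard_map :: "(real \<Rightarrow> complex) \<Rightarrow> real \<Rightarrow> real \<times> real \<Rightarrow> real \<times> real" where
  "billiard_map \<gamma> L x =
     (let t = exit_parameter \<gamma> L x; \<tau> = tangent \<gamma> t
      in (reflect \<tau> (line_direction \<gamma> x) \<bullet> \<tau>, t))"

text \<open>The same line with the opposite orientation; it enters the domain where \<open>x\<close> leaves it.\<close>

definition reverse_line :: "(real \<Rightarrow> complex) \<Rightarrow> real \<Rightarrow> real \<times> real \<Rightarrow> real \<times> real" where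
  "reverse_line \<gamma> L x =
     (let t = exit_parameter \<gamma> L x in ((- line_direction \<gamma> x) \<bullet> tangent \<gamma> t, t))"


section \<open>Rotational invariant curves\<close>

text \<open>
  \<open>c\<close> is a lift of a parametrisation of the curve by \<open>\<real>/\<int>\<close>.  The translation property says that
  the curve winds once around the cylinder (in the direction of increasing \<open>s\<close>, as can be arranged
  by reversing the parameter), and the last clause says that it is simple on the cylinder.
\<close>

definition rotational_curve :: "real \<Rightarrow> (real \<times> real) set \<Rightarrow> bool" where
  "rotational_curve L A \<longleftrightarrow>
     (\<exists>c :: real \<Rightarrow> real \<times> real.
        continuous_on UNIV c \<and> range c = A \<and> A \<subseteq> strip \<and>
        (\<forall>t. c (t + 1) = c t + (0, L)) \<and>
        (\<forall>t t'. \<forall>k::int. c t' = c t + (0, of_int k * L) \<longrightarrow> t' = t + of_int k))"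

definition has_rotation_number ::
    "real \<Rightarrow> (real \<times> real \<Rightarrow> real \<times> real) \<Rightarrow> (real \<times> real) set \<Rightarrow> real \<Rightarrow> bool" where
  "has_rotation_number L T A \<rho> \<longleftrightarrow>
     (\<forall>x\<in>A. (\<lambda>n. (snd ((T ^^ n) x) - snd x) / (real n * L)) \<longlonglongrightarrow> \<rho>)"

text \<open>Periodicity is meant on the cylinder, hence modulo the translation by \<open>L\<close>.\<close>

definition consists_of_periodic_orbits ::
    "real \<Rightarrow> (real \<times> real \<Rightarrow> real \<times> real) \<Rightarrow> nat \<Rightarrow> (real \<times> real) set \<Rightarrow> bool" where
  "consists_of_periodic_orbits L T n A \<longleftrightarrow>
     (\<forall>x\<in>A. \<exists>k::int. (T ^^ n) x = x + (0, of_int k * L))"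

text \<open>
  The closed region bounded by \<open>K\<close> (a union of rotational curves): besides \<open>K\<close>, it consists of
  the components of the complement of \<open>K\<close> that stay away from both ends \<open>p = \<plusminus>1\<close>, that is, of
  those that are relatively compact in the cylinder.
\<close>

definition region_bounded_by :: "(real \<times> real) set \<Rightarrow> (real \<times> real) set" where
  "region_bounded_by K =
     K \<union> {x \<in> strip - K. \<exists>c<1. \<forall>y \<in> connected_component_set (strip - K) x. \<bar>fst y\<bar> \<le> c}"


section \<open>Line fields\<close>

text \<open>
  The tangent spaces are identified with \<^typ>\<open>real \<times> real\<close>, a tangent vector being
  \<open>(dp, ds)\<close>.  Measurability refers to the slope \<open>dp/ds\<close>, which is a chart for
  the non-vertical lines in the projective line.
\<close>

definition nonvertical_line :: "(real \<times> real) set \<Rightarrow> bool" where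
  "nonvertical_line l \<longleftrightarrow> subspace l \<and> dim l = 1 \<and> (\<forall>v\<in>l. v \<noteq> 0 \<longrightarrow> snd v \<noteq> 0)"

definition slope :: "(real \<times> real) set \<Rightarrow> real" where
  "slope l = (THE a. (a, 1) \<in> l)"

definition measurable_line_field ::
    "real \<Rightarrow> (real \<times> real) set \<Rightarrow> (real \<times> real \<Rightarrow> (real \<times> real) set) \<Rightarrow> bool" where
  "measurable_line_field L B l \<longleftrightarrow>
     (\<forall>x\<in>B. nonvertical_line (l x)) \<and>
     (\<forall>x\<in>B. l (x + (0, L)) = l x) \<and>
     (\<lambda>x. slope (l x)) \<in> borel_measurable (lebesgue_on B)"

definition invariant_oriented_line_field ::
    "(real \<times> real \<Rightarrow> real \<times> real) \<Rightarrow> (real \<times> real) set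
       \<Rightarrow> (real \<times> real \<Rightarrow> (real \<times> real) set) \<Rightarrow> bool" where
  "invariant_oriented_line_field T B l \<longleftrightarrow>
     (\<forall>x\<in>B. frechet_derivative T (at x) ` l x = l (T x) \<and>
            (\<forall>v\<in>l x. snd v > 0 \<longrightarrow> snd (frechet_derivative T (at x) v) > 0))"

end

theory Submission
  imports Defs
begin

text \<open>
  Let \<open>x\<close> lie on \<open>\<alpha>\<close>. As \<open>DT\<^sup>4\<close> preserves the oriented field, it cannot map the vertical direction
  at \<open>x\<close> to itself; since \<open>T\<^sup>4\<close> is the identity on \<open>\<alpha>\<close>, Rolle's theorem shows that \<open>\<alpha>\<close> is a graph.
  The twist property forces \<open>\<alpha>\<close> to coincide with its image under the central symmetry, so its
  orbits are parallelograms whose vertices have normal angles \<open>\<psi> + j \<pi> / 2\<close>. The support function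
  \<open>h\<close> then satisfies \<open>h(\<psi>)\<^sup>2 + h(\<psi> + \<pi> / 2)\<^sup>2 = R\<^sup>2\<close>, and \<open>\<alpha>\<close> is \<open>sin \<delta> = h(\<psi>) / R\<close>.

  Lines have symplectic coordinates \<open>(\<phi>, q)\<close> (normal angle and distance from the centre), with
  generating function \<open>2 h(\<psi>) sin \<delta>\<close>. The slope \<open>\<omega> = dq/d\<phi>\<close> of the field in these coordinates is
  bounded and satisfies \<open>\<omega> \<circ> T - \<omega> \<ge> 2 h''(\<psi>) sin \<delta>\<close>. Integrating over \<open>\<B>\<close> as in E. Hopf's theorem
  gives \<open>\<integral> h'' (h + h'') (\<pi> - 2 \<delta> + sin 2\<delta>) d\<psi> \<le> 0\<close>, where now \<open>\<delta> = arcsin (h / R)\<close>. Adding the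
  same integrand at \<open>\<psi> + \<pi> / 2\<close> and integrating by parts turns this into an inequality between
  \<open>\<integral> \<delta>''\<^sup>2\<close> and \<open>\<integral> \<delta>'\<^sup>2\<close> that contradicts the Poincare inequality for the \<open>\<pi> / 2\<close>-antiperiodic
  function \<open>\<delta>'\<close>, unless \<open>\<delta>' = 0\<close>.
\<close>

section \<open>Area-preserving changes of variables in the plane\<close>

text \<open>The field is only measurable, so nothing can be differentiated along it, and its slope
  \<open>dp/ds\<close> carries no a priori bound. The orientation makes up for this: since
  \<open>ds > 0\<close> is preserved, a line moving along the field turns counterclockwise as seen
  from both of its ends, and this squeezes \<open>om_out\<close> between the moments of the two ends
  of the chord. Invariance is used pointwise: the graph property comes from the field on \<alpha>, a
  set of measure zero.

  The cylinder is unrolled, so a fundamental domain of \<B> is not literally invariant under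
  \<open>T\<close>. The integral is taken over \<open>n\<close> periods instead, with a loss at the
  two ends that does not depend on \<open>n\<close>.

  The curve is only C^2, so the radius of curvature is merely continuous and \<open>h\<close> has
  just two derivatives. Integration by parts is therefore done with an explicit primitive
  \<open>Z\<close> in \<delta> and \<delta>'. Rotation number 1/4 is what makes the shift by
  \<open>pi / 2\<close> exchange the sine and cosine of \<delta>; the contradiction at the end is
  \<open>16 * (pi / 2 + 1) > pi ^ 3\<close>, which leaves ample room.\<close>

definition vec_of_pair :: "real \<times> real \<Rightarrow> real^2" where
  "vec_of_pair x = vector [fst x, snd x]"

definition pair_of_vec :: "real^2 \<Rightarrow> real \<times> real" where
  "pair_of_vec v = (v $ 1, v $ 2)"

lemma vec_of_pair_nth [simp]: "vec_of_pair x $ 1 = fst x" "vec_of_pair x $ 2 = snd x"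
  by (simp_all add: vec_of_pair_def)

lemma pair_of_vec_of_pair [simp]: "pair_of_vec (vec_of_pair x) = x"
  by (simp add: pair_of_vec_def)

lemma vec_of_pair_of_vec [simp]: "vec_of_pair (pair_of_vec v) = v"
  by (simp add: pair_of_vec_def vec_eq_iff forall_2)

lemma bounded_linear_vec_of_pair: "bounded_linear vec_of_pair"
  by (rule linear_conv_bounded_linear[THEN iffD1])
     (auto intro!: linearI simp: vec_eq_iff forall_2)

lemma bounded_linear_pair_of_vec: "bounded_linear pair_of_vec"
  by (rule linear_conv_bounded_linear[THEN iffD1])
     (auto intro!: linearI simp: pair_of_vec_def)

lemma cbox_pair_image: "vec_of_pair ` cbox u v = cbox (vec_of_pair u) (vec_of_pair v)"
proof -
  have mem: "x \<in> cbox u v \<longleftrightarrow> vec_of_pair x \<in> cbox (vec_of_pair u) (vec_of_pair v)" for x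
    by (cases x; cases u; cases v) (auto simp: mem_box_cart forall_2 cbox_Pair_eq)
  show ?thesis
  proof (intro equalityI subsetI)
    fix v' assume "v' \<in> cbox (vec_of_pair u) (vec_of_pair v)"
    then have "pair_of_vec v' \<in> cbox u v" by (simp add: mem)
    then show "v' \<in> vec_of_pair ` cbox u v" by (metis image_eqI vec_of_pair_of_vec)
  qed (use mem in auto)
qed

lemma cbox_vec_image: "pair_of_vec ` cbox u v = cbox (pair_of_vec u) (pair_of_vec v)"
proof -
  have "cbox u v = vec_of_pair ` cbox (pair_of_vec u) (pair_of_vec v)"
    by (simp add: cbox_pair_image)
  then show ?thesis by (auto simp: image_image)
qed

lemma content_cbox_pair_image: "measure lborel (vec_of_pair ` cbox u v) = measure lborel (cbox u v)"
proof (cases "fst u \<le> fst v \<and> snd u \<le> snd v")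
  case True
  then have "cbox (vec_of_pair u) (vec_of_pair v) \<noteq> {}"
    by (auto simp: forall_2 interval_ne_empty_cart)
  then have "measure lborel (vec_of_pair ` cbox u v) = (fst v - fst u) * (snd v - snd u)"
    by (simp add: cbox_pair_image content_cbox_cart UNIV_2)
  moreover have "measure lborel (cbox u v) = (fst v - fst u) * (snd v - snd u)"
    using True by (cases u; cases v) (simp add: content_Pair)
  ultimately show ?thesis by simp
next
  case False
  then have "cbox u v = {}"
    by (cases u; cases v) (auto simp: cbox_Pair_eq)
  then show ?thesis by simp
qed

lemma has_integral_pair_cbox:
  "(f has_integral i) (cbox a b) \<longleftrightarrow> 
   ((\<lambda>v. f (pair_of_vec v)) has_integral i) (cbox (vec_of_pair a) (vec_of_pair b))"
proof
  assume "(f has_integral i) (cbox a b)"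
  then have "((\<lambda>v. f (pair_of_vec v)) has_integral (1 / 1) *\<^sub>R i) (vec_of_pair ` cbox a b)"
  proof (rule has_integral_twiddle[rotated -1])
    show "isCont pair_of_vec x" for x
      by (simp add: linear_continuous_at bounded_linear_pair_of_vec)
    show "measure lborel (pair_of_vec ` cbox u v) = 1 * measure lborel (cbox u v)" for u v
      using content_cbox_pair_image[of "pair_of_vec u" "pair_of_vec v"]
      by (simp add: cbox_pair_image cbox_vec_image)
    show "\<exists>w z. vec_of_pair ` cbox u v = cbox w z" for u v
      by (intro exI) (rule cbox_pair_image)
    show "\<exists>w z. pair_of_vec ` cbox u v = cbox w z" for u v
      by (intro exI) (rule cbox_vec_image)
  qed simp_all
  then show "((\<lambda>v. f (pair_of_vec v)) has_integral i) (cbox (vec_of_pair a) (vec_of_pair b))"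
    by (simp add: cbox_pair_image)
next
  assume "((\<lambda>v. f (pair_of_vec v)) has_integral i) (cbox (vec_of_pair a) (vec_of_pair b))"
  then have "((\<lambda>x. f (pair_of_vec (vec_of_pair x))) has_integral (1 / 1) *\<^sub>R i)
      (pair_of_vec ` cbox (vec_of_pair a) (vec_of_pair b))"
  proof (rule has_integral_twiddle[rotated -1])
    show "isCont vec_of_pair x" for x
      by (simp add: linear_continuous_at bounded_linear_vec_of_pair)
    show "measure lborel (vec_of_pair ` cbox u v) = 1 * measure lborel (cbox u v)" for u v
      by (simp add: content_cbox_pair_image)
    show "\<exists>w z. vec_of_pair ` cbox u v = cbox w z" for u v
      by (intro exI) (rule cbox_pair_image)
    show "\<exists>w z. pair_of_vec ` cbox u v = cbox w z" for u v
      by (intro exI) (rule cbox_vec_image)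
  qed simp_all
  then show "(f has_integral i) (cbox a b)"
    by (simp add: cbox_vec_image)
qed

lemma has_integral_pair_iff:
  fixes f :: "real \<times> real \<Rightarrow> real"
  assumes "bounded S"
  shows "(f has_integral i) S \<longleftrightarrow> ((\<lambda>v. f (pair_of_vec v)) has_integral i) (vec_of_pair ` S)"
proof -
  obtain a b where ab: "S \<subseteq> cbox a b"
    using bounded_subset_cbox_symmetric[OF assms] by blast
  have mem: "v \<in> vec_of_pair ` S \<longleftrightarrow> pair_of_vec v \<in> S" for v
    by (metis image_iff pair_of_vec_of_pair vec_of_pair_of_vec)
  have ab': "vec_of_pair ` S \<subseteq> cbox (vec_of_pair a) (vec_of_pair b)"
    using image_mono[OF ab, of vec_of_pair] unfolding cbox_pair_image .
  have "(f has_integral i) S \<longleftrightarrow> ((\<lambda>x. if x \<in> S then f x else 0) has_integral i) (cbox a b)"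
    by (rule has_integral_restrict[OF ab, symmetric])
  also have "\<dots> \<longleftrightarrow> ((\<lambda>v. if v \<in> vec_of_pair ` S then f (pair_of_vec v) else 0) has_integral i)
      (cbox (vec_of_pair a) (vec_of_pair b))"
    unfolding has_integral_pair_cbox mem ..
  also have "\<dots> \<longleftrightarrow> ((\<lambda>v. f (pair_of_vec v)) has_integral i) (vec_of_pair ` S)"
    by (rule has_integral_restrict[OF ab'])
  finally show ?thesis .
qed

lemma absolutely_integrable_pair_iff:
  fixes f :: "real \<times> real \<Rightarrow> real"
  assumes "bounded S"
  shows "f absolutely_integrable_on S \<longleftrightarrow>
    (\<lambda>v. f (pair_of_vec v)) absolutely_integrable_on (vec_of_pair ` S)"
  unfolding absolutely_integrable_on_def integrable_on_def
  by (simp add: has_integral_pair_iff[OF assms])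

lemma integral_pair_eq:
  fixes f :: "real \<times> real \<Rightarrow> real"
  assumes "bounded S"
  shows "integral S f = integral (vec_of_pair ` S) (\<lambda>v. f (pair_of_vec v))"
  by (simp add: integral_def integrable_on_def has_integral_pair_iff[OF assms])

text \<open>\<open>has_absolute_integral_change_of_variables\<close> concerns functions between
  spaces \<open>real^'n\<close>, so domain and values are carried to \<open>real^2\<close> and
  \<open>real^1\<close>. The coordinate isomorphism maps boxes to boxes of equal content, hence
  integrals agree.\<close>

lemma change_of_variables_area_preserving:
  fixes f :: "real \<times> real \<Rightarrow> real" and g :: "real \<times> real \<Rightarrow> real \<times> real"
  assumes S: "compact S"
    and der: "\<And>x. x \<in> S \<Longrightarrow> (g has_derivative g' x) (at x)"
    and inj: "inj_on g S"
    and det: "\<And>x. x \<in> S \<Longrightarrow>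
      \<bar>fst (g' x (1, 0)) * snd (g' x (0, 1)) - fst (g' x (0, 1)) * snd (g' x (1, 0))\<bar> = 1"
    and int: "(\<lambda>x. f (g x)) absolutely_integrable_on S"
  shows "f absolutely_integrable_on (g ` S)" "integral (g ` S) f = integral S (\<lambda>x. f (g x))"
proof -
  define G where "G v = vec_of_pair (g (pair_of_vec v))" for v
  define G' where "G' v = (\<lambda>u. vec_of_pair (g' (pair_of_vec v) (pair_of_vec u)))" for v
  have bS: "bounded S" using S by (rule compact_imp_bounded)
  have bgS: "bounded (g ` S)"
    using S der by (intro compact_imp_bounded compact_continuous_image)
      (meson continuous_at_imp_continuous_on has_derivative_continuous)
  have mem: "v \<in> vec_of_pair ` S \<longleftrightarrow> pair_of_vec v \<in> S" for v
    by (metis image_iff pair_of_vec_of_pair vec_of_pair_of_vec)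
  have GS: "G ` vec_of_pair ` S = vec_of_pair ` g ` S"
    by (simp add: G_def image_image)
  have compS: "vec_of_pair ` S \<in> sets lebesgue"
  proof -
    have "compact (vec_of_pair ` S)"
      using S by (intro compact_continuous_image)
        (simp_all add: bounded_linear_vec_of_pair linear_continuous_on)
    then show ?thesis by (simp add: borel_compact)
  qed
  have derG: "(G has_derivative G' v) (at v within vec_of_pair ` S)" if "v \<in> vec_of_pair ` S" for v
  proof -
    have "(g has_derivative g' (pair_of_vec v)) (at (pair_of_vec v))"
      using that der mem by auto
    then have "(G has_derivative G' v) (at v)"
      unfolding G_def G'_def
      by (intro bounded_linear.has_derivative[OF bounded_linear_vec_of_pair]
           has_derivative_compose[where f = pair_of_vec and g = g]
           bounded_linear_imp_has_derivative bounded_linear_pair_of_vec) 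
    then show ?thesis by (rule has_derivative_at_withinI)
  qed
  have injG: "inj_on G (vec_of_pair ` S)"
    using inj by (auto simp: inj_on_def G_def) (metis pair_of_vec_of_pair)
  have ax: "pair_of_vec (axis 1 1) = (1, 0)" "pair_of_vec (axis 2 1) = (0, 1)"
    by (simp_all add: pair_of_vec_def axis_def)
  have detG: "\<bar>det (matrix (G' v))\<bar> = 1" if "v \<in> vec_of_pair ` S" for v
    using det[of "pair_of_vec v"] that mem
    by (simp add: det_2 matrix_def G'_def ax algebra_simps)
  define fv where "fv v = (vec (f (pair_of_vec v)) :: real^1)" for v
  define b where "b = (vec (integral S (\<lambda>x. f (g x))) :: real^1)"
  have eq: "f (g (pair_of_vec v)) = f (pair_of_vec (G v))" for v by (simp add: G_def)
  have "(\<lambda>v. f (g (pair_of_vec v))) absolutely_integrable_on (vec_of_pair ` S)"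
    using int absolutely_integrable_pair_iff[OF bS, of "\<lambda>x. f (g x)"] by simp
  then have 1: "(\<lambda>v. fv (G v)) absolutely_integrable_on (vec_of_pair ` S)"
    unfolding fv_def absolutely_integrable_on_1_iff by (simp add: eq)
  have 2: "integral (vec_of_pair ` S) (\<lambda>v. fv (G v)) = b"
    using integral_pair_eq[OF bS, of "\<lambda>x. f (g x)"]
    unfolding fv_def b_def integral_on_1_eq by (simp add: eq)
  have "(\<lambda>v. \<bar>det (matrix (G' v))\<bar> *\<^sub>R fv (G v)) absolutely_integrable_on (vec_of_pair ` S) \<and>
     integral (vec_of_pair ` S) (\<lambda>v. \<bar>det (matrix (G' v))\<bar> *\<^sub>R fv (G v)) = b"
    using 1 2 detG by (auto cong: set_integrable_cong integral_cong)
  then have "fv absolutely_integrable_on (G ` vec_of_pair ` S) \<and> integral (G ` vec_of_pair ` S) fv = b"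
    using has_absolute_integral_change_of_variables[OF compS derG injG, of fv b] by blast
  then have 3: "fv absolutely_integrable_on (vec_of_pair ` g ` S)" "integral (vec_of_pair ` g ` S) fv = b"
    by (simp_all only: GS)
  show "f absolutely_integrable_on (g ` S)"
    using 3(1) unfolding fv_def absolutely_integrable_on_1_iff absolutely_integrable_pair_iff[OF bgS] by simp
  show "integral (g ` S) f = integral S (\<lambda>x. f (g x))"
    using 3(2) unfolding fv_def b_def integral_on_1_eq integral_pair_eq[OF bgS] by simp
qed

section \<open>Rigidity of the support function\<close>

lemma integral_periodic_shift:
  fixes f :: "real \<Rightarrow> real"
  assumes cont: "continuous_on UNIV f" and per: "\<And>x. f (x + p) = f x" and p: "p \<ge> 0"
  shows "integral {a..a + p} f = integral {0..p} f"
proof -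
  have int: "f integrable_on {u..v}" for u v
    by (intro integrable_continuous_interval continuous_on_subset[OF cont]) auto
  have "((\<lambda>x. integral {x..x + p} f) has_real_derivative 0) (at x)" for x
  proof -
    \<comment> \<open>A base point strictly to the left of \<open>x\<close> and
      \<open>x + p\<close>, so that the integral function has a two-sided derivative at
      both.\<close>
    define b where "b = x - 1"
    have der: "((\<lambda>u. integral {b..u} f) has_real_derivative f u) (at u)" if "b < u" for u
    proof -
      have "((\<lambda>u. integral {b..u} f) has_real_derivative f u) (at u within {b..u + 1})"
        using that by (intro integral_has_real_derivative continuous_on_subset[OF cont]) auto
      then show ?thesis
        using that by (simp add: at_within_Icc_at)
    qed
    have "((\<lambda>x. integral {b..x + p} f - integral {b..x} f) has_real_derivative f (x + p) - f x) (at x)"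
    proof (rule DERIV_diff)
      show "((\<lambda>u. integral {b..u} f) has_real_derivative f x) (at x)"
        by (rule der) (simp add: b_def)
      have "((\<lambda>u. integral {b..u} f) has_real_derivative f (x + p)) (at (x + p))"
        by (rule der) (use p in \<open>simp add: b_def\<close>)
      then show "((\<lambda>u. integral {b..u + p} f) has_real_derivative f (x + p)) (at x)"
        by (simp add: DERIV_shift)
    qed
    then have "((\<lambda>x. integral {b..x + p} f - integral {b..x} f) has_real_derivative 0) (at x)"
      by (simp add: per)
    then show ?thesis
    proof (rule has_field_derivative_transform_within_open[where S = "{b<..}"])
      show "integral {b..u + p} f - integral {b..u} f = integral {u..u + p} f" if "u \<in> {b<..}" for u
        using Henstock_Kurzweil_Integration.integral_combine[of b u "u + p" f] that p int by simp
    qed (auto simp: b_def)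
  qed
  then have "integral {a..a + p} f = integral {0..0 + p} f"
    by (intro DERIV_isconst_all[where f = "\<lambda>x. integral {x..x + p} f"]) blast
  then show ?thesis by simp
qed

text \<open>Antiperiodicity gives \<open>2 v(x) = - \<integral> v'\<close> over the half period starting at \<open>x\<close>.\<close>

lemma antiperiodic_bound:
  fixes v v' :: "real \<Rightarrow> real"
  assumes der: "\<And>x. (v has_real_derivative v' x) (at x)"
    and cont: "continuous_on UNIV v'"
    and anti: "\<And>x. v (x + p) = - v x" and p: "p > 0"
  shows "4 * (v x)\<^sup>2 \<le> p * integral {0..p} (\<lambda>x. (v' x)\<^sup>2)"
proof -
  have anti': "v' (x + p) = - v' x" for x
  proof -
    have "(v has_real_derivative v' (x + p)) (at (x + p))" by (rule der)
    then have "((\<lambda>x. v (x + p)) has_real_derivative v' (x + p)) (at x)" by (simp add: DERIV_shift)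
    then have "((\<lambda>x. - v x) has_real_derivative v' (x + p)) (at x)" by (simp add: anti)
    moreover have "((\<lambda>x. - v x) has_real_derivative - v' x) (at x)"
      by (intro derivative_intros der)
    ultimately show ?thesis by (rule DERIV_unique)
  qed
  define E where "E = integral {0..p} (\<lambda>x. (v' x)\<^sup>2)"
  have contv': "continuous_on S v'" for S
    by (rule continuous_on_subset[OF cont]) auto
  have int: "g integrable_on {u..w}" if "continuous_on UNIV g" for g :: "real \<Rightarrow> real" and u w
    by (intro integrable_continuous_interval continuous_on_subset[OF that]) auto
  show ?thesis
  proof -
    have Ex: "integral {x..x + p} (\<lambda>x. (v' x)\<^sup>2) = E"
      unfolding E_def
      by (rule integral_periodic_shift) (use p in \<open>auto simp: anti' intro!: continuous_intros contv'\<close>)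
    have "(v' has_integral v (x + p) - v x) {x..x + p}"
      using p by (intro fundamental_theorem_of_calculus)
        (auto intro: has_field_derivative_at_within der simp flip: has_real_derivative_iff_has_vector_derivative)
    then have I1: "integral {x..x + p} v' = - 2 * v x"
      by (simp add: anti integral_unique)
    \<comment> \<open>The mean of \<open>v'\<close> over \<open>[x, x + p]\<close>. Expanding the
      square of \<open>v' - a\<close> proves the Cauchy-Schwarz inequality for \<open>v'\<close> and
      the constant function.\<close>
    define a where "a = - 2 * v x / p"
    have "0 \<le> integral {x..x + p} (\<lambda>t. (v' t - a)\<^sup>2)"
      by (intro integral_nonneg int continuous_intros contv') auto
    also have "integral {x..x + p} (\<lambda>t. (v' t - a)\<^sup>2) =
        integral {x..x + p} (\<lambda>t. (v' t)\<^sup>2 - 2 * a * v' t + a\<^sup>2)"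
      by (intro integral_cong) (simp add: power2_eq_square algebra_simps)
    also have "\<dots> = E - 2 * a * (- 2 * v x) + a\<^sup>2 * p"
      using p by (simp add: Henstock_Kurzweil_Integration.integral_add Henstock_Kurzweil_Integration.integral_diff
         int continuous_intros contv' Ex I1)
    also have "\<dots> = E - 4 * (v x)\<^sup>2 / p"
      using p unfolding a_def by (simp add: field_simps power2_eq_square)
    finally show ?thesis using p unfolding E_def by (simp add: field_simps)
  qed
qed

text \<open>The function is even with derivative \<open>y * cos y\<close>. It occurs in the
  coefficient of \<open>w\<^sup>2\<close> in \<open>support_function_rigidity\<close>.\<close>

lemma mult_sin_add_cos_ge_1:
  fixes y :: real
  assumes "\<bar>y\<bar> \<le> pi / 2"
  shows "1 \<le> y * sin y + cos y"
proof -
  have "0 * sin 0 + cos 0 \<le> \<bar>y\<bar> * sin \<bar>y\<bar> + cos \<bar>y\<bar>"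
  proof (rule DERIV_nonneg_imp_nondecreasing[where f = "\<lambda>y. y * sin y + cos y"])
    fix x assume x: "0 \<le> x" "x \<le> \<bar>y\<bar>"
    then have "0 \<le> x * cos x"
      using assms by (intro mult_nonneg_nonneg cos_ge_zero) auto
    moreover have "((\<lambda>y. y * sin y + cos y) has_real_derivative x * cos x) (at x)"
      by (auto intro!: derivative_eq_intros)
    ultimately show "\<exists>y. ((\<lambda>y. y * sin y + cos y) has_real_derivative y) (at x) \<and> 0 \<le> y" by blast
  qed simp
  then show ?thesis by (cases "y \<ge> 0") auto
qed

lemma integral_double_period:
  fixes f :: "real \<Rightarrow> real"
  assumes cont: "continuous_on UNIV f" and per: "\<And>x. f (x + p) = f x" and p: "p \<ge> 0"
  shows "integral {0..2 * p} f = 2 * integral {0..p} f"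
proof -
  have "integral {0..2 * p} f = integral {0..p} f + integral {p..2 * p} f"
    using p by (intro Henstock_Kurzweil_Integration.integral_combine[symmetric]
      integrable_continuous_interval continuous_on_subset[OF cont]) auto
  then show ?thesis
    using integral_periodic_shift[OF cont per p, of p] by simp
qed

lemma integral_periodic_translate:
  fixes f :: "real \<Rightarrow> real"
  assumes cont: "continuous_on UNIV f" and per: "\<And>x. f (x + p) = f x" and p: "p \<ge> 0"
  shows "integral {0..p} (\<lambda>x. f (x + a)) = integral {0..p} f"
proof -
  have "integral {0..p} (\<lambda>x. f (x + a)) = integral {a..a + p} f"
    using integral_shift[where f = f and a = 0 and b = p and c = a] continuous_on_subset[OF cont]
    by (simp add: o_def add.commute)
  then show ?thesis using integral_periodic_shift[OF cont per p] by simp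
qed

text \<open>Here \<open>h'' + h\<close> is the radius of curvature and the last factor is
  \<open>pi - 2 * \<delta> + sin (2 * \<delta>)\<close>. After symmetrisation, and up to an exact
  derivative, the coefficients of \<open>\<delta>''\<^sup>2\<close> and \<open>\<delta>'^4\<close>
  are nonnegative; only the term in \<open>\<delta>'\<^sup>2\<close> has the wrong sign, and
  \<open>antiperiodic_bound\<close> absorbs it.\<close>

theorem support_function_rigidity:
  fixes h h' h'' :: "real \<Rightarrow> real"
  assumes der_h: "\<And>x. (h has_real_derivative h' x) (at x)"
    and der_h': "\<And>x. (h' has_real_derivative h'' x) (at x)"
    and cont_h'': "continuous_on UNIV h''"
    and h_pos: "\<And>x. h x > 0"
    and h_per: "\<And>x. h (x + pi) = h x"
    and R: "R > 0" and h_R: "\<And>x. (h x)\<^sup>2 + (h (x + pi / 2))\<^sup>2 = R\<^sup>2"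
    and le: "integral {0..2 * pi} (\<lambda>x. h'' x * (h'' x + h x) *
        (pi - 2 * arcsin (h x / R) + 2 * (h x / R) * (h (x + pi / 2) / R))) \<le> 0"
  shows "h' x = 0"
proof -
  define S where "S x = h x / R" for x
  define C where "C x = h (x + pi / 2) / R" for x
  define d where "d x = arcsin (S x)" for x
  have SC: "(S x)\<^sup>2 + (C x)\<^sup>2 = 1" for x
    using h_R[of x] R by (simp add: S_def C_def power_divide flip: add_divide_distrib)
  have S_pos: "S x > 0" and C_pos: "C x > 0" for x
    using h_pos R by (simp_all add: S_def C_def)
  have S_shift: "S (x + pi / 2) = C x" for x by (simp add: S_def C_def)
  have C_shift: "C (x + pi / 2) = S x" for x
    using h_per[of x] by (simp add: S_def C_def add.assoc)
  have S_lt: "S x < 1" for x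
    using SC[of x] C_pos[of x] S_pos[of x]
    by (smt (verit) one_le_power zero_less_power)
  have sin_d: "sin (d x) = S x" for x
    using S_pos[of x] S_lt[of x] by (simp add: d_def)
  have d_bounds: "0 < d x" "d x < pi / 2" for x
    using S_pos[of x] S_lt[of x] arcsin_less_arcsin[of 0 "S x"] arcsin_lt_bounded[of "S x"]
    by (simp_all add: d_def)
  have cos_d: "cos (d x) = C x" for x
  proof -
    have "cos (d x) = sqrt (1 - (S x)\<^sup>2)"
      using S_pos[of x] S_lt[of x] by (simp add: d_def cos_arcsin)
    then show ?thesis
      using SC[of x] C_pos[of x] by (simp add: real_sqrt_unique)
  qed
  have d_shift: "d (x + pi / 2) = pi / 2 - d x" for x
  proof -
    have "sin (pi / 2 - d x) = S (x + pi / 2)"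
      by (simp add: sin_diff cos_d S_shift)
    then have "d (x + pi / 2) = arcsin (sin (pi / 2 - d x))" by (simp add: d_def[of "x + pi / 2"])
    also have "\<dots> = pi / 2 - d x" using d_bounds[of x] by (intro arcsin_sin) auto
    finally show ?thesis .
  qed
  define S' where "S' x = h' x / R" for x
  define S'' where "S'' x = h'' x / R" for x
  define v where "v x = S' x / C x" for x
  have der_S: "(S has_real_derivative S' x) (at x)" for x
    unfolding S_def S'_def using der_h by (rule DERIV_cdivide)
  have der_S': "(S' has_real_derivative S'' x) (at x)" for x
    unfolding S'_def S''_def using der_h' by (rule DERIV_cdivide)
  have der_d: "(d has_real_derivative v x) (at x)" for x
  proof -
    have "(arcsin has_real_derivative inverse (sqrt (1 - (S x)\<^sup>2))) (at (S x))"
      using S_pos[of x] S_lt[of x] by (intro DERIV_arcsin) auto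
    then have "((\<lambda>x. arcsin (S x)) has_real_derivative inverse (sqrt (1 - (S x)\<^sup>2)) * S' x) (at x)"
      by (rule DERIV_chain2[OF _ der_S])
    moreover have "sqrt (1 - (S x)\<^sup>2) = C x"
      using SC[of x] C_pos[of x] by (simp add: real_sqrt_unique)
    ultimately show ?thesis by (simp add: d_def[abs_def] v_def field_simps)
  qed
  have der_C: "(C has_real_derivative - S x * v x) (at x)" for x
  proof -
    have "((\<lambda>x. cos (d x)) has_real_derivative - sin (d x) * v x) (at x)"
      by (rule DERIV_chain2[OF DERIV_cos der_d])
    then show ?thesis by (simp add: cos_d sin_d)
  qed
  \<comment> \<open>The second derivative of \<delta>, found by solving
    \<open>S'' = C * w - S * v\<^sup>2\<close>; no derivative of \<open>h''\<close> enters.\<close>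
  define w where "w x = (S'' x + S x * (v x)\<^sup>2) / C x" for x
  have der_v: "(v has_real_derivative w x) (at x)" for x
  proof -
    have "((\<lambda>x. S' x / C x) has_real_derivative (S'' x * C x - S' x * (- S x * v x)) / (C x * C x)) (at x)"
      by (rule DERIV_divide[OF der_S' der_C]) (use C_pos[of x] in simp)
    moreover have "(S'' x * C x - S' x * (- S x * v x)) / (C x * C x) = w x"
      using C_pos[of x] by (simp add: w_def v_def field_simps power2_eq_square)
    ultimately show ?thesis by (simp add: v_def[abs_def])
  qed
  have v_shift: "v (x + pi / 2) = - v x" for x
  proof -
    have "((\<lambda>x. d (x + pi / 2)) has_real_derivative v (x + pi / 2)) (at x)"
      using der_d[of "x + pi / 2"] by (simp add: DERIV_shift)
    moreover have "((\<lambda>x. pi / 2 - d x) has_real_derivative - v x) (at x)"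
      using DERIV_diff[OF DERIV_const der_d, of "pi / 2"] by simp
    ultimately show ?thesis by (auto simp: d_shift intro: DERIV_unique)
  qed
  have w_shift: "w (x + pi / 2) = - w x" for x
  proof -
    have "((\<lambda>x. v (x + pi / 2)) has_real_derivative w (x + pi / 2)) (at x)"
      using der_v[of "x + pi / 2"] by (simp add: DERIV_shift)
    moreover have "((\<lambda>x. - v x) has_real_derivative - w x) (at x)"
      by (intro derivative_intros der_v)
    ultimately show ?thesis by (auto simp: v_shift intro: DERIV_unique)
  qed
  have S''_eq: "S'' x = C x * w x - S x * (v x)\<^sup>2" for x
    using C_pos[of x] by (simp add: w_def)
  have contS: "continuous_on A S" and contC: "continuous_on A C" and contd: "continuous_on A d"
    and contv: "continuous_on A v" for A
    using der_S der_C der_d der_v by (meson DERIV_isCont continuous_at_imp_continuous_on)+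
  have contw: "continuous_on A w" for A
    unfolding w_def S''_def using C_pos R
    by (intro continuous_intros contS contC contv continuous_on_subset[OF cont_h''])
       (auto simp: less_le)
  \<comment> \<open>\<open>b\<close> is \<open>a\<close> shifted by \<open>pi / 2\<close>: the shift
    replaces \<open>d\<close> by \<open>pi / 2 - d\<close> and exchanges \<open>S\<close> with
    \<open>C\<close>.\<close>
  define a where "a x = pi - 2 * d x + 2 * S x * C x" for x
  define b where "b x = 2 * d x + 2 * S x * C x" for x
  define I where "I x = S'' x * (S'' x + S x) * a x" for x
  have I_per: "I (x + 2 * pi) = I x" for x
  proof -
    have eq: "y + 2 * pi = y + pi / 2 + pi / 2 + pi / 2 + pi / 2" for y by simp
    show ?thesis
      unfolding eq I_def a_def S''_eq S_shift C_shift d_shift v_shift w_shift by simp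
  qed
  have contI: "continuous_on UNIV I"
    unfolding I_def a_def S''_eq
    by (intro continuous_intros contS contC contd contv contw)
  have int: "g integrable_on {u..w}" if "continuous_on UNIV g" for g :: "real \<Rightarrow> real" and u w
    by (intro integrable_continuous_interval continuous_on_subset[OF that]) auto
  have "(\<lambda>x. h'' x * (h'' x + h x) *
      (pi - 2 * arcsin (h x / R) + 2 * (h x / R) * (h (x + pi / 2) / R))) = (\<lambda>x. R\<^sup>2 * I x)"
    using R by (intro ext) (simp add: I_def a_def S''_def S_def C_def d_def power2_eq_square field_simps)
  then have "R\<^sup>2 * integral {0..2 * pi} I \<le> 0"
    using le by simp
  then have I_le: "integral {0..2 * pi} I \<le> 0"
    using R by (simp add: mult_le_0_iff)
  \<comment> \<open>The coefficients of \<open>v\<^sup>2 * w\<close> and of \<open>w\<close> in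
    \<open>G\<close>, namely \<open>2 * S * C * (b - a)\<close> and \<open>S * C * (a - b)\<close>.
    The primed versions are derivatives with respect to the angle \<open>d\<close>, so the chain
    rule adds a factor \<open>v\<close>.\<close>
  define m where "m x = 2 * S x * C x * (4 * d x - pi)" for x
  define n where "n x = S x * C x * (pi - 4 * d x)" for x
  define m' where "m' x = 2 * ((C x)\<^sup>2 - (S x)\<^sup>2) * (4 * d x - pi) + 8 * S x * C x" for x
  define n' where "n' x = ((C x)\<^sup>2 - (S x)\<^sup>2) * (pi - 4 * d x) - 4 * S x * C x" for x
  txt \<open>\<open>Z'\<close> collects the terms of the symmetrised integrand that contain \<open>w\<close> linearly.\<close>
  define Z where "Z x = m x * (v x)^3 / 3 + n x * v x" for x
  define Z' where "Z' x = m' x * (v x)^4 / 3 + m x * (v x)\<^sup>2 * w x + n' x * (v x)\<^sup>2 + n x * w x" for x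
  have S'_eq: "S' x = C x * v x" for x using C_pos[of x] by (simp add: v_def)
  have der_Z: "(Z has_real_derivative Z' x) (at x)" for x
  proof -
    have dm: "(m has_real_derivative m' x * v x) (at x)"
      unfolding m_def[abs_def]
      by (rule derivative_eq_intros der_S der_C der_d refl)+
         (simp add: m'_def S'_eq algebra_simps power2_eq_square)
    have dn: "(n has_real_derivative n' x * v x) (at x)"
      unfolding n_def[abs_def]
      by (rule derivative_eq_intros der_S der_C der_d refl)+
         (simp add: n'_def S'_eq algebra_simps power2_eq_square)
    have "(Z has_real_derivative (m' x * v x * (v x)^3 + m x * (3 * (v x)\<^sup>2 * w x)) / 3
        + (n' x * v x * v x + n x * w x)) (at x)"
      unfolding Z_def[abs_def]
      by (auto intro!: derivative_eq_intros dm dn der_v simp: power2_eq_square)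
    then show ?thesis
      by (rule DERIV_cong) (simp add: Z'_def field_simps power2_eq_square power3_eq_cube power4_eq_xxxx)
  qed
  have Z_shift: "Z (x + pi / 2) = Z x" for x
    unfolding Z_def m_def n_def S_shift C_shift d_shift v_shift by (simp add: algebra_simps)
  define G where "G x = I x + I (x + pi / 2)" for x
  have I_shift_eq: "I (x + pi / 2) = (S x * w x + C x * (v x)\<^sup>2) * (S x * w x + C x * (v x)\<^sup>2 - C x) * b x" for x
    unfolding I_def a_def b_def S''_eq S_shift C_shift d_shift v_shift w_shift
    by (simp add: algebra_simps)
  have G_eq: "G x = Z' x + (a x * (C x)\<^sup>2 + b x * (S x)\<^sup>2) * (w x)\<^sup>2
      + (a x * (S x)\<^sup>2 + b x * (C x)\<^sup>2 - m' x / 3) * (v x)^4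
      - (n' x + a x * (S x)\<^sup>2 + b x * (C x)\<^sup>2) * (v x)\<^sup>2" for x
    unfolding G_def I_shift_eq unfolding I_def S''_eq Z'_def m_def n_def a_def b_def
    by (simp add: field_simps power2_eq_square power4_eq_xxxx)
  have G_ge: "Z' x + (pi / 2 + 1) * (w x)\<^sup>2 - pi * (v x)\<^sup>2 \<le> G x" for x
  proof -
    \<comment> \<open>Centred at \<open>d = pi / 4\<close>, the fixed point of the shift. All
      coefficients become combinations of \<open>y * sin y\<close> and \<open>cos y\<close>.\<close>
    define y where "y = 2 * d x - pi / 2"
    have y: "\<bar>y\<bar> \<le> pi / 2" using d_bounds[of x] unfolding y_def by linarith
    have cy: "cos y = 2 * S x * C x"
      by (simp add: y_def cos_diff sin_double sin_d cos_d)
    have sy: "sin y = (S x)\<^sup>2 - (C x)\<^sup>2"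
      by (simp add: y_def sin_diff cos_double sin_d cos_d)
    have d_eq: "d x = y / 2 + pi / 4" by (simp add: y_def field_simps)
    have C2: "(C x)\<^sup>2 = (1 - sin y) / 2" and S2: "(S x)\<^sup>2 = (1 + sin y) / 2"
      using SC[of x] sy by auto
    have a_eq: "a x = pi / 2 - y + cos y" and b_eq: "b x = pi / 2 + y + cos y"
      unfolding a_def b_def cy[symmetric] d_eq by (simp_all add: field_simps)
    have m'_eq: "m' x = - 4 * y * sin y + 4 * cos y"
    proof -
      have "8 * S x * C x = 4 * cos y" by (simp add: cy)
      then show ?thesis unfolding m'_def C2 S2 d_eq by (simp add: field_simps)
    qed
    have n'_eq: "n' x = 2 * y * sin y - 2 * cos y"
    proof -
      have "4 * S x * C x = 2 * cos y" by (simp add: cy)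
      then show ?thesis unfolding n'_def C2 S2 d_eq by (simp add: field_simps)
    qed
    have cos0: "0 \<le> cos y" using y by (intro cos_ge_zero) auto
    have ysin: "0 \<le> y * sin y"
    proof (cases "y \<ge> 0")
      case True then show ?thesis using y by (intro mult_nonneg_nonneg sin_ge_zero) auto
    next
      case False
      then have "0 \<le> sin (- y)" using y by (intro sin_ge_zero) auto
      with False show ?thesis by (simp add: mult_nonpos_nonpos)
    qed
    have ysin': "y * sin y \<le> pi / 2"
    proof -
      have "y * sin y \<le> \<bar>y\<bar> * \<bar>sin y\<bar>" by (metis abs_ge_self abs_mult)
      also have "\<dots> \<le> \<bar>y\<bar> * 1" by (intro mult_left_mono) auto
      finally show ?thesis using y by simp
    qed
    have "a x * (C x)\<^sup>2 + b x * (S x)\<^sup>2 = pi / 2 + (y * sin y + cos y)"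
      unfolding C2 S2 a_eq b_eq by (simp add: field_simps)
    also have "\<dots> \<ge> pi / 2 + 1" using mult_sin_add_cos_ge_1[OF y] by simp
    finally have c1: "pi / 2 + 1 \<le> a x * (C x)\<^sup>2 + b x * (S x)\<^sup>2" .
    have "a x * (S x)\<^sup>2 + b x * (C x)\<^sup>2 - m' x / 3 = pi / 2 + (y * sin y - cos y) / 3"
      unfolding C2 S2 a_eq b_eq m'_eq by (simp add: field_simps)
    also have "\<dots> \<ge> 0" using ysin cos_le_one[of y] pi_gt3 by argo
    finally have c2: "0 \<le> a x * (S x)\<^sup>2 + b x * (C x)\<^sup>2 - m' x / 3" .
    have "n' x + a x * (S x)\<^sup>2 + b x * (C x)\<^sup>2 = pi / 2 + y * sin y - cos y"
      unfolding C2 S2 a_eq b_eq n'_eq by (simp add: field_simps)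
    also have "\<dots> \<le> pi" using ysin' cos0 by argo
    finally have c3: "n' x + a x * (S x)\<^sup>2 + b x * (C x)\<^sup>2 \<le> pi" .
    have "(pi / 2 + 1) * (w x)\<^sup>2 \<le> (a x * (C x)\<^sup>2 + b x * (S x)\<^sup>2) * (w x)\<^sup>2"
      using c1 by (intro mult_right_mono) auto
    moreover have "0 \<le> (a x * (S x)\<^sup>2 + b x * (C x)\<^sup>2 - m' x / 3) * (v x)^4"
      using c2 by (intro mult_nonneg_nonneg) auto
    moreover have "(n' x + a x * (S x)\<^sup>2 + b x * (C x)\<^sup>2) * (v x)\<^sup>2 \<le> pi * (v x)\<^sup>2"
      using c3 by (intro mult_right_mono) auto
    ultimately show ?thesis unfolding G_eq by linarith
  qed
  have contIs: "continuous_on UNIV (\<lambda>x. I (x + pi / 2))"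
    by (rule continuous_on_compose2[OF contI]) (auto intro!: continuous_intros)
  have contG: "continuous_on UNIV G"
    unfolding G_def by (intro continuous_intros contI contIs)
  have I_per1: "I (x + pi / 2 + pi / 2) = I x" for x
    unfolding I_def a_def S''_eq S_shift C_shift d_shift v_shift w_shift by simp
  have G_per: "G (x + pi / 2) = G x" for x unfolding G_def I_per1 by simp
  have "integral {0..2 * pi} G = integral {0..2 * pi} I + integral {0..2 * pi} (\<lambda>x. I (x + pi / 2))"
    unfolding G_def by (intro Henstock_Kurzweil_Integration.integral_add int contI contIs)
  also have "\<dots> = 2 * integral {0..2 * pi} I"
    by (simp add: integral_periodic_translate[OF contI I_per])
  finally have "integral {0..2 * pi} G \<le> 0" using I_le by simp
  moreover have "integral {0..2 * pi} G = 4 * integral {0..pi / 2} G"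
    using integral_double_period[OF contG, of pi] integral_double_period[OF contG, of "pi / 2"] G_per
    by (metis (no_types, opaque_lifting) field_sum_of_halves add.assoc mult_2 pi_ge_zero pi_half_ge_zero
       mult.assoc numeral_Bit0 distrib_right)
  ultimately have G_le: "integral {0..pi / 2} G \<le> 0" by simp
  define E where "E = integral {0..pi / 2} (\<lambda>x. (w x)\<^sup>2)"
  define V where "V = integral {0..pi / 2} (\<lambda>x. (v x)\<^sup>2)"
  have bound: "4 * (v x)\<^sup>2 \<le> pi / 2 * E" for x
    unfolding E_def by (rule antiperiodic_bound[OF der_v contw v_shift]) simp
  \<comment> \<open>Integrating the pointwise bound gives the constant
    \<open>pi\<^sup>2 / 16\<close> in place of the sharp Poincare constant \<open>1 / 4\<close>,
    attained by \<open>sin (2 * x)\<close>. It still suffices.\<close>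
  have "integral {0..pi / 2} (\<lambda>x. 4 * (v x)\<^sup>2) \<le> integral {0..pi / 2} (\<lambda>x. pi / 2 * E)"
    by (intro integral_le int continuous_intros contv bound)
  then have VE: "16 * V \<le> pi\<^sup>2 * E"
    unfolding V_def by (simp add: power2_eq_square)
  have "(Z' has_integral Z (pi / 2) - Z 0) {0..pi / 2}"
    by (intro fundamental_theorem_of_calculus)
       (auto intro: has_field_derivative_at_within der_Z simp flip: has_real_derivative_iff_has_vector_derivative)
  then have Z0: "(Z' has_integral 0) {0..pi / 2}"
    using Z_shift[of 0] by simp
  have "((\<lambda>x. Z' x + (pi / 2 + 1) * (w x)\<^sup>2 - pi * (v x)\<^sup>2) has_integral 0 + (pi / 2 + 1) * E - pi * V) {0..pi / 2}"
    unfolding E_def V_def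
    by (intro has_integral_add has_integral_diff has_integral_mult_right Z0 integrable_integral int continuous_intros contv contw)
  then have "0 + (pi / 2 + 1) * E - pi * V \<le> integral {0..pi / 2} G"
    by (rule has_integral_le[OF _ integrable_integral[OF int[OF contG]]]) (rule G_ge)
  then have *: "(pi / 2 + 1) * E \<le> pi * V" using G_le by simp
  have "E \<le> 0"
  proof (rule ccontr)
    assume E: "\<not> E \<le> 0"
    \<comment> \<open>\<open>pi > 3\<close> makes \<open>16 * (pi / 2 + 1)\<close> exceed 40, while
      \<open>(32 / 10) ^ 3 < 33\<close>.\<close>
    have pi32: "pi \<le> 32 / 10" using pi_approx by simp
    have "16 * (pi / 2 + 1) * E \<le> pi * (16 * V)"
      using * by argo
    also have "\<dots> \<le> pi * (pi\<^sup>2 * E)"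
      by (intro mult_left_mono VE) simp
    finally have "16 * (pi / 2 + 1) * E \<le> pi * (pi\<^sup>2 * E)" .
    then have "16 * (pi / 2 + 1) \<le> pi ^ 3"
      using E by (simp add: power3_eq_cube power2_eq_square mult.assoc[symmetric])
    also have "pi ^ 3 \<le> (32 / 10) ^ 3" using pi32 by (intro power_mono) auto
    finally show False using pi_gt3 by (simp add: power3_eq_cube)
  qed
  then have "v x = 0"
  proof -
    have "pi / 2 * E \<le> 0" using \<open>E \<le> 0\<close> by (simp add: mult_nonneg_nonpos)
    then have "(v x)\<^sup>2 \<le> 0" using bound[of x] by linarith
    then show ?thesis by simp
  qed
  then show ?thesis using C_pos[of x] R by (simp add: v_def S'_def)
qed

section \<open>Centrally symmetric ovals\<close>

lemma inner_cis: "cis a \<bullet> cis b = cos (a - b)"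
  "(\<i> * cis a) \<bullet> cis b = - sin (a - b)" "cis a \<bullet> (\<i> * cis b) = sin (a - b)"
  "(\<i> * cis a) \<bullet> (\<i> * cis b) = cos (a - b)"
  by (simp_all add: inner_complex_def cos_diff sin_diff)

lemma cis_plus_pi: "cis (a + pi) = - cis a"
  by (simp add: complex_eq_iff)

lemma cis_plus_2pi: "cis (a + 2 * pi) = cis a"
  by (simp add: complex_eq_iff)

lemma cis_vector_derivative: "(cis has_vector_derivative (\<i> * cis t)) (at t)"
  by (auto simp: has_vector_derivative_complex_iff intro!: derivative_eq_intros)

lemma cis_frame_decomposition:
  "z = (z \<bullet> cis a) *\<^sub>R cis a + (z \<bullet> (\<i> * cis a)) *\<^sub>R (\<i> * cis a)"
proof -
  have *: "(cos a)\<^sup>2 + (sin a)\<^sup>2 = 1" by simp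
  have "Re z = (Re z * cos a + Im z * sin a) * cos a - (- Re z * sin a + Im z * cos a) * sin a"
    "Im z = (Re z * cos a + Im z * sin a) * sin a + (- Re z * sin a + Im z * cos a) * cos a"
    using * by algebra+
  then show ?thesis by (intro complex_eqI) (simp_all add: inner_complex_def)
qed

text \<open>
  The angle \<open>\<Theta> s\<close> is that of the outer normal at \<open>\<gamma> s\<close>, and \<open>c\<close> is the centre of symmetry.
\<close>

locale oval =
  fixes \<gamma> :: "real \<Rightarrow> complex" and L :: real and c :: complex and \<Theta> k :: "real \<Rightarrow> real"
  assumes L_pos: "L > 0"
    and gamma_deriv: "(\<gamma> has_vector_derivative (\<i> * cis (\<Theta> s))) (at s)"
    and Theta_deriv: "(\<Theta> has_real_derivative k s) (at s)"
    and k_pos: "k s > 0"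
    and k_cont: "continuous_on UNIV k"
    and gamma_period: "\<gamma> (s + L) = \<gamma> s"
    and Theta_period: "\<Theta> (s + L) = \<Theta> s + 2 * pi"
    and symmetric: "(\<lambda>z. 2 * c - z) ` range \<gamma> = range \<gamma>"
begin

lemma Theta_strict_mono: "s < t \<Longrightarrow> \<Theta> s < \<Theta> t"
  by (rule DERIV_pos_imp_increasing[where f = \<Theta>]) (use Theta_deriv k_pos in blast)+

lemma Theta_less_iff [simp]: "\<Theta> s < \<Theta> t \<longleftrightarrow> s < t"
  by (metis Theta_strict_mono linorder_neqE_linordered_idom order.asym)

lemma Theta_le_iff [simp]: "\<Theta> s \<le> \<Theta> t \<longleftrightarrow> s \<le> t"
  by (meson Theta_less_iff linorder_not_le)

lemma Theta_eq_iff [simp]: "\<Theta> s = \<Theta> t \<longleftrightarrow> s = t"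
  by (metis Theta_less_iff linorder_neqE_linordered_idom order.irrefl)

lemma Theta_cont: "continuous_on A \<Theta>"
  using Theta_deriv by (meson DERIV_isCont continuous_at_imp_continuous_on)

lemma gamma_cont: "continuous_on A \<gamma>"
  using gamma_deriv by (meson has_vector_derivative_continuous continuous_at_imp_continuous_on)

lemma Theta_add_nat: "\<Theta> (s + real n * L) = \<Theta> s + 2 * pi * real n"
proof (induction n)
  case (Suc n)
  have eq: "s + real (Suc n) * L = (s + real n * L) + L" by (simp add: algebra_simps)
  show ?case unfolding eq Theta_period Suc by (simp add: algebra_simps)
qed simp

lemma Theta_surj: "\<exists>s. \<Theta> s = \<psi>"
proof -
  obtain n where n: "\<psi> - \<Theta> 0 \<le> 2 * pi * real n"
    using real_arch_simple[of "(\<psi> - \<Theta> 0) / (2 * pi)"] by (auto simp: field_simps)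
  obtain m where m: "\<Theta> 0 - \<psi> \<le> 2 * pi * real m"
    using real_arch_simple[of "(\<Theta> 0 - \<psi>) / (2 * pi)"] by (auto simp: field_simps)
  have "\<Theta> (- real m * L) \<le> \<psi>"
    using Theta_add_nat[of "- real m * L" m] m by simp
  moreover have "\<psi> \<le> \<Theta> (real n * L)"
    using Theta_add_nat[of 0 n] n by simp
  moreover have "- real m * L \<le> real n * L"
    using L_pos by (intro mult_right_mono) auto
  ultimately show ?thesis
    using IVT'[of \<Theta> "- real m * L" \<psi> "real n * L"] Theta_cont by blast
qed

definition \<sigma> :: "real \<Rightarrow> real" where "\<sigma> = inv \<Theta>"

lemma Theta_sigma [simp]: "\<Theta> (\<sigma> \<psi>) = \<psi>"
  unfolding \<sigma>_def by (rule f_inv_into_f) (use Theta_surj in \<open>metis rangeI\<close>)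

lemma sigma_Theta [simp]: "\<sigma> (\<Theta> s) = s"
  using Theta_sigma[of "\<Theta> s"] unfolding Theta_eq_iff .

lemma sigma_less_iff [simp]: "\<sigma> a < \<sigma> b \<longleftrightarrow> a < b"
  using Theta_less_iff[of "\<sigma> a" "\<sigma> b"] by simp

lemma sigma_period: "\<sigma> (\<psi> + 2 * pi) = \<sigma> \<psi> + L"
  by (metis Theta_period Theta_sigma sigma_Theta)

lemma sigma_isCont: "isCont \<sigma> \<psi>"
proof -
  have "isCont \<sigma> (\<Theta> (\<sigma> \<psi>))"
    by (rule isCont_inverse_function2[of "\<sigma> \<psi> - 1" _ "\<sigma> \<psi> + 1"])
       (use Theta_deriv DERIV_isCont in auto)
  then show ?thesis by simp
qed

text \<open>The radius of curvature as a function of the normal angle, the density of arclength with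
  respect to that angle.\<close>

definition \<rho> :: "real \<Rightarrow> real" where "\<rho> \<psi> = 1 / k (\<sigma> \<psi>)"

lemma rho_pos: "\<rho> \<psi> > 0"
  using k_pos by (simp add: \<rho>_def)

lemma sigma_cont: "continuous_on A \<sigma>"
  using sigma_isCont by (simp add: continuous_at_imp_continuous_on)

lemma rho_cont: "continuous_on A \<rho>"
proof -
  have "continuous_on A (\<lambda>\<psi>. k (\<sigma> \<psi>))"
    by (rule continuous_on_compose2[OF k_cont sigma_cont]) auto
  then show ?thesis
    unfolding \<rho>_def using k_pos by (intro continuous_intros) (auto simp: less_le)
qed

lemma sigma_deriv: "(\<sigma> has_real_derivative \<rho> \<psi>) (at \<psi>)"
proof -
  have "(\<sigma> has_real_derivative inverse (k (\<sigma> \<psi>))) (at \<psi>)"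
    by (rule DERIV_inverse_function[where f = \<Theta> and a = "\<psi> - 1" and b = "\<psi> + 1"])
       (use Theta_deriv k_pos sigma_isCont in \<open>auto simp: less_le\<close>)
  then show ?thesis by (simp add: \<rho>_def inverse_eq_divide)
qed

section \<open>Position, support function and central symmetry\<close>

definition P :: "real \<Rightarrow> complex" where "P \<psi> = \<gamma> (\<sigma> \<psi>) - c"

lemma P_Theta: "P (\<Theta> s) = \<gamma> s - c"
  by (simp add: P_def)

lemma P_period: "P (\<psi> + 2 * pi) = P \<psi>"
  by (simp add: P_def sigma_period gamma_period)

lemma P_period': "P (\<psi> - 2 * pi) = P \<psi>"
  using P_period[of "\<psi> - 2 * pi"] by simp

lemma P_deriv: "(P has_vector_derivative (\<rho> \<psi> *\<^sub>R (\<i> * cis \<psi>))) (at \<psi>)"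
proof -
  have "((\<gamma> \<circ> \<sigma>) has_vector_derivative (\<rho> \<psi> *\<^sub>R (\<i> * cis (\<Theta> (\<sigma> \<psi>))))) (at \<psi>)"
    by (rule vector_diff_chain_at)
       (use sigma_deriv gamma_deriv[of "\<sigma> \<psi>"] in \<open>auto simp flip: has_real_derivative_iff_has_vector_derivative\<close>)
  then show ?thesis
    unfolding P_def[abs_def] by (auto intro!: derivative_eq_intros simp: o_def)
qed

lemma dot_deriv: "((\<lambda>t. P t \<bullet> z) has_real_derivative (\<rho> t * ((\<i> * cis t) \<bullet> z))) (at t)"
proof -
  have "((\<lambda>t. P t \<bullet> z) has_vector_derivative ((\<rho> t *\<^sub>R (\<i> * cis t)) \<bullet> z)) (at t)"
    by (rule bounded_linear.has_vector_derivative[OF bounded_linear_inner_left P_deriv])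
  then show ?thesis by (simp add: has_real_derivative_iff_has_vector_derivative)
qed

lemma dot_cont: "continuous_on A (\<lambda>t. P t \<bullet> z)"
  using dot_deriv by (meson DERIV_isCont continuous_at_imp_continuous_on)

text \<open>The derivative of \<open>P t \<bullet> cis \<phi>\<close> is
  \<open>\<rho> t * sin (\<phi> - t)\<close>. Inside the locale all convexity arguments reduce to
  this sign and to the total turning \<open>2 * pi\<close>.\<close>

lemma dot_incr:
  assumes "\<phi> - pi \<le> a" "a < b" "b \<le> \<phi>"
  shows "P a \<bullet> cis \<phi> < P b \<bullet> cis \<phi>"
proof (rule DERIV_pos_imp_increasing_open[OF assms(2)])
  fix x assume x: "a < x" "x < b"
  have "sin (\<phi> - x) > 0" using x assms by (intro sin_gt_zero) auto
  then have "\<rho> x * ((\<i> * cis x) \<bullet> cis \<phi>) > 0"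
    using rho_pos[of x] sin_minus[of "x - \<phi>"] by (simp add: inner_cis mult_pos_neg)
  then show "\<exists>y. ((\<lambda>t. P t \<bullet> cis \<phi>) has_real_derivative y) (at x) \<and> 0 < y"
    using dot_deriv by blast
qed (rule dot_cont)

lemma dot_decr:
  assumes "\<phi> \<le> a" "a < b" "b \<le> \<phi> + pi"
  shows "P b \<bullet> cis \<phi> < P a \<bullet> cis \<phi>"
proof -
  have "P a \<bullet> cis (\<phi> + pi) < P b \<bullet> cis (\<phi> + pi)"
    using assms by (intro dot_incr) auto
  then show ?thesis by (simp add: cis_plus_pi)
qed

lemma reduce_mod_2pi: obtains n :: int where "\<phi> \<le> a + of_int n * (2 * pi)" "a + of_int n * (2 * pi) < \<phi> + 2 * pi"
proof -
  define n where "n = \<lceil>(\<phi> - a) / (2 * pi)\<rceil>"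
  have "of_int n \<ge> (\<phi> - a) / (2 * pi)" "of_int n < (\<phi> - a) / (2 * pi) + 1"
    unfolding n_def by linarith+
  then show ?thesis by (intro that[of n]) (auto simp: field_simps)
qed

lemma P_add_int: "P (\<psi> + of_int n * (2 * pi)) = P \<psi>"
proof (induction n rule: int_induct[where k = 0])
  case (step1 i)
  then show ?case using P_period[of "\<psi> + of_int i * (2 * pi)"] by (simp add: algebra_simps)
next
  case (step2 i)
  then show ?case using P_period'[of "\<psi> + of_int i * (2 * pi)"] by (simp add: algebra_simps)
qed simp

lemma support_strict:
  assumes "\<psi> < \<xi>" "\<xi> < \<psi> + 2 * pi"
  shows "P \<xi> \<bullet> cis \<psi> < P \<psi> \<bullet> cis \<psi>"
proof (cases "\<xi> \<le> \<psi> + pi")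
  case True
  then show ?thesis using assms by (intro dot_decr) auto
next
  case False
  then have "P (\<xi> - 2 * pi) \<bullet> cis \<psi> < P \<psi> \<bullet> cis \<psi>"
    using assms by (intro dot_incr) auto
  then show ?thesis by (simp add: P_period')
qed

lemma support_cases: "P \<xi> = P \<psi> \<or> P \<xi> \<bullet> cis \<psi> < P \<psi> \<bullet> cis \<psi>"
proof -
  obtain n where "\<psi> \<le> \<xi> + of_int n * (2 * pi)" "\<xi> + of_int n * (2 * pi) < \<psi> + 2 * pi"
    by (rule reduce_mod_2pi)
  then have "\<xi> + of_int n * (2 * pi) = \<psi> \<or> P (\<xi> + of_int n * (2 * pi)) \<bullet> cis \<psi> < P \<psi> \<bullet> cis \<psi>"
    using support_strict[of \<psi> "\<xi> + of_int n * (2 * pi)"] by linarith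
  then show ?thesis unfolding P_add_int[of \<xi> n] using P_add_int[of \<xi> n] by auto
qed

lemma P_range: "\<gamma> s - c \<in> range P"
  by (metis P_Theta rangeI)

lemma minus_P_range: "- P \<psi> \<in> range P"
proof -
  have "2 * c - \<gamma> (\<sigma> \<psi>) \<in> range \<gamma>" using symmetric by blast
  then obtain s where "2 * c - \<gamma> (\<sigma> \<psi>) = \<gamma> s" by blast
  then have "- P \<psi> = \<gamma> s - c" by (simp add: P_def algebra_simps)
  then show ?thesis using P_range by simp
qed

text \<open>The symmetry is assumed for the image of the curve only; uniqueness of the extreme point
  in a given direction turns it into a parameter shift. The point \<open>- P (\<psi> + pi)\<close>
  lies on the curve and reaches at least as far in direction \<open>cis \<psi>\<close> as
  \<open>P \<psi>\<close> does, so it is \<open>P \<psi>\<close>.\<close>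

lemma P_half_period: "P (\<psi> + pi) = - P \<psi>"
proof -
  obtain \<xi> where \<xi>: "P \<xi> = - P (\<psi> + pi)" using minus_P_range[of "\<psi> + pi"] by (metis imageE)
  obtain \<xi>' where \<xi>': "P \<xi>' = - P \<psi>" using minus_P_range[of \<psi>] by (metis imageE)
  have "P \<xi> \<bullet> cis \<psi> \<ge> P \<psi> \<bullet> cis \<psi>"
  proof -
    have "P \<xi>' \<bullet> cis (\<psi> + pi) \<le> P (\<psi> + pi) \<bullet> cis (\<psi> + pi)"
      using support_cases[of \<xi>' "\<psi> + pi"] by (metis order.refl less_imp_le)
    then show ?thesis unfolding \<xi> \<xi>' cis_plus_pi by simp
  qed
  then have "P \<xi> = P \<psi>" using support_cases[of \<xi> \<psi>] by auto
  then show ?thesis using \<xi> by (metis minus_minus)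
qed

lemma rho_half_period: "\<rho> (\<psi> + pi) = \<rho> \<psi>"
proof -
  have "((\<lambda>x. P (x + pi) \<bullet> (\<i> * cis \<psi>)) has_real_derivative
      (\<rho> (\<psi> + pi) * ((\<i> * cis (\<psi> + pi)) \<bullet> (\<i> * cis \<psi>)))) (at \<psi>)"
    using dot_deriv[of "\<i> * cis \<psi>" "\<psi> + pi"] by (simp add: DERIV_shift)
  then have "((\<lambda>x. - (P x \<bullet> (\<i> * cis \<psi>))) has_real_derivative - \<rho> (\<psi> + pi)) (at \<psi>)"
    by (simp add: P_half_period inner_cis)
  moreover have "((\<lambda>x. - (P x \<bullet> (\<i> * cis \<psi>))) has_real_derivative - \<rho> \<psi>) (at \<psi>)"
    using DERIV_minus[OF dot_deriv[of "\<i> * cis \<psi>" \<psi>]] by (simp add: inner_cis)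
  ultimately show ?thesis using DERIV_unique by fastforce
qed

definition h :: "real \<Rightarrow> real" where "h \<psi> = P \<psi> \<bullet> cis \<psi>"
definition h' :: "real \<Rightarrow> real" where "h' \<psi> = P \<psi> \<bullet> (\<i> * cis \<psi>)"

lemma h_deriv: "(h has_real_derivative h' \<psi>) (at \<psi>)"
proof -
  have "((\<lambda>t. P t \<bullet> cis t) has_vector_derivative
     (P \<psi> \<bullet> (\<i> * cis \<psi>) + (\<rho> \<psi> *\<^sub>R (\<i> * cis \<psi>)) \<bullet> cis \<psi>)) (at \<psi>)"
    by (rule bounded_bilinear.has_vector_derivative[OF bounded_bilinear_inner P_deriv cis_vector_derivative])
  then show ?thesis
    by (simp add: has_real_derivative_iff_has_vector_derivative h_def[abs_def] h'_def inner_cis)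
qed

text \<open>The classical relation \<open>h'' + h = \<rho>\<close>: it makes \<open>h\<close> twice
  continuously differentiable although the curve is only C^2.\<close>

lemma h'_deriv: "(h' has_real_derivative (\<rho> \<psi> - h \<psi>)) (at \<psi>)"
proof -
  have "((\<lambda>t. \<i> * cis t) has_vector_derivative (\<i> * (\<i> * cis \<psi>))) (at \<psi>)"
    by (rule bounded_linear.has_vector_derivative[OF bounded_linear_mult_right cis_vector_derivative])
  then have "((\<lambda>t. P t \<bullet> (\<i> * cis t)) has_vector_derivative
     (P \<psi> \<bullet> (\<i> * (\<i> * cis \<psi>)) + (\<rho> \<psi> *\<^sub>R (\<i> * cis \<psi>)) \<bullet> (\<i> * cis \<psi>))) (at \<psi>)"
    by (rule bounded_bilinear.has_vector_derivative[OF bounded_bilinear_inner P_deriv])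
  moreover have "P \<psi> \<bullet> (\<i> * (\<i> * cis \<psi>)) = - h \<psi>"
    by (simp add: h_def inner_complex_def)
  ultimately show ?thesis
    by (simp add: has_real_derivative_iff_has_vector_derivative h'_def[abs_def] inner_cis)
qed

lemma h_half_period: "h (\<psi> + pi) = h \<psi>" "h' (\<psi> + pi) = h' \<psi>"
  by (simp_all add: h_def h'_def P_half_period cis_plus_pi)

lemma h_pos: "h \<psi> > 0"
  using support_strict[of \<psi> "\<psi> + pi"] by (simp add: h_def P_half_period)

lemma P_frame: "P \<psi> = h \<psi> *\<^sub>R cis \<psi> + h' \<psi> *\<^sub>R (\<i> * cis \<psi>)"
  unfolding h_def h'_def by (rule cis_frame_decomposition)

text \<open>
  The chord from \<open>P \<psi>\<close> to \<open>P \<psi>'\<close>; the angle \<open>\<phi>\<close> is that of its right normal, so that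
  \<open>\<phi> - \<psi>\<close> and \<open>\<psi>' - \<phi>\<close> are the angles which it forms with the tangents.
\<close>

definition chord :: "real \<Rightarrow> real \<Rightarrow> real \<Rightarrow> bool" where
  "chord \<psi> \<phi> \<psi>' \<longleftrightarrow> \<psi> < \<phi> \<and> \<phi> < \<psi> + pi \<and> \<phi> < \<psi>' \<and> \<psi>' < \<phi> + pi \<and> P \<psi> \<bullet> cis \<phi> = P \<psi>' \<bullet> cis \<phi>"

lemma chord_ex: "\<psi> < \<phi> \<Longrightarrow> \<phi> < \<psi> + pi \<Longrightarrow> \<exists>\<psi>'. chord \<psi> \<phi> \<psi>'"
proof -
  assume *: "\<psi> < \<phi>" "\<phi> < \<psi> + pi"
  have 1: "P \<psi> \<bullet> cis \<phi> < P \<phi> \<bullet> cis \<phi>" using * by (intro dot_incr) auto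
  have "P (\<phi> - pi) \<bullet> cis \<phi> < P \<psi> \<bullet> cis \<phi>" using * by (intro dot_incr) auto
  then have 2: "P (\<phi> + pi) \<bullet> cis \<phi> < P \<psi> \<bullet> cis \<phi>"
    using P_period[of "\<phi> - pi"] by (simp add: algebra_simps)
  obtain x where x: "\<phi> \<le> x" "x \<le> \<phi> + pi" "P x \<bullet> cis \<phi> = P \<psi> \<bullet> cis \<phi>"
    using IVT2'[of "\<lambda>t. P t \<bullet> cis \<phi>" "\<phi> + pi" "P \<psi> \<bullet> cis \<phi>" \<phi>] 1 2 dot_cont by auto
  then have "x \<noteq> \<phi>" "x \<noteq> \<phi> + pi" using 1 2 by auto
  with x * show ?thesis by (intro exI[of _ x]) (auto simp: chord_def)
qed

lemma chord_unique: "chord \<psi> \<phi> a \<Longrightarrow> chord \<psi> \<phi> b \<Longrightarrow> a = b"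
  using dot_decr[of \<phi> a b] dot_decr[of \<phi> b a] unfolding chord_def
  by (cases a b rule: linorder_cases) auto

lemma chord_shift: "chord (\<psi> + pi) (\<phi> + pi) (\<psi>' + pi) \<longleftrightarrow> chord \<psi> \<phi> \<psi>'"
  by (auto simp: chord_def P_half_period cis_plus_pi)

lemma chord_shift2: "chord (\<psi> + 2 * pi) (\<phi> + 2 * pi) (\<psi>' + 2 * pi) \<longleftrightarrow> chord \<psi> \<phi> \<psi>'"
  by (auto simp: chord_def P_period cis_plus_2pi)

text \<open>The reversed line has the opposite normal, and its end point is listed one full turn
  later so that parameters increase along the chord.\<close>

lemma chord_reverse: "chord \<psi> \<phi> \<psi>' \<Longrightarrow> chord \<psi>' (\<phi> + pi) (\<psi> + 2 * pi)"
  by (auto simp: chord_def P_period cis_plus_pi)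

lemma chord_direction:
  assumes "chord \<psi> \<phi> \<psi>'"
  obtains r where "r > 0" "P \<psi>' - P \<psi> = r *\<^sub>R (\<i> * cis \<phi>)"
proof -
  define r where "r = (P \<psi>' - P \<psi>) \<bullet> (\<i> * cis \<phi>)"
  have "(P \<psi>' - P \<psi>) \<bullet> cis \<phi> = 0"
    using assms by (simp add: chord_def inner_diff_left)
  then have eq: "P \<psi>' - P \<psi> = r *\<^sub>R (\<i> * cis \<phi>)"
    using cis_frame_decomposition[of "P \<psi>' - P \<psi>" \<phi>] unfolding r_def by simp
  have "(P \<psi>' - P \<psi>) \<bullet> cis \<psi> < 0"
    using support_strict[of \<psi> \<psi>'] assms by (auto simp: chord_def inner_diff_left)
  then have "r * sin (\<phi> - \<psi>) > 0" unfolding eq by (simp add: inner_cis)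
  moreover have "sin (\<phi> - \<psi>) > 0" using assms by (intro sin_gt_zero) (auto simp: chord_def)
  ultimately have "r > 0" by (simp add: zero_less_mult_iff)
  with eq that show ?thesis by blast
qed

text \<open>The twist property. For \<open>a < b\<close> the point \<open>P b\<close> lies strictly
  to the left of the first chord, so the direction towards it is obtained from that of the first
  chord by a counterclockwise turn.\<close>

lemma chord_mono_aux:
  assumes "chord \<psi> \<phi>1 a" "chord \<psi> \<phi>2 b" "a < b"
  shows "\<phi>1 < \<phi>2"
proof -
  have b: "b < \<psi> + 2 * pi" using assms by (auto simp: chord_def)
  have "P b \<bullet> cis \<phi>1 < P \<psi> \<bullet> cis \<phi>1"
  proof (cases "b \<le> \<phi>1 + pi")
    case True
    then have "P b \<bullet> cis \<phi>1 < P a \<bullet> cis \<phi>1"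
      using assms by (intro dot_decr) (auto simp: chord_def)
    then show ?thesis using assms by (simp add: chord_def)
  next
    case False
    then have "P (b - 2 * pi) \<bullet> cis \<phi>1 < P \<psi> \<bullet> cis \<phi>1"
      using assms b by (intro dot_incr) (auto simp: chord_def)
    then show ?thesis by (simp add: P_period')
  qed
  moreover obtain r where r: "r > 0" "P b - P \<psi> = r *\<^sub>R (\<i> * cis \<phi>2)"
    using assms(2) by (rule chord_direction)
  ultimately have "(r *\<^sub>R (\<i> * cis \<phi>2)) \<bullet> cis \<phi>1 < 0"
    by (simp flip: r(2) add: inner_diff_left)
  then have pos: "sin (\<phi>2 - \<phi>1) > 0" using r(1) by (simp add: inner_cis zero_less_mult_iff)
  show ?thesis
  proof (rule ccontr)
    assume "\<not> \<phi>1 < \<phi>2"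
    then have "sin (\<phi>1 - \<phi>2) \<ge> 0"
      using assms by (intro sin_ge_zero) (auto simp: chord_def)
    then show False using pos sin_minus[of "\<phi>2 - \<phi>1"] by simp
  qed
qed

lemma chord_unique_angle:
  assumes "chord \<psi> \<phi>1 a" "chord \<psi> \<phi>2 a"
  shows "\<phi>1 = \<phi>2"
proof -
  obtain r where r: "r > 0" "P a - P \<psi> = r *\<^sub>R (\<i> * cis \<phi>1)"
    using assms(1) by (rule chord_direction)
  have "(r *\<^sub>R (\<i> * cis \<phi>1)) \<bullet> cis \<phi>2 = 0"
    using assms(2) by (simp flip: r(2) add: inner_diff_left chord_def)
  then have "sin (\<phi>1 - \<phi>2) = 0" using r(1) by (simp add: inner_cis)
  moreover have "\<bar>\<phi>1 - \<phi>2\<bar> < pi" using assms by (auto simp: chord_def)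
  ultimately show ?thesis using sin_eq_0_pi[of "\<phi>1 - \<phi>2"] by auto
qed

lemma chord_mono: "chord \<psi> \<phi>1 a \<Longrightarrow> chord \<psi> \<phi>2 b \<Longrightarrow> \<phi>1 < \<phi>2 \<longleftrightarrow> a < b"
  using chord_mono_aux[of \<psi> \<phi>1 a \<phi>2 b] chord_mono_aux[of \<psi> \<phi>2 b \<phi>1 a] chord_unique[of \<psi> \<phi>1 a b]
  by (cases a b rule: linorder_cases) (use chord_unique_angle in auto)

text \<open>Reversing both chords turns the common end into a common start.\<close>

lemma chord_mono': "chord a \<phi>1 \<psi>' \<Longrightarrow> chord b \<phi>2 \<psi>' \<Longrightarrow> \<phi>1 < \<phi>2 \<longleftrightarrow> a < b"
  using chord_mono[OF chord_reverse chord_reverse, of a \<phi>1 \<psi>' b \<phi>2] by simp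

end

section \<open>The billiard map\<close>

lemma strip_iff: "x \<in> strip \<longleftrightarrow> -1 < fst x \<and> fst x < 1"
  by (cases x) (auto simp: strip_def)

lemma open_strip: "open strip"
  unfolding strip_def by (intro open_Times) auto

lemma arccos_strip: "x \<in> strip \<Longrightarrow> 0 < arccos (fst x) \<and> arccos (fst x) < pi"
  using arccos_lt_bounded by (simp add: strip_iff)

definition sine :: "real \<times> real \<Rightarrow> real" where "sine x = sqrt (1 - (fst x)\<^sup>2)"

lemma sine_pos: "x \<in> strip \<Longrightarrow> sine x > 0"
  using abs_square_less_1[of "fst x"] by (auto simp: strip_iff sine_def abs_less_iff)

lemma sin_arccos_strip: "x \<in> strip \<Longrightarrow> sin (arccos (fst x)) = sine x"
  by (simp add: strip_iff sine_def sin_arccos)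

lemma cos_arccos_strip: "x \<in> strip \<Longrightarrow> cos (arccos (fst x)) = fst x"
  by (simp add: strip_iff)

text \<open>The angle \<delta> becomes its supplement: time reversal for lines through a fixed
  boundary point.\<close>

definition flip :: "real \<times> real \<Rightarrow> real \<times> real" where "flip x = (- fst x, snd x)"

lemma flip_strip [simp]: "flip x \<in> strip \<longleftrightarrow> x \<in> strip"
  by (auto simp: strip_iff flip_def)

lemma flip_flip [simp]: "flip (flip x) = x" "flip (x + y) = flip x + flip y" "flip (0, a) = (0, a)"
  by (simp_all add: flip_def prod_eq_iff)

lemma shift_strip [simp]: "x + (0, a) \<in> strip \<longleftrightarrow> x \<in> strip"
  by (auto simp: strip_iff)

context oval
begin

abbreviation T :: "real \<times> real \<Rightarrow> real \<times> real" where "T \<equiv> billiard_map \<gamma> L"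

lemma tangent_eq: "tangent \<gamma> s = \<i> * cis (\<Theta> s)"
  unfolding tangent_def by (rule vector_derivative_at[OF gamma_deriv])

text \<open>
  The line \<open>x\<close> leaving \<open>\<gamma> (snd x)\<close> (for \<open>e = 1\<close>), or the one that arrives there and is reflected
  into it (for \<open>e = -1\<close>), given by the angle of its normal and its signed distance from the centre.
\<close>

definition angle :: "real \<Rightarrow> real \<times> real \<Rightarrow> real" where
  "angle e x = \<Theta> (snd x) + e * arccos (fst x)"

definition line :: "real \<Rightarrow> real \<times> real \<Rightarrow> real \<times> real" where
  "line e x = (angle e x, (\<gamma> (snd x) - c) \<bullet> cis (angle e x))"

text \<open>Position of the boundary point along its line, measured from the foot of the
  perpendicular from the centre. It is also the rate at which the signed distance of the line
  changes when the line turns about that point.\<close>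

definition moment :: "real \<Rightarrow> real \<times> real \<Rightarrow> real" where
  "moment e x = (\<gamma> (snd x) - c) \<bullet> (\<i> * cis (angle e x))"

lemma line_direction_eq: "line_direction \<gamma> x = \<i> * cis (angle 1 x)"
  by (cases x) (simp add: line_direction_def tangent_eq angle_def mult.assoc cis_mult)

text \<open>From the starting angle over one full turn, \<open>P t \<bullet> cis \<phi>\<close>
  rises until \<phi>, falls until \<open>\<phi> + pi\<close> and rises again. Its initial value
  therefore recurs exactly once in between, on the falling part.\<close>

lemma exit_parameter_eq:
  assumes x: "x \<in> strip" and ch: "chord (\<Theta> (snd x)) (angle 1 x) \<psi>'"
  shows "exit_parameter \<gamma> L x = \<sigma> \<psi>'"
  unfolding exit_parameter_def
proof (rule the_equality)
  have "snd x < \<sigma> \<psi>'" using ch sigma_less_iff[of "\<Theta> (snd x)" \<psi>'] by (auto simp: chord_def)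
  moreover have "\<sigma> \<psi>' < snd x + L"
  proof -
    have "\<psi>' < \<Theta> (snd x + L)" using ch by (auto simp: chord_def Theta_period)
    then show ?thesis by (metis sigma_less_iff sigma_Theta)
  qed
  moreover obtain r where r: "r > 0" "P \<psi>' - P (\<Theta> (snd x)) = r *\<^sub>R (\<i> * cis (angle 1 x))"
    using ch by (rule chord_direction)
  ultimately show "snd x < \<sigma> \<psi>' \<and> \<sigma> \<psi>' < snd x + L \<and>
      (\<exists>r>0. \<gamma> (\<sigma> \<psi>') = \<gamma> (snd x) + r *\<^sub>R line_direction \<gamma> x)"
    by (auto simp: P_def line_direction_eq algebra_simps intro!: exI[of _ r])
next
  fix t
  assume "snd x < t \<and> t < snd x + L \<and> (\<exists>r>0. \<gamma> t = \<gamma> (snd x) + r *\<^sub>R line_direction \<gamma> x)"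
  then obtain r where t: "snd x < t" "t < snd x + L" and r: "\<gamma> t = \<gamma> (snd x) + r *\<^sub>R line_direction \<gamma> x"
    by blast
  define \<phi> where "\<phi> = angle 1 x"
  define \<psi> where "\<psi> = \<Theta> (snd x)"
  have \<psi>\<phi>: "\<psi> < \<phi>" "\<phi> < \<psi> + pi"
    using arccos_strip[OF x] by (auto simp: \<phi>_def \<psi>_def angle_def)
  have \<psi>t: "\<psi> < \<Theta> t" "\<Theta> t < \<psi> + 2 * pi"
    using t Theta_less_iff[of t "snd x + L"] by (auto simp: \<psi>_def Theta_period simp del: Theta_less_iff intro: Theta_strict_mono)
  have eq: "P (\<Theta> t) \<bullet> cis \<phi> = P \<psi> \<bullet> cis \<phi>"
    unfolding \<psi>_def P_Theta r line_direction_eq \<phi>_def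
    by (simp add: inner_diff_left inner_add_left inner_cis)
  have "\<phi> < \<Theta> t"
  proof (rule ccontr)
    assume "\<not> \<phi> < \<Theta> t"
    then have "P \<psi> \<bullet> cis \<phi> < P (\<Theta> t) \<bullet> cis \<phi>" using \<psi>\<phi> \<psi>t by (intro dot_incr) auto
    then show False using eq by simp
  qed
  moreover have "\<Theta> t < \<phi> + pi"
  proof (rule ccontr)
    assume "\<not> \<Theta> t < \<phi> + pi"
    then have "P (\<Theta> t - 2 * pi) \<bullet> cis \<phi> < P \<psi> \<bullet> cis \<phi>" using \<psi>\<phi> \<psi>t by (intro dot_incr) auto
    then show False using eq by (simp add: P_period')
  qed
  ultimately have "chord \<psi> \<phi> (\<Theta> t)" using \<psi>\<phi> eq by (simp add: chord_def)
  then have "\<Theta> t = \<psi>'" using ch chord_unique unfolding \<psi>_def \<phi>_def by blast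
  then show "t = \<sigma> \<psi>'" by auto
qed

lemma T_eq:
  assumes x: "x \<in> strip" and ch: "chord (\<Theta> (snd x)) (angle 1 x) \<psi>'"
  shows "T x = (cos (\<psi>' - angle 1 x), \<sigma> \<psi>')"
  unfolding billiard_map_def Let_def exit_parameter_eq[OF assms] reflect_def line_direction_eq tangent_eq
  by (simp add: inner_diff_left inner_cis cos_diff mult.commute)

text \<open>By the reflection law the reversed line makes the supplementary angle at the exit point.
  On a set mapped onto itself by \<open>T\<close>, reversal of lines thus has the same image as
  \<open>flip\<close>.\<close>

lemma reverse_line_eq:
  assumes x: "x \<in> strip"
  shows "reverse_line \<gamma> L x = flip (T x)"
proof -
  obtain \<psi>' where ch: "chord (\<Theta> (snd x)) (angle 1 x) \<psi>'"
    using chord_ex[of "\<Theta> (snd x)" "angle 1 x"] arccos_strip[OF x] by (auto simp: angle_def)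
  show ?thesis
    unfolding reverse_line_def Let_def T_eq[OF x ch] exit_parameter_eq[OF x ch] line_direction_eq tangent_eq flip_def
    by (simp add: inner_cis cos_diff mult.commute)
qed

lemma T_props:
  assumes x: "x \<in> strip"
  shows "T x \<in> strip" "chord (\<Theta> (snd x)) (angle 1 x) (\<Theta> (snd (T x)))" "angle (-1) (T x) = angle 1 x"
proof -
  obtain \<psi>' where ch: "chord (\<Theta> (snd x)) (angle 1 x) \<psi>'"
    using chord_ex[of "\<Theta> (snd x)" "angle 1 x"] arccos_strip[OF x] by (auto simp: angle_def)
  have b: "0 < \<psi>' - angle 1 x" "\<psi>' - angle 1 x < pi" using ch by (auto simp: chord_def)
  have "cos (\<psi>' - angle 1 x) < cos 0" "cos pi < cos (\<psi>' - angle 1 x)"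
    using b by (intro cos_monotone_0_pi; simp)+
  then show "T x \<in> strip" by (simp add: T_eq[OF x ch] strip_iff)
  show "chord (\<Theta> (snd x)) (angle 1 x) (\<Theta> (snd (T x)))" using ch by (simp add: T_eq[OF x ch])
  show "angle (-1) (T x) = angle 1 x"
    using b unfolding angle_def[of "-1"] by (simp add: T_eq[OF x ch] arccos_cos)
qed

lemma arccos_inj: "x \<in> strip \<Longrightarrow> y \<in> strip \<Longrightarrow> arccos (fst x) = arccos (fst y) \<Longrightarrow> fst x = fst y"
  by (metis cos_arccos_strip)

lemma T_eqI:
  assumes x: "x \<in> strip" and y: "y \<in> strip"
    and ch: "chord (\<Theta> (snd x)) (angle 1 x) (\<Theta> (snd y))" and an: "angle (-1) y = angle 1 x"
  shows "T x = y"
proof -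
  have "\<Theta> (snd (T x)) = \<Theta> (snd y)" using T_props(2)[OF x] ch by (rule chord_unique)
  then have s: "snd (T x) = snd y" by simp
  then have "fst (T x) = fst y"
    using T_props(3)[OF x] an T_props(1)[OF x] y by (intro arccos_inj) (auto simp: angle_def)
  with s show ?thesis by (simp add: prod_eq_iff)
qed

lemma line_T: "x \<in> strip \<Longrightarrow> line (-1) (T x) = line 1 x"
  using T_props[of x] by (simp add: line_def chord_def P_Theta)

lemma angle_shift: "angle e (x + (0, L)) = angle e x + 2 * pi"
  by (simp add: angle_def Theta_period)

lemma T_shift: "x \<in> strip \<Longrightarrow> T (x + (0, L)) = T x + (0, L)"
  using T_props[of x] by (intro T_eqI) (simp_all add: angle_shift Theta_period chord_shift2)

lemma angle_flip: "x \<in> strip \<Longrightarrow> angle e (flip x) = angle (- e) x + e * pi"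
  by (simp add: angle_def flip_def strip_iff arccos_minus algebra_simps)

text \<open>Time reversibility. The translation by \<open>L\<close> appears because the exit
  parameter is always chosen ahead of the entry parameter.\<close>

lemma T_flip_T: "x \<in> strip \<Longrightarrow> T (flip (T x)) = flip x + (0, L)"
  using T_props[of x] chord_reverse[of "\<Theta> (snd x)" "angle 1 x" "\<Theta> (snd (T x))"]
  by (intro T_eqI) (simp_all add: angle_shift angle_flip Theta_period, simp_all add: flip_def Theta_period)

lemma line_out_inj: "inj_on (line 1) strip"
proof (rule inj_onI)
  fix x y assume xy: "x \<in> strip" "y \<in> strip" "line 1 x = line 1 y"
  define \<phi> where "\<phi> = angle 1 x"
  have "P (\<Theta> (snd x)) \<bullet> cis \<phi> = P (\<Theta> (snd y)) \<bullet> cis \<phi>" "angle 1 y = \<phi>"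
    using xy(3) unfolding line_def P_Theta \<phi>_def by (metis prod.inject)+
  moreover have "\<phi> - pi < \<Theta> (snd x)" "\<Theta> (snd x) < \<phi>" "\<phi> - pi < \<Theta> (snd y)" "\<Theta> (snd y) < \<phi>"
    using arccos_strip[OF xy(1)] arccos_strip[OF xy(2)] \<open>angle 1 y = \<phi>\<close> by (auto simp: \<phi>_def angle_def)
  ultimately have "\<Theta> (snd x) = \<Theta> (snd y)"
    using dot_incr[of \<phi> "\<Theta> (snd x)" "\<Theta> (snd y)"] dot_incr[of \<phi> "\<Theta> (snd y)" "\<Theta> (snd x)"]
    by (cases "\<Theta> (snd x)" "\<Theta> (snd y)" rule: linorder_cases) auto
  then have s: "snd x = snd y" by simp
  then have "fst x = fst y" using xy by (intro arccos_inj) (auto simp: line_def angle_def)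
  with s show "x = y" by (simp add: prod_eq_iff)
qed

lemma line_in_inj: "inj_on (line (-1)) strip"
proof (rule inj_onI)
  fix x y assume xy: "x \<in> strip" "y \<in> strip" "line (-1) x = line (-1) y"
  define \<phi> where "\<phi> = angle (-1) x"
  have "P (\<Theta> (snd x)) \<bullet> cis \<phi> = P (\<Theta> (snd y)) \<bullet> cis \<phi>" "angle (-1) y = \<phi>"
    using xy(3) unfolding line_def P_Theta \<phi>_def by (metis prod.inject)+
  moreover have "\<phi> < \<Theta> (snd x)" "\<Theta> (snd x) < \<phi> + pi" "\<phi> < \<Theta> (snd y)" "\<Theta> (snd y) < \<phi> + pi"
    using arccos_strip[OF xy(1)] arccos_strip[OF xy(2)] \<open>angle (-1) y = \<phi>\<close> by (auto simp: \<phi>_def angle_def)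
  ultimately have "\<Theta> (snd x) = \<Theta> (snd y)"
    using dot_decr[of \<phi> "\<Theta> (snd x)" "\<Theta> (snd y)"] dot_decr[of \<phi> "\<Theta> (snd y)" "\<Theta> (snd x)"]
    by (cases "\<Theta> (snd x)" "\<Theta> (snd y)" rule: linorder_cases) auto
  then have s: "snd x = snd y" by simp
  then have "fst x = fst y" using xy by (intro arccos_inj) (auto simp: line_def angle_def)
  with s show "x = y" by (simp add: prod_eq_iff)
qed

section \<open>Differentials of the line coordinates and of the billiard map\<close>

definition dangle :: "real \<Rightarrow> real \<times> real \<Rightarrow> real \<times> real \<Rightarrow> real" where
  "dangle e x v = k (snd x) * snd v - e * fst v / sine x"

definition dline :: "real \<Rightarrow> real \<times> real \<Rightarrow> real \<times> real \<Rightarrow> real \<times> real" where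
  "dline e x v = (dangle e x v, e * sine x * snd v + moment e x * dangle e x v)"

lemma angle_deriv:
  assumes x: "x \<in> strip"
  shows "(angle e has_derivative dangle e x) (at x)"
proof -
  have 1: "((\<lambda>x. \<Theta> (snd x)) has_derivative (\<lambda>v. k (snd x) * snd v)) (at x)"
    using has_derivative_compose[OF bounded_linear_imp_has_derivative[OF bounded_linear_snd]
      Theta_deriv[THEN has_field_derivative_imp_has_derivative]] by blast
  have "(arccos has_real_derivative inverse (- sqrt (1 - (fst x)\<^sup>2))) (at (fst x))"
    using x by (intro DERIV_arccos) (auto simp: strip_iff)
  then have 2: "((\<lambda>x. arccos (fst x)) has_derivative (\<lambda>v. inverse (- sqrt (1 - (fst x)\<^sup>2)) * fst v)) (at x)"
    using has_derivative_compose[OF bounded_linear_imp_has_derivative[OF bounded_linear_fst]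
      has_field_derivative_imp_has_derivative] by blast
  have "((\<lambda>x. \<Theta> (snd x) + e * arccos (fst x)) has_derivative
      (\<lambda>v. k (snd x) * snd v + e * (inverse (- sqrt (1 - (fst x)\<^sup>2)) * fst v))) (at x)"
    by (intro has_derivative_add 1 has_derivative_mult_right 2)
  then show ?thesis
    by (simp add: angle_def[abs_def] dangle_def[abs_def] sine_def field_simps)
qed

lemma line_deriv:
  assumes x: "x \<in> strip" and e: "e = 1 \<or> e = -1"
  shows "(line e has_derivative dline e x) (at x)"
proof -
  have "(\<gamma> has_derivative (\<lambda>t. t *\<^sub>R (\<i> * cis (\<Theta> (snd x))))) (at (snd x))"
    using gamma_deriv[of "snd x"] by (simp add: has_vector_derivative_def)
  then have "((\<lambda>x. \<gamma> (snd x)) has_derivative (\<lambda>v. snd v *\<^sub>R (\<i> * cis (\<Theta> (snd x))))) (at x)"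
    using has_derivative_compose[OF bounded_linear_imp_has_derivative[OF bounded_linear_snd]] by blast
  then have 1: "((\<lambda>x. \<gamma> (snd x) - c) has_derivative (\<lambda>v. snd v *\<^sub>R (\<i> * cis (\<Theta> (snd x))))) (at x)"
    using has_derivative_diff[OF _ has_derivative_const] by fastforce
  have "(cis has_derivative (\<lambda>t. t *\<^sub>R (\<i> * cis (angle e x)))) (at (angle e x))"
    using cis_vector_derivative[of "angle e x"] by (simp add: has_vector_derivative_def)
  then have 2: "((\<lambda>x. cis (angle e x)) has_derivative (\<lambda>v. dangle e x v *\<^sub>R (\<i> * cis (angle e x)))) (at x)"
    using has_derivative_compose[OF angle_deriv[OF x]] by blast
  have "((\<lambda>x. (\<gamma> (snd x) - c) \<bullet> cis (angle e x)) has_derivative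
      (\<lambda>v. (\<gamma> (snd x) - c) \<bullet> (dangle e x v *\<^sub>R (\<i> * cis (angle e x)))
        + (snd v *\<^sub>R (\<i> * cis (\<Theta> (snd x)))) \<bullet> cis (angle e x))) (at x)"
    by (rule has_derivative_inner[OF 1 2])
  moreover have "- sin (\<Theta> (snd x) - angle e x) = e * sine x"
    using e sin_arccos_strip[OF x] by (auto simp: angle_def)
  ultimately have "((\<lambda>x. (\<gamma> (snd x) - c) \<bullet> cis (angle e x)) has_derivative
      (\<lambda>v. e * sine x * snd v + moment e x * dangle e x v)) (at x)"
    by (simp add: inner_cis moment_def algebra_simps)
  then show ?thesis
    unfolding line_def[abs_def] dline_def[abs_def] by (intro has_derivative_Pair angle_deriv x)
qed

text \<open>Both charts have Jacobian determinant \<open>-1\<close> in the coordinates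
  \<open>(cos \<delta>, s)\<close>. Equality of the two makes \<open>T\<close> area-preserving;
  absolute value 1 is what the change of variables in Hopf's argument uses.\<close>

lemma dline_cross:
  assumes "x \<in> strip" "e = 1 \<or> e = -1"
  shows "fst (dline e x u) * snd (dline e x v) - fst (dline e x v) * snd (dline e x u)
    = - (fst u * snd v - fst v * snd u)"
  using assms(2) sine_pos[OF assms(1)] by (auto simp: dline_def dangle_def field_simps)

text \<open>The two moments are coordinates along the same line, so this is the length of the
  chord.\<close>

definition len :: "real \<times> real \<Rightarrow> real" where "len x = moment (-1) (T x) - moment 1 x"

lemma len_pos:
  assumes x: "x \<in> strip" shows "len x > 0"
proof -
  obtain r where r: "r > 0" "P (\<Theta> (snd (T x))) - P (\<Theta> (snd x)) = r *\<^sub>R (\<i> * cis (angle 1 x))"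
    using T_props(2)[OF x] by (rule chord_direction)
  have "len x = (P (\<Theta> (snd (T x))) - P (\<Theta> (snd x))) \<bullet> (\<i> * cis (angle 1 x))"
    by (simp add: len_def moment_def P_Theta T_props[OF x] inner_diff_left)
  then show ?thesis unfolding r(2) using r(1) by (simp add: inner_cis)
qed

text \<open>Obtained by solving \<open>dline (-1) (T x) (dT x v) = dline 1 x v\<close>; see \<open>dline_dT\<close>.\<close>

definition dT :: "real \<times> real \<Rightarrow> real \<times> real \<Rightarrow> real \<times> real" where
  "dT x v = (let ds = (len x * dangle 1 x v - sine x * snd v) / sine (T x)
     in (sine (T x) * (dangle 1 x v - k (snd (T x)) * ds), ds))"

lemma dline_dT:
  assumes x: "x \<in> strip" shows "dline (-1) (T x) (dT x v) = dline 1 x v"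
proof -
  have y: "sine (T x) > 0" by (rule sine_pos[OF T_props(1)[OF x]])
  define f where "f = dangle 1 x v"
  define ds where "ds = (len x * f - sine x * snd v) / sine (T x)"
  have dT: "dT x v = (sine (T x) * (f - k (snd (T x)) * ds), ds)"
    by (simp add: dT_def f_def ds_def Let_def)
  have 1: "dangle (-1) (T x) (dT x v) = f"
    using y by (simp add: dangle_def dT)
  have 2: "sine (T x) * ds = len x * f - sine x * snd v"
    using y by (simp add: ds_def)
  then show ?thesis
    unfolding dline_def 1 by (simp add: dT len_def algebra_simps flip: f_def)
qed

lemma dangle_dT: "x \<in> strip \<Longrightarrow> dangle (-1) (T x) (dT x v) = dangle 1 x v"
  using dline_dT[of x v] by (simp add: dline_def)

lemma dT_cross:
  assumes x: "x \<in> strip"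
  shows "fst (dT x u) * snd (dT x v) - fst (dT x v) * snd (dT x u) = fst u * snd v - fst v * snd u"
  using dline_cross[OF T_props(1)[OF x], of "-1" "dT x u" "dT x v"] dline_cross[OF x, of 1 u v]
  by (simp add: dline_dT[OF x])

text \<open>The turning of a chord, times its length, is accounted for by the transverse
  displacements of its two ends. In \<open>field_step\<close> this converts \<open>ds > 0\<close> at
  both ends into a positive rotation rate.\<close>

lemma sine_snd_dT:
  assumes x: "x \<in> strip"
  shows "len x * dangle 1 x v = sine x * snd v + sine (T x) * snd (dT x v)"
  using sine_pos[OF T_props(1)[OF x]] by (simp add: dT_def Let_def)

lemma line_cont: "e = 1 \<or> e = -1 \<Longrightarrow> continuous_on strip (line e)"
  using line_deriv has_derivative_continuous by (blast intro: continuous_at_imp_continuous_on)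

lemma T_deriv:
  assumes x: "x \<in> strip"
  shows "(T has_derivative dT x) (at x)"
proof -
  define U where "U = line (-1) ` strip"
  define g where "g = inv_into strip (line (-1))"
  have U: "open U"
    unfolding U_def by (rule invariance_of_domain[OF line_cont open_strip line_in_inj]) simp
  have cont: "continuous_on U g"
    unfolding U_def g_def
    by (rule continuous_on_inverse_open[OF open_strip])
       (use line_cont line_in_inj in auto)
  have gT: "g (line 1 y) = T y" if "y \<in> strip" for y
    unfolding g_def line_T[OF that, symmetric]
    by (rule inv_into_f_f[OF line_in_inj T_props(1)[OF that]])
  \<comment> \<open>The inverse of \<open>dline (-1) (T x)\<close>: the change of distance
    determines \<open>ds\<close>, then the change of angle determines \<open>dp\<close>.\<close>
  define G where "G z = (let ds = (moment (-1) (T x) * fst z - snd z) / sine (T x)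
      in (sine (T x) * (fst z - k (snd (T x)) * ds), ds))" for z
  have Tx: "T x \<in> strip" by (rule T_props(1)[OF x])
  have xU: "line 1 x \<in> U" unfolding U_def line_T[OF x, symmetric] using Tx by blast
  have "(g has_derivative G) (at (line 1 x))"
  proof (rule has_derivative_inverse_basic[where f = "line (-1)" and f' = "dline (-1) (T x)" and T = U])
    show "(line (-1) has_derivative dline (-1) (T x)) (at (g (line 1 x)))"
      unfolding gT[OF x] by (rule line_deriv[OF Tx]) simp
    have "linear G"
      by (rule linearI)
        (use sine_pos[OF Tx] in \<open>simp_all add: G_def Let_def field_simps\<close>)
    then show "bounded_linear G" by (simp add: linear_conv_bounded_linear)
    show "G \<circ> dline (-1) (T x) = id"
      using sine_pos[OF Tx] by (auto simp: fun_eq_iff G_def Let_def dline_def dangle_def field_simps)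
    show "isCont g (line 1 x)"
      using cont U xU by (simp add: continuous_on_eq_continuous_at)
    show "line (-1) (g z) = z" if "z \<in> U" for z
      using that unfolding g_def U_def by (rule f_inv_into_f)
  qed (use U xU in auto)
  then have "((\<lambda>y. g (line 1 y)) has_derivative (\<lambda>v. G (dline 1 x v))) (at x)"
    using has_derivative_compose[OF line_deriv[OF x, of 1], of g G] by simp
  moreover have "G (dline 1 x v) = dT x v" for v
    by (simp add: G_def dT_def Let_def dline_def len_def algebra_simps)
  ultimately have "((\<lambda>y. g (line 1 y)) has_derivative dT x) (at x)"
    by (simp add: fun_eq_iff)
  then show ?thesis
    by (rule has_derivative_transform_within_open[OF _ open_strip x]) (rule gT)
qed

lemma T_cont: "continuous_on strip T"
  using T_deriv has_derivative_continuous by (blast intro: continuous_at_imp_continuous_on)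

lemma T_frechet: "x \<in> strip \<Longrightarrow> frechet_derivative T (at x) = dT x"
  using frechet_derivative_at[OF T_deriv] by simp

lemma sine_cont: "continuous_on A sine"
  unfolding sine_def by (intro continuous_intros)

lemma angle_cont: "A \<subseteq> strip \<Longrightarrow> continuous_on A (angle e)"
  using angle_deriv has_derivative_continuous by (blast intro: continuous_at_imp_continuous_on)

lemma moment_cont: "A \<subseteq> strip \<Longrightarrow> continuous_on A (moment e)"
  unfolding moment_def
  by (intro continuous_intros continuous_on_compose2[OF gamma_cont[of UNIV]]
    continuous_on_cis angle_cont) auto

lemma k_snd_cont: "continuous_on A (\<lambda>x. k (snd x))"
  by (rule continuous_on_compose2[OF k_cont]) (auto intro!: continuous_intros)

lemma dangle_cont:
  assumes "A \<subseteq> strip" "continuous_on A v"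
  shows "continuous_on A (\<lambda>x. dangle e x (v x))"
  unfolding dangle_def using sine_pos assms
  by (intro continuous_intros k_snd_cont sine_cont) (auto simp: less_le subset_iff)

lemma dT_cont:
  assumes A: "A \<subseteq> strip" and v: "continuous_on A v"
  shows "continuous_on A (\<lambda>x. dT x (v x))"
proof -
  have TA: "continuous_on A T" using T_cont A by (rule continuous_on_subset)
  have mT: "continuous_on A (\<lambda>x. moment (-1) (T x))"
    by (rule continuous_on_compose2[OF moment_cont[of strip] TA]) (use A T_props(1) in blast)+
  have sT: "continuous_on A (\<lambda>x. sine (T x))"
    by (rule continuous_on_compose2[OF sine_cont TA]) auto
  have kT: "continuous_on A (\<lambda>x. k (snd (T x)))"
    by (rule continuous_on_compose2[OF k_snd_cont[of UNIV] TA]) auto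
  have "sine (T x) \<noteq> 0" if "x \<in> A" for x
    using sine_pos[of "T x"] T_props(1)[of x] that A by auto
  then show ?thesis
    unfolding dT_def Let_def len_def
    by (intro continuous_intros sT kT mT moment_cont A dangle_cont v sine_cont) auto
qed

end

section \<open>The invariant curve\<close>

lemma nonvertical_slope:
  assumes "nonvertical_line l"
  shows "(slope l, 1) \<in> l" "v \<in> l \<Longrightarrow> v = snd v *\<^sub>R (slope l, 1)"
proof -
  have sub: "subspace l" and nv: "\<And>v. v \<in> l \<Longrightarrow> v \<noteq> 0 \<Longrightarrow> snd v \<noteq> 0" and dim: "dim l = 1"
    using assms by (auto simp: nonvertical_line_def)
  have unique: "v = snd v *\<^sub>R u" if "v \<in> l" "u \<in> l" "snd u = 1" for u v
  proof -
    have "v - snd v *\<^sub>R u \<in> l" using sub that by (simp add: subspace_diff subspace_scale)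
    moreover have "snd (v - snd v *\<^sub>R u) = 0" using that by simp
    ultimately have "v - snd v *\<^sub>R u = 0" using nv by blast
    then show ?thesis by simp
  qed
  have "\<exists>v\<in>l. v \<noteq> 0"
  proof (rule ccontr)
    assume "\<not> (\<exists>v\<in>l. v \<noteq> 0)"
    then have "l \<subseteq> {0}" by auto
    then show False using dim dim_eq_0[of l] by simp
  qed
  then obtain v where v: "v \<in> l" "v \<noteq> 0" by blast
  then have "snd v \<noteq> 0" using nv by blast
  then have "(1 / snd v) *\<^sub>R v = (fst v / snd v, 1)" by (simp add: prod_eq_iff)
  then have ex: "(fst v / snd v, 1) \<in> l" using sub v by (metis subspace_scale)
  have "a = b" if "(a, 1) \<in> l" "(b, 1) \<in> l" for a b
    using unique[OF that] by simp
  then show *: "(slope l, 1) \<in> l" unfolding slope_def using ex by (metis (mono_tags, lifting) theI')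
  show "v \<in> l \<Longrightarrow> v = snd v *\<^sub>R (slope l, 1)" for v using unique[OF _ *] by simp
qed

text \<open>A continuous locally injective function has no interior local extremum, whereas equal
  values at two points would produce one between them.\<close>

lemma locally_injective_imp_injective:
  fixes u :: "real \<Rightarrow> real"
  assumes cont: "continuous_on UNIV u"
    and loc: "\<And>t. \<exists>e>0. inj_on u {t - e<..<t + e}"
  shows "inj u"
proof -
  have no_extremum: False if ab: "a < t" "t < b" and ext: "(\<forall>x\<in>{a..b}. u x \<le> u t) \<or> (\<forall>x\<in>{a..b}. u t \<le> u x)" for a b t
  proof -
    obtain e where e: "e > 0" "inj_on u {t - e<..<t + e}" using loc by blast
    define d where "d = min (e / 2) (min (t - a) (b - t))"
    have d: "d > 0" "d < e" "d \<le> t - a" "d \<le> b - t" using e ab by (auto simp: d_def)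
    have "inj_on u {t - d..t + d}" by (rule inj_on_subset[OF e(2)]) (use d in auto)
    then have "u (t - d) < u t \<and> u t < u (t + d) \<or> u (t + d) < u t \<and> u t < u (t - d)"
      using d by (intro continuous_inj_imp_mono continuous_on_subset[OF cont]) auto
    moreover have "t - d \<in> {a..b}" "t + d \<in> {a..b}" using d by auto
    ultimately show False using ext by force
  qed
  have neq: "u a \<noteq> u b" if ab: "a < b" for a b
  proof
    assume eq: "u a = u b"
    have cab: "continuous_on {a..b} u" by (rule continuous_on_subset[OF cont]) auto
    obtain M where M: "M \<in> {a..b}" "\<forall>x\<in>{a..b}. u x \<le> u M"
      using continuous_attains_sup[OF compact_Icc _ cab] ab by (auto simp del: atLeastAtMost_iff)
    obtain m where m: "m \<in> {a..b}" "\<forall>x\<in>{a..b}. u m \<le> u x"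
      using continuous_attains_inf[OF compact_Icc _ cab] ab by (auto simp del: atLeastAtMost_iff)
    define t where "t = (a + b) / 2"
    have t: "a < t" "t < b" using ab by (auto simp: t_def)
    have "M = a \<or> M = b" using no_extremum[of a M b] M by force
    moreover have "m = a \<or> m = b" using no_extremum[of a m b] m by force
    ultimately have "\<forall>x\<in>{a..b}. u x = u a" using M m eq by force
    then have "\<forall>x\<in>{a..b}. u x \<le> u t"
      using t by (metis atLeastAtMost_iff less_imp_le order.refl)
    then show False using no_extremum[of a t b] t by blast
  qed
  show ?thesis
    by (rule injI) (metis neq linorder_neqE_linordered_idom)
qed

context oval
begin

section \<open>Iterates of the lifted map and the period on the curve\<close>

lemma T_shift_int: "x \<in> strip \<Longrightarrow> T (x + (0, of_int m * L)) = T x + (0, of_int m * L)"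
proof (induction m rule: int_induct[where k = 0])
  case (step1 i)
  have eq: "x + (0, of_int (i + 1) * L) = x + (0, of_int i * L) + (0, L)" for x :: "real \<times> real"
    by (simp add: prod_eq_iff algebra_simps)
  show ?case unfolding eq using step1 T_shift[of "x + (0, of_int i * L)"] by simp
next
  case (step2 i)
  have eq: "x + (0, of_int i * L) = x + (0, of_int (i - 1) * L) + (0, L)" for x :: "real \<times> real"
    by (simp add: prod_eq_iff algebra_simps)
  have "T (x + (0, of_int (i - 1) * L)) + (0, L) = T x + (0, of_int (i - 1) * L) + (0, L)"
    using step2 T_shift[of "x + (0, of_int (i - 1) * L)"] unfolding eq by simp
  then show ?case by simp
qed (simp add: zero_prod_def[symmetric])

lemma T_funpow_strip: "x \<in> strip \<Longrightarrow> (T ^^ n) x \<in> strip"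
  by (induction n) (auto simp: T_props)

lemma T_funpow_shift_int:
  "x \<in> strip \<Longrightarrow> (T ^^ n) (x + (0, of_int m * L)) = (T ^^ n) x + (0, of_int m * L)"
  by (induction n) (auto simp: T_shift_int T_funpow_strip)

text \<open>Periodicity on the cylinder leaves an unknown number \<open>m\<close> of turns after
  four steps. Along multiples of 4 the quotient defining the rotation number is constantly
  \<open>m / 4\<close>.\<close>

lemma period_from_rotation_number:
  assumes x: "x \<in> A" "A \<subseteq> strip" and rot: "has_rotation_number L T A (1/4)"
    and per: "consists_of_periodic_orbits L T 4 A"
  shows "(T ^^ 4) x = x + (0, L)"
proof -
  obtain m :: int where m: "(T ^^ 4) x = x + (0, of_int m * L)"
    using per x by (auto simp: consists_of_periodic_orbits_def)
  have xs: "x \<in> strip" using x by auto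
  have it: "(T ^^ (4 * n)) x = x + (0, of_int (int n * m) * L)" for n
  proof (induction n)
    case (Suc n)
    have "(T ^^ (4 * Suc n)) x = (T ^^ 4) ((T ^^ (4 * n)) x)"
      by (metis funpow_add o_apply mult_Suc_right)
    then show ?case
      unfolding Suc T_funpow_shift_int[OF xs] m by (simp add: prod_eq_iff algebra_simps)
  qed (simp add: zero_prod_def[symmetric])
  have "(\<lambda>n. (snd ((T ^^ n) x) - snd x) / (real n * L)) \<longlonglongrightarrow> 1/4"
    using rot x by (auto simp: has_rotation_number_def)
  \<comment> \<open>\<open>Suc n\<close> keeps the denominator away from zero, so the quotient is
    the same for every index.\<close>
  then have "(\<lambda>n. (snd ((T ^^ (4 * Suc n)) x) - snd x) / (real (4 * Suc n) * L)) \<longlonglongrightarrow> 1/4"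
    by (rule LIMSEQ_subseq_LIMSEQ[unfolded o_def, where f = "\<lambda>n. 4 * Suc n"]) (simp add: strict_mono_def)
  moreover have "(snd ((T ^^ (4 * Suc n)) x) - snd x) / (real (4 * Suc n) * L) = of_int m / 4" for n
  proof -
    define N where "N = real (Suc n)"
    have "N > 0" by (simp add: N_def)
    then have "(of_int m * N * L) / (4 * N * L) = of_int m / 4" using L_pos by simp
    then show ?thesis unfolding it by (simp add: N_def mult_ac)
  qed
  ultimately have "(\<lambda>n. of_int m / 4 :: real) \<longlonglongrightarrow> 1/4" by (simp only:)
  then have "of_int m / 4 = (1/4 :: real)" using LIMSEQ_unique tendsto_const by blast
  then show ?thesis using m by simp
qed

section \<open>Images of the vertical direction and the graph property\<close>

lemma dT_linear: "x \<in> strip \<Longrightarrow> linear (dT x)"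
  using T_deriv[of x] has_derivative_linear by blast

text \<open>The infinitesimal twist: increasing \<open>p = cos \<delta>\<close> turns the line
  clockwise and moves its exit point back.\<close>

lemma snd_dT_vertical: "x \<in> strip \<Longrightarrow> snd (dT x (1, 0)) < 0"
  using len_pos[of x] sine_pos[of x] sine_pos[OF T_props(1), of x]
  by (simp add: dT_def Let_def dangle_def divide_neg_pos mult_pos_neg)

text \<open>
  Since \<open>dT\<close> preserves area, \<open>v\<close> stays on the same side of the field \<open>(w, 1)\<close>; the twist then
  keeps its images to the left of the vertical.
\<close>

lemma vertical_image_step:
  assumes x: "x \<in> strip" and field: "dT x (w, 1) = r *\<^sub>R (w', 1)" "r > 0"
    and v: "fst v - w * snd v > 0" "snd v \<le> 0"
  shows "fst (dT x v) - w' * snd (dT x v) > 0" "snd (dT x v) < 0"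
proof -
  define d where "d = fst v - w * snd v"
  have "fst (dT x v) * r - r * w' * snd (dT x v) = d"
    using dT_cross[OF x, of v "(w, 1)"] unfolding field by (simp add: d_def algebra_simps)
  then have "r * (fst (dT x v) - w' * snd (dT x v)) > 0"
    using v by (simp add: d_def algebra_simps)
  then show "fst (dT x v) - w' * snd (dT x v) > 0" using field(2) by (simp add: zero_less_mult_iff)
  have "v = d *\<^sub>R (1, 0) + snd v *\<^sub>R (w, 1)" by (simp add: prod_eq_iff d_def)
  then have "dT x v = d *\<^sub>R dT x (1, 0) + snd v *\<^sub>R (r *\<^sub>R (w', 1))"
    using linear_add[OF dT_linear[OF x]] linear_scale[OF dT_linear[OF x]] field(1) by metis
  then have "snd (dT x v) = d * snd (dT x (1, 0)) + snd v * r" by simp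
  also have "\<dots> < 0"
    using snd_dT_vertical[OF x] v field(2)
    by (intro add_neg_nonpos) (auto simp: d_def mult_pos_neg mult_nonpos_nonneg)
  finally show "snd (dT x v) < 0" .
qed

text \<open>The derivative of the \<open>s\<close>-component of the fourth iterate along the
  vertical, written out by the chain rule.\<close>

definition D4 :: "real \<times> real \<Rightarrow> real" where
  "D4 x = snd (dT (T (T (T x))) (dT (T (T x)) (dT (T x) (dT x (1, 0)))))"

lemma D4_cont: "continuous_on strip D4"
proof -
  have c1: "continuous_on strip (\<lambda>x. T (T x))"
    by (rule continuous_on_compose2[OF T_cont T_cont]) (use T_props(1) in blast)
  have c2: "continuous_on strip (\<lambda>x. T (T (T x)))"
    by (rule continuous_on_compose2[OF T_cont c1]) (use T_props(1) in blast)
  have d0: "continuous_on strip (\<lambda>x. dT x (1, 0))"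
    by (intro dT_cont continuous_intros) auto
  \<comment> \<open>Base point and vector vary independently here. Linearity splits off the vector,
    leaving differentials applied to constant vectors.\<close>
  have step: "continuous_on strip (\<lambda>x. dT (f x) (v x))"
    if f: "continuous_on strip f" "f ` strip \<subseteq> strip" and v: "continuous_on strip v" for f v
  proof -
    have lin: "dT (f x) (v x) = fst (v x) *\<^sub>R dT (f x) (1, 0) + snd (v x) *\<^sub>R dT (f x) (0, 1)"
      if "x \<in> strip" for x
    proof -
      have "v x = fst (v x) *\<^sub>R (1, 0) + snd (v x) *\<^sub>R (0, 1)" by (simp add: prod_eq_iff)
      moreover have "f x \<in> strip" using f that by blast
      ultimately show ?thesis
        using linear_add[OF dT_linear] linear_scale[OF dT_linear] by metis
    qed
    have "continuous_on strip (\<lambda>x. dT (f x) a)" for a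
      by (rule continuous_on_compose2[OF dT_cont f(1)]) (use f in \<open>auto intro!: continuous_intros\<close>)
    then have "continuous_on strip (\<lambda>x. fst (v x) *\<^sub>R dT (f x) (1, 0) + snd (v x) *\<^sub>R dT (f x) (0, 1))"
      by (intro continuous_intros v)
    then show ?thesis by (rule continuous_on_eq) (use lin in auto)
  qed
  show ?thesis
    unfolding D4_def
    by (intro continuous_intros step c1 c2 T_cont d0) (use T_props(1) in blast)+
qed

lemma D4_deriv:
  assumes "(r, s) \<in> strip"
  shows "((\<lambda>r. snd (T (T (T (T (r, s)))))) has_real_derivative D4 (r, s)) (at r)"
proof -
  have Td: "((\<lambda>r. T (g r)) has_vector_derivative dT (g r) g') (at r)"
    if "(g has_vector_derivative g') (at r)" "g r \<in> strip" for g g'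
  proof -
    have "((\<lambda>r. T (g r)) has_derivative (\<lambda>t. dT (g r) (t *\<^sub>R g'))) (at r)"
      using has_derivative_compose[of g "\<lambda>t. t *\<^sub>R g'" r UNIV T "dT (g r)"] T_deriv[OF that(2)] that(1)
      by (simp add: has_vector_derivative_def)
    then show ?thesis
      using linear_scale[OF dT_linear[OF that(2)]] by (simp add: has_vector_derivative_def)
  qed
  have 0: "((\<lambda>r. (r, s)) has_vector_derivative (1, 0)) (at r)"
    by (rule has_vector_derivative_Pair) (auto intro!: derivative_eq_intros)
  have "((\<lambda>r. T (T (T (T (r, s))))) has_vector_derivative
      (dT (T (T (T (r, s)))) (dT (T (T (r, s))) (dT (T (r, s)) (dT (r, s) (1, 0)))))) (at r)"
    by (intro Td 0) (use assms T_props(1) in auto)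
  then have "((\<lambda>r. snd (T (T (T (T (r, s)))))) has_vector_derivative D4 (r, s)) (at r)"
    unfolding D4_def by (rule bounded_linear.has_vector_derivative[OF bounded_linear_snd])
  then show ?thesis by (simp add: has_real_derivative_iff_has_vector_derivative)
qed

text \<open>
  Two such points on one vertical would have images under \<open>T\<^sup>4\<close> on one vertical, so that \<open>D4\<close>
  vanishes between them by Rolle's theorem.
\<close>

lemma periodic_set_locally_graph:
  assumes x: "x \<in> strip" and neg: "D4 x < 0"
  obtains e where "e > 0" "\<And>y z. dist y x < e \<Longrightarrow> dist z x < e \<Longrightarrow> snd y = snd z \<Longrightarrow>
    (T ^^ 4) y = y + (0, L) \<Longrightarrow> (T ^^ 4) z = z + (0, L) \<Longrightarrow> y = z"
proof -
  have "isCont D4 x" using D4_cont open_strip x by (simp add: continuous_on_eq_continuous_at)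
  then have "eventually (\<lambda>y. D4 y < 0) (nhds x)"
    using neg by (metis isCont_def order_tendstoD(2) tendsto_at_iff_tendsto_nhds)
  then have "eventually (\<lambda>y. D4 y < 0 \<and> y \<in> strip) (nhds x)"
    using eventually_nhds_in_open[OF open_strip x] by eventually_elim auto
  then obtain e where e: "e > 0" "\<And>y. dist y x < e \<Longrightarrow> D4 y < 0 \<and> y \<in> strip"
    unfolding eventually_nhds_metric by blast
  have strict: False if yz: "dist y x < e" "dist z x < e" "snd y = snd z" "fst y < fst z"
    "(T ^^ 4) y = y + (0, L)" "(T ^^ 4) z = z + (0, L)" for y z
  proof -
    have seg: "dist (r, snd y) x < e" if "fst y \<le> r" "r \<le> fst z" for r
    proof -
      have "(r, snd y) \<in> closed_segment y z"
      proof -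
        have "r \<in> closed_segment (fst y) (fst z)" using that by (simp add: closed_segment_eq_real_ivl)
        then obtain t where "0 \<le> t" "t \<le> 1" "r = (1 - t) * fst y + t * fst z"
          by (auto simp: in_segment)
        then show ?thesis using yz(3)
          by (auto simp: in_segment prod_eq_iff algebra_simps intro!: exI[of _ t])
      qed
      moreover have "closed_segment y z \<subseteq> ball x e"
        using yz by (intro closed_segment_subset convex_ball) (auto simp: dist_commute)
      ultimately show ?thesis by (auto simp: dist_commute)
    qed
    have "snd (T (T (T (T (fst z, snd y))))) < snd (T (T (T (T (fst y, snd y)))))"
      by (rule DERIV_neg_imp_decreasing[OF yz(4)]) (use seg e D4_deriv in blast)
    moreover have "T (T (T (T y))) = y + (0, L)" "T (T (T (T z))) = z + (0, L)"
      using yz by (simp_all add: numeral_eq_Suc)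
    ultimately show False using yz(3) by (metis order.irrefl prod.collapse snd_add)
  qed
  show ?thesis
  proof (rule that[OF e(1)])
    fix y z
    assume *: "dist y x < e" "dist z x < e" "snd y = snd z"
      "(T ^^ 4) y = y + (0, L)" "(T ^^ 4) z = z + (0, L)"
    then have "fst y = fst z" using strict[of y z] strict[of z y] by (metis linorder_neqE_linordered_idom)
    then show "y = z" using * by (simp add: prod_eq_iff)
  qed
qed

text \<open>\<open>periodic_set_locally_graph\<close> makes the \<open>s\<close>-component locally
  injective along the curve, hence injective; winding once around the cylinder makes it
  surjective.\<close>

lemma rotational_curve_graph:
  assumes rot: "rotational_curve L A"
    and per: "\<And>x. x \<in> A \<Longrightarrow> (T ^^ 4) x = x + (0, L)"
    and neg: "\<And>x. x \<in> A \<Longrightarrow> D4 x < 0"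
  obtains f where "continuous_on UNIV f" "A = range (\<lambda>s. (f s, s))"
proof -
  obtain c :: "real \<Rightarrow> real \<times> real" where "continuous_on UNIV c \<and> range c = A \<and> A \<subseteq> strip \<and> (\<forall>t. c (t + 1) = c t + (0, L)) \<and>
      (\<forall>t t'. \<forall>k::int. c t' = c t + (0, of_int k * L) \<longrightarrow> t' = t + of_int k)"
    using rot unfolding rotational_curve_def by (rule exE)
  then have c: "continuous_on UNIV c" "range c = A" "A \<subseteq> strip" "\<forall>t. c (t + 1) = c t + (0, L)"
      "\<forall>t t'. \<forall>k::int. c t' = c t + (0, of_int k * L) \<longrightarrow> t' = t + of_int k"
    by blast+
  have c_inj: "t = t'" if "c t = c t'" for t t'
    using c(5)[rule_format, of t' t 0] that by (simp add: zero_prod_def[symmetric])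
  define u where "u t = snd (c t)" for t
  have u_cont: "continuous_on UNIV u" unfolding u_def by (intro continuous_intros c(1))
  have "inj u"
  proof (rule locally_injective_imp_injective[OF u_cont])
    fix t
    have ct: "c t \<in> A" using c(2) by blast
    obtain e where e: "e > 0" "\<And>y z. dist y (c t) < e \<Longrightarrow> dist z (c t) < e \<Longrightarrow> snd y = snd z \<Longrightarrow>
        (T ^^ 4) y = y + (0, L) \<Longrightarrow> (T ^^ 4) z = z + (0, L) \<Longrightarrow> y = z"
      using periodic_set_locally_graph[OF _ neg[OF ct]] ct c(3) by blast
    have "isCont c t" using c(1) by (simp add: continuous_on_eq_continuous_at)
    then obtain d where d: "d > 0" "\<And>t'. dist t' t < d \<Longrightarrow> dist (c t') (c t) < e"
      using e(1) unfolding continuous_at_eps_delta by blast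
    have "inj_on u {t - d<..<t + d}"
    proof (rule inj_onI)
      fix a b assume ab: "a \<in> {t - d<..<t + d}" "b \<in> {t - d<..<t + d}" "u a = u b"
      have "c a = c b"
      proof (rule e(2))
        show "dist (c a) (c t) < e" "dist (c b) (c t) < e"
          using ab by (auto intro!: d(2) simp: dist_real_def)
        show "snd (c a) = snd (c b)" using ab by (simp add: u_def)
      qed (rule per, use c(2) in blast)+
      then show "a = b" by (rule c_inj)
    qed
    with d(1) show "\<exists>e>0. inj_on u {t - e<..<t + e}" by blast
  qed
  have u_nat: "u (t + real n) = u t + real n * L" for t n
  proof (induction n)
    case (Suc n)
    have eq: "t + real (Suc n) = (t + real n) + 1" by simp
    have "u ((t + real n) + 1) = u (t + real n) + L" by (simp add: u_def c(4))
    then show ?case unfolding eq using Suc by (simp add: algebra_simps)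
  qed simp
  have "surj u"
    unfolding surj_def
  proof
    fix s
    obtain n where n: "s - u 0 \<le> real n * L"
      using real_arch_simple[of "(s - u 0) / L"] L_pos by (auto simp: field_simps)
    obtain m where m: "u 0 - s \<le> real m * L"
      using real_arch_simple[of "(u 0 - s) / L"] L_pos by (auto simp: field_simps)
    have "u (- real m) \<le> s" "s \<le> u (real n)"
      using u_nat[of "- real m" m] u_nat[of 0 n] n m by auto
    then obtain t where "u t = s"
      using IVT'[of u "- real m" s "real n"] continuous_on_subset[OF u_cont] by auto
    then show "\<exists>t. s = u t" by blast
  qed
  have inv_cont: "continuous_on UNIV (inv u)"
    using continuous_on_inverse_open[OF open_UNIV u_cont, of "inv u"] \<open>inj u\<close> \<open>surj u\<close> by simp
  define f where "f s = fst (c (inv u s))" for s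
  show ?thesis
  proof (rule that)
    show "continuous_on UNIV f"
      unfolding f_def by (intro continuous_intros continuous_on_compose2[OF c(1) inv_cont]) auto
    have "c t = (f (u t), u t)" for t
      unfolding f_def inv_f_f[OF \<open>inj u\<close>] by (simp add: u_def)
    moreover have "(f s, s) = c (inv u s)" for s
      using \<open>surj u\<close> by (simp add: prod_eq_iff f_def) (metis surj_f_inv_f u_def)
    ultimately show "A = range (\<lambda>s. (f s, s))"
      unfolding c(2)[symmetric] by (auto simp: image_iff) metis+
  qed
qed

text \<open>The vertical vector \<open>(1, 0)\<close> satisfies the hypotheses of
  \<open>vertical_image_step\<close>, whose conclusions are its hypotheses at the next point of the
  orbit; four applications suffice.\<close>

lemma D4_neg:
  assumes x: "x \<in> A" and A: "A \<subseteq> strip" "T ` A \<subseteq> A"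
    and field: "\<And>x. x \<in> A \<Longrightarrow> \<exists>r>0. dT x (w x, 1) = r *\<^sub>R (w (T x), 1)"
  shows "D4 x < 0"
proof -
  have step: "fst (dT y v) - w (T y) * snd (dT y v) > 0 \<and> snd (dT y v) < 0"
    if "y \<in> A" "fst v - w y * snd v > 0 \<and> snd v \<le> 0" for y v
    using field[OF that(1)] vertical_image_step[of y "w y" _ "w (T y)" v] that A by blast
  have TA: "T y \<in> A" if "y \<in> A" for y using A that by blast
  define v1 where "v1 = dT x (1, 0)"
  define v2 where "v2 = dT (T x) v1"
  define v3 where "v3 = dT (T (T x)) v2"
  have 1: "fst v1 - w (T x) * snd v1 > 0 \<and> snd v1 < 0"
    unfolding v1_def by (rule step[OF x]) simp
  have 2: "fst v2 - w (T (T x)) * snd v2 > 0 \<and> snd v2 < 0"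
    unfolding v2_def by (rule step) (use 1 x TA in auto)
  have 3: "fst v3 - w (T (T (T x))) * snd v3 > 0 \<and> snd v3 < 0"
    unfolding v3_def by (rule step) (use 2 x TA in auto)
  have "snd (dT (T (T (T x))) v3) < 0"
    using step[of "T (T (T x))" v3] 3 x TA by auto
  then show ?thesis by (simp add: D4_def v3_def v2_def v1_def)
qed

text \<open>By the twist, the set \<open>{\<psi>. G1 \<psi> < G2 \<psi>}\<close> is invariant under \<open>G1\<close>.\<close>

lemma chord_map_comparison:
  fixes G1 G2 \<delta>1 \<delta>2 :: "real \<Rightarrow> real"
  assumes c1: "\<And>\<psi>. chord \<psi> (\<psi> + \<delta>1 \<psi>) (G1 \<psi>)" and c2: "\<And>\<psi>. chord \<psi> (\<psi> + \<delta>2 \<psi>) (G2 \<psi>)"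
    and r1: "\<And>\<psi>. G1 \<psi> - \<delta>1 (G1 \<psi>) = \<psi> + \<delta>1 \<psi>" and r2: "\<And>\<psi>. G2 \<psi> - \<delta>2 (G2 \<psi>) = \<psi> + \<delta>2 \<psi>"
    and m1: "strict_mono G1" and m2: "strict_mono G2"
    and p1: "\<And>\<psi>. G1 (G1 (G1 (G1 \<psi>))) = \<psi> + 2 * pi" and p2: "\<And>\<psi>. G2 (G2 (G2 (G2 \<psi>))) = \<psi> + 2 * pi"
  shows "\<not> G1 \<psi> < G2 \<psi>"
proof
  assume less: "G1 \<psi> < G2 \<psi>"
  have shift1: "G1 (\<psi> - 2 * pi) = G1 \<psi> - 2 * pi" for \<psi>
    using p1[of "\<psi> - 2 * pi"] p1[of "G1 (\<psi> - 2 * pi)"] by simp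
  have shift2: "G2 (\<psi> - 2 * pi) = G2 \<psi> - 2 * pi" for \<psi>
    using p2[of "\<psi> - 2 * pi"] p2[of "G2 (\<psi> - 2 * pi)"] by simp
  \<comment> \<open>By 4-periodicity the inverse of \<open>G1\<close> is three more steps followed
    by one full turn back.\<close>
  define H1 where "H1 \<psi> = G1 (G1 (G1 \<psi>)) - 2 * pi" for \<psi>
  define H2 where "H2 \<psi> = G2 (G2 (G2 \<psi>)) - 2 * pi" for \<psi>
  have GH: "G1 (H1 \<psi>) = \<psi>" "G2 (H2 \<psi>) = \<psi>" "H1 (G1 \<psi>) = \<psi>" "H2 (G2 \<psi>) = \<psi>" for \<psi>
    by (simp_all add: H1_def H2_def shift1 shift2 p1 p2)
  have back1: "chord (H1 \<psi>) (\<psi> - \<delta>1 \<psi>) \<psi>" for \<psi> using c1[of "H1 \<psi>"] r1[of "H1 \<psi>"] GH by simp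
  have back2: "chord (H2 \<psi>) (\<psi> - \<delta>2 \<psi>) \<psi>" for \<psi> using c2[of "H2 \<psi>"] r2[of "H2 \<psi>"] GH by simp
  \<comment> \<open>The twist at both ends of a chord: a larger angle \<delta> at a vertex sends the
    next vertex forward and the previous one back.\<close>
  have equiv: "G1 \<psi> < G2 \<psi> \<longleftrightarrow> H2 \<psi> < H1 \<psi>" for \<psi>
    using chord_mono[OF c1[of \<psi>] c2[of \<psi>]] chord_mono'[OF back2[of \<psi>] back1[of \<psi>]] by simp
  have step: "G1 (G1 \<psi>) < G2 (G1 \<psi>)" if "G1 \<psi> < G2 \<psi>" for \<psi>
  proof -
    have "H2 (G1 \<psi>) < H2 (G2 \<psi>)"
      using that m2 by (simp add: H2_def strict_mono_less)
    then show ?thesis by (simp add: equiv GH)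
  qed
  \<comment> \<open>The strict inequality persists along the \<open>G1\<close>-orbit and survives
    monotone composition, although both fourth iterates are one full turn.\<close>
  let ?a = "G1 \<psi>" let ?b = "G1 ?a" let ?c = "G1 ?b"
  have "G1 ?a < G2 ?a" "G1 ?b < G2 ?b" "G1 ?c < G2 ?c"
    using step[OF less] step[OF step[OF less]] step[OF step[OF step[OF less]]] .
  moreover have "?b < G2 (G2 \<psi>)"
    using \<open>G1 ?a < G2 ?a\<close> less m2 by (meson order.strict_trans strict_mono_less)
  moreover have "?c < G2 (G2 (G2 \<psi>))"
    using \<open>G1 ?b < G2 ?b\<close> \<open>?b < G2 (G2 \<psi>)\<close> m2 by (meson order.strict_trans strict_mono_less)
  moreover have "G1 ?c < G2 (G2 (G2 (G2 \<psi>)))"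
    using \<open>G1 ?c < G2 ?c\<close> \<open>?c < G2 (G2 (G2 \<psi>))\<close> m2 by (meson order.strict_trans strict_mono_less)
  ultimately show False by (simp add: p1 p2)
qed

lemma four_periodic_structure:
  fixes f :: "real \<Rightarrow> real"
  assumes f_cont: "continuous_on UNIV f" and A: "A = range (\<lambda>s. (f s, s))" "A \<subseteq> strip"
    and TA: "T ` A \<subseteq> A" and per: "\<And>x. x \<in> A \<Longrightarrow> (T ^^ 4) x = x + (0, L)"
  shows "arccos (f (\<sigma> (\<psi> + pi / 2))) = pi / 2 - arccos (f (\<sigma> \<psi>))"
    and "chord \<psi> (\<psi> + arccos (f (\<sigma> \<psi>))) (\<psi> + pi / 2)"
proof -
  define \<delta> where "\<delta> \<psi> = arccos (f (\<sigma> \<psi>))" for \<psi>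
  define X where "X \<psi> = (f (\<sigma> \<psi>), \<sigma> \<psi>)" for \<psi>
  define G where "G \<psi> = \<Theta> (snd (T (X \<psi>)))" for \<psi>
  have XA: "X \<psi> \<in> A" for \<psi> using A by (auto simp: X_def)
  then have Xs: "X \<psi> \<in> strip" for \<psi> using A by blast
  have TX: "T (X \<psi>) = X (G \<psi>)" for \<psi>
  proof -
    have "T (X \<psi>) \<in> A" using TA XA by blast
    then show ?thesis unfolding A X_def G_def by auto
  qed
  have angX: "angle e (X \<psi>) = \<psi> + e * \<delta> \<psi>" for e \<psi>
    by (simp add: angle_def X_def \<delta>_def)
  have snd_X: "\<Theta> (snd (X \<psi>)) = \<psi>" for \<psi> by (simp add: X_def)
  have ch: "chord \<psi> (\<psi> + \<delta> \<psi>) (G \<psi>)" for \<psi>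
    using T_props(2)[OF Xs[of \<psi>]] by (simp add: angX snd_X TX)
  have re: "G \<psi> - \<delta> (G \<psi>) = \<psi> + \<delta> \<psi>" for \<psi>
    using T_props(3)[OF Xs[of \<psi>]] by (simp add: angX TX)
  have G4: "G (G (G (G \<psi>))) = \<psi> + 2 * pi" for \<psi>
  proof -
    have "X (G (G (G (G \<psi>)))) = X \<psi> + (0, L)"
      using per[OF XA[of \<psi>]] by (simp add: numeral_eq_Suc TX)
    then have "\<Theta> (snd (X (G (G (G (G \<psi>)))))) = \<Theta> (snd (X \<psi>) + L)" by simp
    then show ?thesis unfolding Theta_period snd_X .
  qed
  have X_cont: "continuous_on UNIV X"
    unfolding X_def by (intro continuous_intros continuous_on_compose2[OF f_cont sigma_cont] sigma_cont) auto
  have "continuous_on UNIV (\<lambda>\<psi>. T (X \<psi>))"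
    by (rule continuous_on_compose2[OF T_cont X_cont]) (use Xs in auto)
  then have G_cont: "continuous_on UNIV G"
    unfolding G_def by (intro continuous_on_compose2[OF Theta_cont[of UNIV]] continuous_intros) auto
  have G_inj: "inj G" by (rule injI) (metis G4 add_right_cancel)
  have G_shift: "G (\<psi> + 2 * pi * real n) = G \<psi> + 2 * pi * real n" for \<psi> n
  proof (induction n)
    case (Suc n)
    have "G (\<psi> + 2 * pi) = G \<psi> + 2 * pi" for \<psi>
      using G4[of \<psi>] G4[of "G \<psi>"] by simp
    then have "G (\<psi> + 2 * pi * real n + 2 * pi) = G \<psi> + 2 * pi * real n + 2 * pi" using Suc by simp
    then show ?case by (simp add: algebra_simps)
  qed simp
  have G_mono: "strict_mono G"
  proof (rule strict_monoI)
    fix a b :: real assume ab: "a < b"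
    \<comment> \<open>Continuity and injectivity leave two directions; comparison with a translate
      of \<open>a\<close> by full turns beyond \<open>b\<close> excludes the decreasing one.\<close>
    obtain n where n: "b - a < real n * (2 * pi)" using reals_Archimedean3[of "2 * pi"] by auto
    define d where "d = a + 2 * pi * real n"
    have bd: "b < d" using n by (simp add: d_def mult.commute)
    have "(G a < G b \<and> G b < G d) \<or> (G d < G b \<and> G b < G a)"
      by (rule continuous_inj_imp_mono)
         (use ab bd in \<open>auto intro: continuous_on_subset[OF G_cont] inj_on_subset[OF G_inj]\<close>)
    moreover have "G a \<le> G d" unfolding d_def G_shift by simp
    ultimately show "G a < G b" by auto
  qed
  define G' where "G' \<psi> = G (\<psi> + pi) - pi" for \<psi>
  define \<delta>' where "\<delta>' \<psi> = \<delta> (\<psi> + pi)" for \<psi>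
  have ch': "chord \<psi> (\<psi> + \<delta>' \<psi>) (G' \<psi>)" for \<psi>
    using ch[of "\<psi> + pi"] chord_shift[of \<psi> "\<psi> + \<delta>' \<psi>" "G' \<psi>"] by (simp add: G'_def \<delta>'_def add_ac)
  have re': "G' \<psi> - \<delta>' (G' \<psi>) = \<psi> + \<delta>' \<psi>" for \<psi>
    using re[of "\<psi> + pi"] by (simp add: G'_def \<delta>'_def)
  have G'_mono: "strict_mono G'" using G_mono by (auto simp: strict_mono_def G'_def)
  have G'4: "G' (G' (G' (G' \<psi>))) = \<psi> + 2 * pi" for \<psi> by (simp add: G'_def G4)
  have GG': "G \<psi> = G' \<psi>" for \<psi>
    using chord_map_comparison[OF ch ch' re re' G_mono G'_mono G4 G'4, of \<psi>]
      chord_map_comparison[OF ch' ch re' re G'_mono G_mono G'4 G4, of \<psi>] by simp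
  have G_pi: "G (\<psi> + pi) = G \<psi> + pi" for \<psi>
    using GG'[of \<psi>] unfolding G'_def by linarith
  have \<delta>_pi: "\<delta> (\<psi> + pi) = \<delta> \<psi>" for \<psi>
    using chord_unique_angle[OF ch[of \<psi>] ch'[of \<psi>, folded GG']] by (simp add: \<delta>'_def)
  have GG: "G (G \<psi>) = \<psi> + pi" for \<psi>
  proof -
    \<comment> \<open>An increasing involution of the line is the identity. It is an involution
      because \<open>G\<close> commutes with the half turn.\<close>
    define q where "q x = G (G x) - pi" for x
    have "G (y - pi) = G y - pi" for y using G_pi[of "y - pi"] by simp
    then have qq: "q (q \<psi>) = \<psi>" by (simp add: q_def G4)
    have q_mono: "q x < q y" if "x < y" for x y
      using that strict_mono_less[OF G_mono] by (simp add: q_def)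
    have "q \<psi> = \<psi>"
      using q_mono[of "q \<psi>" \<psi>] q_mono[of \<psi> "q \<psi>"] unfolding qq by linarith
    then show ?thesis by (simp add: q_def)
  qed
  \<comment> \<open>By \<open>re\<close>, the steps from \<psi> to \<open>G \<psi>\<close> and from
    \<open>G \<psi>\<close> to \<open>\<psi> + pi\<close> both equal
    \<open>\<delta> \<psi> + \<delta> (G \<psi>)\<close>, so each is half of
    \<open>pi\<close>.\<close>
  have half: "G \<psi> = \<psi> + pi / 2" for \<psi>
    using re[of \<psi>] re[of "G \<psi>"] \<delta>_pi[of \<psi>] by (simp add: GG)
  show "arccos (f (\<sigma> (\<psi> + pi / 2))) = pi / 2 - arccos (f (\<sigma> \<psi>))"
    using re[of \<psi>] by (simp add: half \<delta>_def)
  show "chord \<psi> (\<psi> + arccos (f (\<sigma> \<psi>))) (\<psi> + pi / 2)"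
    using ch[of \<psi>] by (simp add: half \<delta>_def)
qed

lemma P_dot_cis: "P \<psi> \<bullet> cis (\<psi> + a) = h \<psi> * cos a + h' \<psi> * sin a"
  by (subst P_frame) (simp add: inner_add_left inner_cis)

text \<open>Both ends of a chord give its distance from the centre. Combining this for two
  consecutive sides yields \<open>A\<close>, which fixes the ratio of the two support values, and
  \<open>B\<close>; together they imply \<open>C\<close>, the vanishing derivative of
  \<open>E\<close>.\<close>

lemma four_periodic_support:
  fixes \<delta> :: "real \<Rightarrow> real"
  assumes ch: "\<And>\<psi>. chord \<psi> (\<psi> + \<delta> \<psi>) (\<psi> + pi / 2)"
    and half: "\<And>\<psi>. \<delta> (\<psi> + pi / 2) = pi / 2 - \<delta> \<psi>"
  obtains R where "R > 0" "\<And>\<psi>. (h \<psi>)\<^sup>2 + (h (\<psi> + pi / 2))\<^sup>2 = R\<^sup>2"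
    "\<And>\<psi>. sin (\<delta> \<psi>) = h \<psi> / R" "\<And>\<psi>. cos (\<delta> \<psi>) = h (\<psi> + pi / 2) / R"
proof -
  have \<delta>: "0 < \<delta> \<psi>" "\<delta> \<psi> < pi / 2" for \<psi>
    using ch[of \<psi>] ch[of "\<psi> + pi / 2"] unfolding half by (auto simp: chord_def)
  then have sin_pos: "sin (\<delta> \<psi>) > 0" and cos_pos: "cos (\<delta> \<psi>) > 0" for \<psi>
    using sin_gt_zero2[OF \<delta>] cos_gt_zero[OF \<delta>] by auto
  have eq: "h \<psi> * cos (\<delta> \<psi>) + h' \<psi> * sin (\<delta> \<psi>) =
      h (\<psi> + pi / 2) * sin (\<delta> \<psi>) - h' (\<psi> + pi / 2) * cos (\<delta> \<psi>)" for \<psi>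
  proof -
    have "P \<psi> \<bullet> cis (\<psi> + \<delta> \<psi>) = P (\<psi> + pi / 2) \<bullet> cis (\<psi> + pi / 2 + (\<delta> \<psi> - pi / 2))"
      using ch[of \<psi>] by (simp add: chord_def)
    then show ?thesis unfolding P_dot_cis by (simp add: cos_diff sin_diff)
  qed
  \<comment> \<open>The equation of the next side: \<open>half\<close> exchanges sine and cosine,
    and central symmetry brings \<open>\<psi> + pi\<close> back to \<psi>.\<close>
  have eq': "h (\<psi> + pi / 2) * sin (\<delta> \<psi>) + h' (\<psi> + pi / 2) * cos (\<delta> \<psi>) =
      h \<psi> * cos (\<delta> \<psi>) - h' \<psi> * sin (\<delta> \<psi>)" for \<psi>
    using eq[of "\<psi> + pi / 2"] unfolding half
    by (simp add: cos_diff sin_diff add.assoc h_half_period)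
  have A: "h \<psi> * cos (\<delta> \<psi>) = h (\<psi> + pi / 2) * sin (\<delta> \<psi>)" for \<psi> using eq[of \<psi>] eq'[of \<psi>] by linarith
  have B: "h' \<psi> * sin (\<delta> \<psi>) + h' (\<psi> + pi / 2) * cos (\<delta> \<psi>) = 0" for \<psi> using eq[of \<psi>] eq'[of \<psi>] by linarith
  have C: "h \<psi> * h' \<psi> + h (\<psi> + pi / 2) * h' (\<psi> + pi / 2) = 0" for \<psi>
  proof -
    have "sin (\<delta> \<psi>) * (h \<psi> * h' \<psi> + h (\<psi> + pi / 2) * h' (\<psi> + pi / 2)) =
       h \<psi> * (h' \<psi> * sin (\<delta> \<psi>)) + (h (\<psi> + pi / 2) * sin (\<delta> \<psi>)) * h' (\<psi> + pi / 2)"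
      by (simp add: algebra_simps)
    also have "\<dots> = h \<psi> * (h' \<psi> * sin (\<delta> \<psi>) + h' (\<psi> + pi / 2) * cos (\<delta> \<psi>))"
      unfolding A[symmetric] by (simp add: algebra_simps)
    finally show ?thesis using sin_pos[of \<psi>] by (simp add: B)
  qed
  define E where "E \<psi> = (h \<psi>)\<^sup>2 + (h (\<psi> + pi / 2))\<^sup>2" for \<psi>
  have "(E has_real_derivative 0) (at \<psi>)" for \<psi>
  proof -
    have "((\<lambda>\<psi>. h (\<psi> + pi / 2)) has_real_derivative h' (\<psi> + pi / 2)) (at \<psi>)"
      using h_deriv[of "\<psi> + pi / 2"] by (simp add: DERIV_shift)
    then have "(E has_real_derivative 2 * h \<psi> * h' \<psi> + 2 * h (\<psi> + pi / 2) * h' (\<psi> + pi / 2)) (at \<psi>)"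
      unfolding E_def[abs_def] by (auto intro!: derivative_eq_intros h_deriv)
    moreover have "2 * h \<psi> * h' \<psi> + 2 * h (\<psi> + pi / 2) * h' (\<psi> + pi / 2) = 0"
      using C[of \<psi>] by (simp add: algebra_simps)
    ultimately show ?thesis by simp
  qed
  then have const: "E \<psi> = E 0" for \<psi> using DERIV_isconst_all by blast
  define R where "R = sqrt (E 0)"
  have E0: "E 0 > 0" using h_pos[of 0] by (simp add: E_def add_pos_nonneg)
  then have R: "R > 0" "R\<^sup>2 = E \<psi>" for \<psi> using const[of \<psi>] by (auto simp: R_def)
  have "(h \<psi>)\<^sup>2 = (R * sin (\<delta> \<psi>))\<^sup>2" for \<psi>
  proof -
    have "(h \<psi>)\<^sup>2 = (h \<psi>)\<^sup>2 * ((sin (\<delta> \<psi>))\<^sup>2 + (cos (\<delta> \<psi>))\<^sup>2)" by simp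
    also have "\<dots> = (sin (\<delta> \<psi>))\<^sup>2 * (h \<psi>)\<^sup>2 + (h \<psi> * cos (\<delta> \<psi>))\<^sup>2"
      unfolding power_mult_distrib by (simp only: distrib_left mult.commute)
    also have "\<dots> = R\<^sup>2 * (sin (\<delta> \<psi>))\<^sup>2"
      unfolding A R(2)[of \<psi>] E_def by (simp add: algebra_simps)
    finally show ?thesis by (simp add: power_mult_distrib)
  qed
  then have hS: "h \<psi> = R * sin (\<delta> \<psi>)" for \<psi>
    using h_pos[of \<psi>] sin_pos[of \<psi>] R(1) by (smt (verit) power2_eq_iff mult_pos_pos)
  show ?thesis
  proof (rule that[OF R(1)])
    show "(h \<psi>)\<^sup>2 + (h (\<psi> + pi / 2))\<^sup>2 = R\<^sup>2" for \<psi> by (simp add: R(2)[of \<psi>] E_def)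
    show "sin (\<delta> \<psi>) = h \<psi> / R" for \<psi> using R(1) by (simp add: hS)
    have "cos (\<delta> \<psi>) = sin (\<delta> (\<psi> + pi / 2))" for \<psi> by (simp add: half sin_diff)
    then show "cos (\<delta> \<psi>) = h (\<psi> + pi / 2) / R" for \<psi> using R(1) by (simp add: hS)
  qed
qed

end

section \<open>The region between the invariant curves\<close>

text \<open>The bound \<open>m\<close> keeps components between the graphs away from the ends of the
  cylinder. A point outside can be moved along its vertical arbitrarily close to one end without
  meeting the curves.\<close>

lemma region_between_graphs:
  fixes f :: "real \<Rightarrow> real"
  assumes cont: "continuous_on UNIV f" and pos: "\<And>s. f s > 0" and m: "\<And>s. f s \<le> m" "m < 1"
  shows "region_bounded_by (range (\<lambda>s. (f s, s)) \<union> range (\<lambda>s. (- f s, s))) = {x. \<bar>fst x\<bar> \<le> f (snd x)}"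
    (is "region_bounded_by ?K = ?B")
proof -
  define V where "V = {x :: real \<times> real. \<bar>fst x\<bar> < f (snd x)}"
  define W where "W = {x :: real \<times> real. f (snd x) < \<bar>fst x\<bar>}"
  have f_snd: "continuous_on UNIV (\<lambda>x :: real \<times> real. f (snd x))"
    by (rule continuous_on_compose2[OF cont]) (auto intro!: continuous_intros)
  have open_V: "open V" unfolding V_def by (intro open_Collect_less continuous_intros f_snd)
  have open_W: "open W" unfolding W_def by (intro open_Collect_less continuous_intros f_snd)
  have K: "x \<in> ?K \<longleftrightarrow> \<bar>fst x\<bar> = f (snd x)" for x :: "real \<times> real"
    using pos[of "snd x"] by (cases x) (auto simp: image_iff abs_if)
  have S: "x \<in> strip - ?K \<longleftrightarrow> x \<in> strip \<and> (x \<in> V \<or> x \<in> W)" for x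
    unfolding Diff_iff K V_def W_def by auto
  have V_strip: "x \<in> strip" if "x \<in> V" for x
    using that m(1)[of "snd x"] m(2) by (auto simp: V_def strip_iff)
  have inner: "\<exists>c<1. \<forall>y \<in> connected_component_set (strip - ?K) x. \<bar>fst y\<bar> \<le> c" if x: "x \<in> V" for x
  proof (intro exI conjI ballI)
    fix y assume y: "y \<in> connected_component_set (strip - ?K) x"
    let ?C = "connected_component_set (strip - ?K) x"
    have xS: "x \<in> strip - ?K" using S V_strip x by blast
    have sub: "?C \<subseteq> strip - ?K" by (rule connected_component_subset)
    have "V \<inter> ?C = {} \<or> W \<inter> ?C = {}"
    proof (rule connectedD[OF connected_connected_component open_V open_W])
      show "V \<inter> W \<inter> ?C = {}" by (auto simp: V_def W_def)
      show "?C \<subseteq> V \<union> W" using sub S by blast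
    qed
    moreover have "x \<in> V \<inter> ?C" using x xS by (simp add: connected_component_refl)
    ultimately have "y \<in> V" using y sub S by blast
    then show "\<bar>fst y\<bar> \<le> m" using m(1)[of "snd y"] by (auto simp: V_def)
  qed (rule m(2))
  have outer: "\<not> (\<exists>c<1. \<forall>y \<in> connected_component_set (strip - ?K) x. \<bar>fst y\<bar> \<le> c)"
    if x: "x \<in> W" "x \<in> strip" for x
  proof
    assume "\<exists>c<1. \<forall>y \<in> connected_component_set (strip - ?K) x. \<bar>fst y\<bar> \<le> c"
    then obtain c where c: "c < 1" "\<And>y. y \<in> connected_component_set (strip - ?K) x \<Longrightarrow> \<bar>fst y\<bar> \<le> c" by blast
    have x1: "\<bar>fst x\<bar> < 1" using x by (auto simp: strip_iff)
    \<comment> \<open>A level above the supposed bound and above the given point, but still inside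
      the strip.\<close>
    define q where "q = (max c \<bar>fst x\<bar> + 1) / 2"
    have q: "c < q" "\<bar>fst x\<bar> < q" "q < 1" using c x1 by (auto simp: q_def)
    define y where "y = (sgn (fst x) * q, snd x)"
    have nz: "fst x \<noteq> 0" using x(1) pos[of "snd x"] by (auto simp: W_def)
    have seg: "closed_segment x y \<subseteq> strip - ?K"
    proof
      fix z assume "z \<in> closed_segment x y"
      then obtain t where t: "0 \<le> t" "t \<le> 1" and z: "z = (1 - t) *\<^sub>R x + t *\<^sub>R y" by (auto simp: in_segment)
      have sz: "snd z = snd x" by (simp add: z y_def algebra_simps)
      have fz: "fst z = sgn (fst x) * ((1 - t) * \<bar>fst x\<bar> + t * q)"
      proof -
        have "fst z = (1 - t) * (sgn (fst x) * \<bar>fst x\<bar>) + t * (sgn (fst x) * q)"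
          unfolding sgn_mult_abs by (simp add: z y_def)
        then show ?thesis by (simp only: distrib_left mult.left_commute)
      qed
      have b: "\<bar>fst x\<bar> \<le> (1 - t) * \<bar>fst x\<bar> + t * q" "(1 - t) * \<bar>fst x\<bar> + t * q \<le> q"
        using convex_bound_le[of "- \<bar>fst x\<bar>" "- \<bar>fst x\<bar>" "- q" "1 - t" t]
          convex_bound_le[of "\<bar>fst x\<bar>" q q "1 - t" t] t q by auto
      have "\<bar>fst z\<bar> = (1 - t) * \<bar>fst x\<bar> + t * q"
        using b(1) nz unfolding fz abs_mult by (simp add: abs_sgn_eq)
      then have "\<bar>fst x\<bar> \<le> \<bar>fst z\<bar>" "\<bar>fst z\<bar> \<le> q" using b by auto
      then have "z \<in> W" "z \<in> strip" using x(1) sz q by (auto simp: W_def strip_iff)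
      then show "z \<in> strip - ?K" using S by blast
    qed
    then have "y \<in> connected_component_set (strip - ?K) x"
      using connected_component_maximal[of x "closed_segment x y" "strip - ?K"] by auto
    then have "\<bar>fst y\<bar> \<le> c" by (rule c(2))
    then show False using q x1 nz by (auto simp: y_def abs_mult abs_sgn_eq)
  qed
  have "x \<in> region_bounded_by ?K \<longleftrightarrow> x \<in> ?B" for x
  proof (cases "x \<in> ?K")
    case True
    then show ?thesis unfolding region_bounded_by_def using K[of x] by auto
  next
    case False
    then have "x \<in> V \<or> x \<in> W" unfolding K V_def W_def by auto
    moreover have "x \<in> ?B \<longleftrightarrow> x \<in> V" using False unfolding K V_def by auto
    moreover have "x \<in> region_bounded_by ?K" if "x \<in> V"
      using inner[OF that] V_strip[OF that] False unfolding region_bounded_by_def by blast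
    moreover have "x \<notin> region_bounded_by ?K" if "x \<in> W"
      using outer[OF that] False unfolding region_bounded_by_def by blast
    moreover have "\<not> (x \<in> V \<and> x \<in> W)" by (auto simp: V_def W_def)
    ultimately show ?thesis by blast
  qed
  then show ?thesis by blast
qed

context oval
begin

context
  fixes f :: "real \<Rightarrow> real"
  assumes f_range: "\<And>s. -1 < f s \<and> f s < 1"
    and ch: "\<And>\<psi>. chord \<psi> (\<psi> + arccos (f (\<sigma> \<psi>))) (\<psi> + pi / 2)"
    and half: "\<And>\<psi>. arccos (f (\<sigma> (\<psi> + pi / 2))) = pi / 2 - arccos (f (\<sigma> \<psi>))"
begin

section \<open>Invariance of the region\<close>

lemma graph_fun_pos: "f s > 0"
proof -
  have "arccos (f s) < pi / 2" "0 < arccos (f s)"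
    using half[of "\<Theta> s"] ch[of "\<Theta> s + pi / 2"] ch[of "\<Theta> s"] by (auto simp: chord_def)
  then have "cos (arccos (f s)) > 0" by (intro cos_gt_zero)
  then show ?thesis using f_range[of s] by simp
qed

lemma graph_fun_period: "f (s + L) = f s"
proof -
  have 1: "arccos (f (\<sigma> (\<psi> + pi))) = arccos (f (\<sigma> \<psi>))" for \<psi>
    using half[of \<psi>] half[of "\<psi> + pi / 2"] by (simp add: add.assoc)
  have "arccos (f (\<sigma> (\<psi> + 2 * pi))) = arccos (f (\<sigma> \<psi>))" for \<psi>
    using 1[of \<psi>] 1[of "\<psi> + pi"] by (simp add: add.assoc)
  from this[of "\<Theta> s"] have "arccos (f (s + L)) = arccos (f s)" by (simp add: sigma_period)
  then show ?thesis using f_range by (metis cos_arccos less_imp_le)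
qed

lemma in_region_iff:
  assumes x: "x \<in> strip"
  shows "\<bar>fst x\<bar> \<le> f (snd x) \<longleftrightarrow>
    arccos (f (snd x)) \<le> arccos (fst x) \<and> arccos (fst x) \<le> pi - arccos (f (snd x))"
proof -
  have b: "\<bar>fst x\<bar> \<le> 1" "\<bar>f (snd x)\<bar> \<le> 1" "\<bar>- f (snd x)\<bar> \<le> 1"
    using x f_range[of "snd x"] by (auto simp: strip_iff)
  have "arccos (- f (snd x)) = pi - arccos (f (snd x))"
    using f_range[of "snd x"] by (intro arccos_minus) auto
  then show ?thesis
    using arccos_le_mono[OF b(2,1)] arccos_le_mono[OF b(1,3)] by auto
qed

lemma region_strip: "\<bar>fst x\<bar> \<le> f (snd x) \<Longrightarrow> x \<in> strip"
  using f_range[of "snd x"] by (auto simp: strip_iff)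

lemma chord_back: "chord (\<psi> - pi / 2) (\<psi> - arccos (f (\<sigma> \<psi>))) \<psi>"
proof -
  have eq: "\<psi> - arccos (f (\<sigma> \<psi>)) = \<psi> - pi / 2 + arccos (f (\<sigma> (\<psi> - pi / 2)))"
    using half[of "\<psi> - pi / 2"] by simp
  show ?thesis using ch[of "\<psi> - pi / 2"] unfolding eq by simp
qed

text \<open>A line of \<alpha> arriving at \<psi>, run backwards: the chord of the reversed curve
  that leaves \<psi>.\<close>

lemma chord_rev: "chord \<psi> (\<psi> - arccos (f (\<sigma> \<psi>)) + pi) (\<psi> + 3 * pi / 2)"
proof -
  have eq: "\<psi> - pi / 2 + 2 * pi = \<psi> + 3 * pi / 2" by simp
  show ?thesis using chord_reverse[OF chord_back[of \<psi>]] unfolding eq .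
qed

lemma chord_rev_back: "chord (\<psi> - 3 * pi / 2) (\<psi> + arccos (f (\<sigma> \<psi>)) - pi) \<psi>"
proof -
  have "chord (\<psi> - 3 * pi / 2 + 2 * pi) (\<psi> + arccos (f (\<sigma> \<psi>)) - pi + 2 * pi) (\<psi> + 2 * pi)"
    using chord_reverse[OF ch[of \<psi>]] by (simp add: algebra_simps)
  then show ?thesis unfolding chord_shift2 .
qed

text \<open>A line of the region leaves its starting point between the lines of the two curves. The
  twist with fixed start orders the end points, and the twist with fixed end converts this order
  back into one of angles.\<close>

lemma T_region:
  assumes "\<bar>fst x\<bar> \<le> f (snd x)"
  shows "\<bar>fst (T x)\<bar> \<le> f (snd (T x))"
proof -
  have x: "x \<in> strip" using assms by (rule region_strip)
  define \<psi> where "\<psi> = \<Theta> (snd x)"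
  define \<psi>' where "\<psi>' = \<Theta> (snd (T x))"
  have \<sigma>: "\<sigma> \<psi> = snd x" "\<sigma> \<psi>' = snd (T x)" by (simp_all add: \<psi>_def \<psi>'_def)
  have c: "chord \<psi> (angle 1 x) \<psi>'" using T_props(2)[OF x] by (simp add: \<psi>_def \<psi>'_def)
  have a: "angle 1 x = \<psi> + arccos (fst x)" "angle 1 x = \<psi>' - arccos (fst (T x))"
    using T_props(3)[OF x] by (simp_all add: angle_def \<psi>_def \<psi>'_def)
  have b: "arccos (f (snd x)) \<le> arccos (fst x)" "arccos (fst x) \<le> pi - arccos (f (snd x))"
    using in_region_iff[OF x] assms by auto
  have "\<psi> + pi / 2 \<le> \<psi>'"
    using chord_mono[OF c ch[of \<psi>]] b(1) unfolding a(1) \<sigma> by linarith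
  then have 1: "arccos (f (snd (T x))) \<le> arccos (fst (T x))"
    using chord_mono'[OF chord_back[of \<psi>'] c] unfolding a(2) \<sigma> by linarith
  have "\<psi>' \<le> \<psi> + 3 * pi / 2"
    using chord_mono[OF chord_rev[of \<psi>] c] b(2) unfolding a(1) \<sigma> by linarith
  then have 2: "arccos (fst (T x)) \<le> pi - arccos (f (snd (T x)))"
    using chord_mono'[OF c chord_rev_back[of \<psi>']] unfolding a(2) \<sigma> by linarith
  show ?thesis using 1 2 in_region_iff[OF T_props(1)[OF x]] by auto
qed

text \<open>The inverse of \<open>T\<close> is \<open>T\<close> conjugated by \<open>flip\<close>,
  followed by a translation, and both operations preserve the region.\<close>

lemma T_region_surj:
  assumes "\<bar>fst y\<bar> \<le> f (snd y)"
  obtains x where "\<bar>fst x\<bar> \<le> f (snd x)" "T x = y"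
proof -
  define B where "B = {x :: real \<times> real. \<bar>fst x\<bar> \<le> f (snd x)}"
  have fB: "flip x \<in> B \<longleftrightarrow> x \<in> B" for x by (simp add: B_def flip_def)
  define z where "z = flip (T (flip y))"
  have yB: "y \<in> B" using assms by (simp add: B_def)
  then have ys: "flip y \<in> strip" using region_strip[of y] by (simp add: B_def)
  have zB: "z \<in> B" unfolding z_def fB using T_region[of "flip y"] yB fB[of y] by (simp add: B_def)
  have Tz: "T z = y + (0, L)" unfolding z_def using T_flip_T[OF ys] by simp
  define x where "x = z - (0, L)"
  have zx: "z = x + (0, L)" by (simp add: x_def)
  have xB: "x \<in> B" using zB graph_fun_period[of "snd x"] by (simp add: zx B_def)
  then have "x \<in> strip" using region_strip[of x] by (simp add: B_def)
  then have "T x + (0, L) = y + (0, L)" using Tz T_shift unfolding zx by metis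
  then show ?thesis using that xB by (simp add: B_def)
qed

end

end

section \<open>Hopf's inequality\<close>

lemma integral_multiple_period:
  fixes g :: "real \<Rightarrow> real"
  assumes cont: "continuous_on UNIV g" and per: "\<And>s. g (s + p) = g s" and p: "p \<ge> 0"
  shows "integral {0..real n * p} g = real n * integral {0..p} g"
proof (induction n)
  case (Suc n)
  have "integral {0..real n * p + p} g = integral {0..real n * p} g + integral {real n * p..real n * p + p} g"
    using p by (intro Henstock_Kurzweil_Integration.integral_combine[symmetric]
      integrable_continuous_interval continuous_on_subset[OF cont]) auto
  then show ?case
    using Suc integral_periodic_shift[OF cont per p, of "real n * p"] by (simp add: algebra_simps)
qed simp

lemma compact_region_piece:
  fixes f :: "real \<Rightarrow> real"
  assumes cont: "continuous_on UNIV f" and f1: "\<And>s. f s \<le> 1"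
  shows "compact {x :: real \<times> real. \<bar>fst x\<bar> \<le> f (snd x) \<and> a \<le> snd x \<and> snd x \<le> b}" (is "compact ?S")
proof -
  have f_snd: "continuous_on UNIV (\<lambda>x :: real \<times> real. f (snd x))"
    by (rule continuous_on_compose2[OF cont]) (auto intro!: continuous_intros)
  have "closed ?S"
    by (intro closed_Collect_conj closed_Collect_le continuous_intros f_snd)
  moreover have "?S \<subseteq> {-1..1} \<times> {a..b}"
  proof
    fix x assume "x \<in> ?S"
    then show "x \<in> {-1..1} \<times> {a..b}" using f1[of "snd x"] by (cases x) auto
  qed
  then have "bounded ?S"
    by (rule bounded_subset[rotated]) (intro bounded_Times bounded_closed_interval)
  ultimately show ?thesis by (simp add: compact_eq_bounded_closed)
qed

lemma integral_double_sqrt: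
  fixes c :: real
  assumes "0 < c" "c < 1"
  shows "((\<lambda>p. 2 * sqrt (1 - p\<^sup>2)) has_integral (2 * c * sqrt (1 - c\<^sup>2) + 2 * arcsin c)) {-c..c}"
proof -
  define F where "F p = p * sqrt (1 - p\<^sup>2) + arcsin p" for p :: real
  have "((\<lambda>p. 2 * sqrt (1 - p\<^sup>2)) has_integral (F c - F (- c))) {-c..c}"
  proof (rule fundamental_theorem_of_calculus)
    fix p assume p: "p \<in> {-c..c}"
    then have b: "-1 < p" "p < 1" using assms by auto
    then have pos: "1 - p\<^sup>2 > 0" by (simp add: abs_square_less_1 abs_less_iff)
    have "(F has_real_derivative
        (1 * sqrt (1 - p\<^sup>2) + ((- (2 * p)) * (inverse (sqrt (1 - p\<^sup>2)) / 2)) * p) + inverse (sqrt (1 - p\<^sup>2))) (at p)"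
      unfolding F_def[abs_def] using b pos
      by (auto intro!: derivative_eq_intros DERIV_arcsin simp: field_simps)
    moreover have "(1 * sqrt (1 - p\<^sup>2) + ((- (2 * p)) * (inverse (sqrt (1 - p\<^sup>2)) / 2)) * p) + inverse (sqrt (1 - p\<^sup>2))
        = 2 * sqrt (1 - p\<^sup>2)"
    proof -
      define r where "r = sqrt (1 - p\<^sup>2)"
      have r: "r > 0" "p\<^sup>2 = 1 - r\<^sup>2" using pos by (auto simp: r_def)
      have "(1 * r + ((- (2 * p)) * (inverse r / 2)) * p) + inverse r = (r\<^sup>2 - p\<^sup>2 + 1) / r"
        using r(1) by (simp add: field_simps power2_eq_square)
      also have "\<dots> = 2 * r" using r(1) unfolding r(2) by (simp add: field_simps power2_eq_square)
      finally show ?thesis by (simp add: r_def)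
    qed
    ultimately have "(F has_real_derivative 2 * sqrt (1 - p\<^sup>2)) (at p)" by (simp only:)
    then show "(F has_vector_derivative 2 * sqrt (1 - p\<^sup>2)) (at p within {-c..c})"
      by (simp add: has_real_derivative_iff_has_vector_derivative has_vector_derivative_at_within)
  qed (use assms in auto)
  moreover have "F c - F (- c) = 2 * c * sqrt (1 - c\<^sup>2) + 2 * arcsin c"
    using assms by (simp add: F_def arcsin_minus)
  ultimately show ?thesis by simp
qed

text \<open>This is the origin of the weight: for \<open>f = cos \<delta>\<close> with \<delta>
  between 0 and \<open>pi / 2\<close>, the fibre integral is
  \<open>pi - 2 * \<delta> + sin (2 * \<delta>)\<close>.\<close>

lemma integral_region_sine:
  fixes f a :: "real \<Rightarrow> real"
  assumes cont: "continuous_on UNIV f" and f01: "\<And>s. 0 < f s \<and> f s < 1"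
    and cont_a: "continuous_on UNIV a" and b: "b \<ge> 0"
  defines "S \<equiv> {x :: real \<times> real. \<bar>fst x\<bar> \<le> f (snd x) \<and> 0 \<le> snd x \<and> snd x \<le> b}"
  shows "integral S (\<lambda>x. 2 * sine x * a (snd x)) =
    integral {0..b} (\<lambda>s. a s * (2 * f s * sqrt (1 - (f s)\<^sup>2) + 2 * arcsin (f s)))"
proof -
  have cS: "compact S" unfolding S_def by (intro compact_region_piece cont) (use f01 less_imp_le in blast)
  define Q where "Q x = 2 * sine x * a (snd x)" for x
  define W where "W s = 2 * f s * sqrt (1 - (f s)\<^sup>2) + 2 * arcsin (f s)" for s
  have Q_cont: "continuous_on S Q"
    unfolding Q_def sine_def
    by (intro continuous_intros continuous_on_compose2[OF cont_a]) auto
  have f_bounds: "-1 \<le> f s" "f s \<le> 1" for s using f01[of s] by auto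
  have W_cont: "continuous_on UNIV W"
    unfolding W_def by (intro continuous_intros cont) (use f_bounds in auto)
  have int: "integrable lborel (\<lambda>x. indicator S x *\<^sub>R Q x)"
    by (rule borel_integrable_compact[OF cS Q_cont])
  have "integral S Q = (LINT x : S | lborel. Q x)"
    by (rule set_borel_integral_eq_integral(2)[symmetric]) (use int in \<open>simp add: set_integrable_def\<close>)
  also have "\<dots> = integral\<^sup>L (lborel \<Otimes>\<^sub>M lborel) (\<lambda>(p, s). indicator S (p, s) *\<^sub>R Q (p, s))"
    by (simp add: set_lebesgue_integral_def lborel_prod case_prod_unfold)
  also have "\<dots> = (\<integral>s. (\<integral>p. indicator S (p, s) *\<^sub>R Q (p, s) \<partial>lborel) \<partial>lborel)"
    by (rule lborel_pair.integral_snd[symmetric]) (use int in \<open>simp add: lborel_prod case_prod_unfold\<close>)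
  also have "\<dots> = (\<integral>s. indicator {0..b} s *\<^sub>R (a s * W s) \<partial>lborel)"
  proof (rule Bochner_Integration.integral_cong[OF refl])
    fix s :: real
    have hi: "((\<lambda>p. 2 * sqrt (1 - p\<^sup>2) * a s) has_integral (W s * a s)) {- f s..f s}"
      unfolding W_def by (intro has_integral_mult_left integral_double_sqrt) (use f01 in auto)
    have "set_integrable lborel {- f s..f s} (\<lambda>p. 2 * sqrt (1 - p\<^sup>2) * a s)"
      by (intro borel_integrable_atLeastAtMost' continuous_intros)
    then have "(LINT p : {- f s..f s} | lborel. 2 * sqrt (1 - p\<^sup>2) * a s) =
        integral {- f s..f s} (\<lambda>p. 2 * sqrt (1 - p\<^sup>2) * a s)"
      by (rule set_borel_integral_eq_integral(2))
    also have "\<dots> = W s * a s" by (rule integral_unique[OF hi])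
    finally have inner: "(LINT p : {- f s..f s} | lborel. 2 * sqrt (1 - p\<^sup>2) * a s) = W s * a s" .
    have "(\<integral>p. indicator {- f s..f s} p *\<^sub>R (2 * sqrt (1 - p\<^sup>2) * a s) \<partial>lborel) = W s * a s"
      using inner unfolding set_lebesgue_integral_def .
    moreover have "indicator S (p, s) *\<^sub>R Q (p, s) =
        indicator {0..b} s *\<^sub>R (indicator {- f s..f s} p *\<^sub>R (2 * sqrt (1 - p\<^sup>2) * a s))" for p
      by (auto simp: indicator_def S_def Q_def sine_def)
    ultimately show "(\<integral>p. indicator S (p, s) *\<^sub>R Q (p, s) \<partial>lborel) = indicator {0..b} s *\<^sub>R (a s * W s)"
      by (simp only: Bochner_Integration.integral_scaleR_right mult.commute)
  qed
  also have "\<dots> = integral {0..b} (\<lambda>s. a s * W s)"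
    using set_borel_integral_eq_integral(2)[of "{0..b}" "\<lambda>s. a s * W s"]
      borel_integrable_atLeastAtMost'[of 0 b "\<lambda>s. a s * W s"]
      continuous_on_subset[OF continuous_on_mult[OF cont_a W_cont]]
    by (simp add: set_lebesgue_integral_def)
  finally show ?thesis unfolding Q_def W_def .
qed

context oval
begin

lemma P_bounded: obtains M where "M > 0" "\<And>\<psi>. norm (P \<psi>) \<le> M"
proof -
  have "continuous_on {0..2 * pi} P"
    using P_deriv by (meson has_vector_derivative_continuous continuous_at_imp_continuous_on)
  then have "bounded (P ` {0..2 * pi})"
    by (intro compact_imp_bounded compact_continuous_image) auto
  then obtain M where M: "M > 0" "\<And>z. z \<in> P ` {0..2 * pi} \<Longrightarrow> norm z \<le> M"
    unfolding bounded_pos by blast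
  have "norm (P \<psi>) \<le> M" for \<psi>
  proof -
    obtain n where "0 \<le> \<psi> + of_int n * (2 * pi)" "\<psi> + of_int n * (2 * pi) < 0 + 2 * pi"
      by (rule reduce_mod_2pi)
    then have "P (\<psi> + of_int n * (2 * pi)) \<in> P ` {0..2 * pi}" by (intro imageI) auto
    then show ?thesis using M(2) unfolding P_add_int by blast
  qed
  with M(1) show ?thesis by (rule that)
qed

lemma moment_bound: "(\<And>\<psi>. norm (P \<psi>) \<le> M) \<Longrightarrow> \<bar>moment e x\<bar> \<le> M"
  using Cauchy_Schwarz_ineq2[of "P (\<Theta> (snd x))" "\<i> * cis (angle e x)"]
  by (simp add: moment_def P_Theta norm_mult) (metis P_Theta order.trans)

lemma line_dist_bound: "(\<And>\<psi>. norm (P \<psi>) \<le> M) \<Longrightarrow> \<bar>snd (line e x)\<bar> \<le> M"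
  using Cauchy_Schwarz_ineq2[of "P (\<Theta> (snd x))" "cis (angle e x)"]
  by (simp add: line_def P_Theta norm_mult) (metis P_Theta order.trans)

lemma moment_eq: "x \<in> strip \<Longrightarrow> moment 1 x - moment (-1) x = - 2 * h (\<Theta> (snd x)) * sine x"
proof -
  assume x: "x \<in> strip"
  have "moment e x = - h (\<Theta> (snd x)) * sin (e * arccos (fst x)) + h' (\<Theta> (snd x)) * cos (e * arccos (fst x))" for e
    unfolding moment_def P_Theta[symmetric] angle_def
    by (subst P_frame) (simp add: inner_add_left inner_cis)
  then show ?thesis using sin_arccos_strip[OF x] by simp
qed

context
  fixes f :: "real \<Rightarrow> real" and w :: "real \<times> real \<Rightarrow> real" and B :: "(real \<times> real) set"
  assumes f_cont: "continuous_on UNIV f" and f01: "\<And>s. 0 < f s \<and> f s < 1"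
    and f_per: "\<And>s. f (s + L) = f s"
    and B_def: "B = {x. \<bar>fst x\<bar> \<le> f (snd x)}"
    and T_B: "T ` B = B"
    and w_meas: "w \<in> borel_measurable (lebesgue_on B)"
    and w_field: "\<And>x. x \<in> B \<Longrightarrow> \<exists>r>0. dT x (w x, 1) = r *\<^sub>R (w (T x), 1)"
begin

lemma B_strip: "B \<subseteq> strip"
proof
  fix x assume "x \<in> B"
  then show "x \<in> strip" using f01[of "snd x"] by (auto simp: B_def strip_iff)
qed

text \<open>Rotation rates of the outgoing and of the incoming line along the field vector
  normalised by \<open>ds = 1\<close>.\<close>

definition rot_out :: "real \<times> real \<Rightarrow> real" where "rot_out x = dangle 1 x (w x, 1)"
definition rot_in :: "real \<times> real \<Rightarrow> real" where "rot_in x = dangle (-1) x (w x, 1)"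

text \<open>The slope of the field in the coordinates of the space of lines.\<close>

definition om_out :: "real \<times> real \<Rightarrow> real" where "om_out x = moment 1 x + sine x / rot_out x"
definition om_in :: "real \<times> real \<Rightarrow> real" where "om_in x = moment (-1) x - sine x / rot_in x"

text \<open>Preservation of the orientation is \<open>r > 0\<close>; it turns
  \<open>sine_snd_dT\<close> into a sum of positive terms. The slopes agree because they belong to
  the same line, read from its two ends.\<close>

lemma field_step:
  assumes x: "x \<in> B"
  shows "rot_out x > 0" "rot_in (T x) > 0" "om_in (T x) = om_out x"
proof -
  have xs: "x \<in> strip" using x B_strip by blast
  obtain r where r: "r > 0" "dT x (w x, 1) = r *\<^sub>R (w (T x), 1)" using w_field[OF x] by blast
  have l: "len x > 0" and s: "sine x > 0" and s': "sine (T x) > 0"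
    using len_pos[OF xs] sine_pos[OF xs] sine_pos[OF T_props(1)[OF xs]] by auto
  have eq: "len x * rot_out x = sine x + sine (T x) * r"
    using sine_snd_dT[OF xs, of "(w x, 1)"] unfolding r(2) rot_out_def by simp
  have "len x * rot_out x > 0" unfolding eq using s s' r(1) by (simp add: add_pos_pos)
  then show pos: "rot_out x > 0" using l by (simp add: zero_less_mult_iff)
  have eq2: "r * rot_in (T x) = rot_out x"
    using dangle_dT[OF xs, of "(w x, 1)"] unfolding r(2) rot_out_def rot_in_def
    by (simp add: dangle_def algebra_simps)
  then show pos': "rot_in (T x) > 0" using pos r(1) by (metis zero_less_mult_pos)
  have ri: "rot_in (T x) = rot_out x / r" using eq2 r(1) by (simp add: field_simps)
  have "om_in (T x) = moment (-1) (T x) - sine (T x) * r / rot_out x"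
    using r(1) by (simp add: om_in_def ri)
  also have "sine (T x) * r / rot_out x = len x - sine x / rot_out x"
    using eq pos by (simp add: field_simps)
  finally show "om_in (T x) = om_out x" by (simp add: om_out_def len_def)
qed

lemma rot_in_pos: "x \<in> B \<Longrightarrow> rot_in x > 0"
  using T_B field_step(2) by (metis imageE)

text \<open>The two expressions for the slope on a chord squeeze it between
  \<open>moment 1 y\<close> and \<open>moment (-1) (T y)\<close>. This makes a merely measurable
  field integrable over bounded pieces.\<close>

lemma om_bound:
  assumes M: "\<And>\<psi>. norm (P \<psi>) \<le> M" and x: "x \<in> B"
  shows "\<bar>om_out x\<bar> \<le> M" "\<bar>om_in x\<bar> \<le> M"
proof -
  have 1: "\<bar>om_out y\<bar> \<le> M" if y: "y \<in> B" for y
  proof -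
    have ys: "sine y > 0" "sine (T y) > 0" using y B_strip sine_pos T_props(1) by blast+
    have "om_out y \<ge> moment 1 y" using ys field_step(1)[OF y] by (simp add: om_out_def)
    moreover have "om_out y \<le> moment (-1) (T y)"
      unfolding field_step(3)[OF y, symmetric] om_in_def using ys field_step(2)[OF y] by simp
    ultimately show ?thesis using moment_bound[OF M, of 1 y] moment_bound[OF M, of "-1" "T y"] by linarith
  qed
  then show "\<bar>om_out x\<bar> \<le> M" using x .
  obtain y where "y \<in> B" "x = T y" using x T_B by blast
  then show "\<bar>om_in x\<bar> \<le> M" using 1[of y] field_step(3)[of y] by simp
qed

text \<open>The rates \<open>rot_out\<close> and \<open>rot_in\<close> add up to twice the
  curvature, so the inequality of arithmetic and harmonic means bounds the sum of their reciprocals.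
  The factor \<open>1 / k - h\<close> is \<open>h''\<close>.\<close>

lemma om_increment:
  assumes x: "x \<in> B"
  shows "2 * sine x * (1 / k (snd x) - h (\<Theta> (snd x))) \<le> om_out x - om_in x"
proof -
  have xs: "x \<in> strip" using x B_strip by blast
  define a where "a = rot_out x"
  define b where "b = rot_in x"
  have ab: "a > 0" "b > 0" using field_step(1)[OF x] rot_in_pos[OF x] by (auto simp: a_def b_def)
  have sum: "a + b = 2 * k (snd x)" by (simp add: a_def b_def rot_out_def rot_in_def dangle_def)
  have "0 \<le> (a - b)\<^sup>2" by simp
  then have "4 * (a * b) \<le> (a + b) * (a + b)" by (simp add: power2_eq_square algebra_simps)
  then have "4 / (a + b) \<le> 1 / a + 1 / b"
    using ab by (simp add: field_simps)
  then have *: "2 / k (snd x) \<le> 1 / a + 1 / b" unfolding sum by simp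
  have "om_out x - om_in x = (moment 1 x - moment (-1) x) + sine x * (1 / a + 1 / b)"
    by (simp add: om_out_def om_in_def a_def b_def algebra_simps)
  also have "\<dots> \<ge> - 2 * h (\<Theta> (snd x)) * sine x + sine x * (2 / k (snd x))"
    unfolding moment_eq[OF xs] using * sine_pos[OF xs] by (intro add_left_mono mult_left_mono) auto
  finally show ?thesis by (simp add: algebra_simps)
qed

section \<open>Integration over the space of lines\<close>

lemma B_lebesgue: "B \<in> sets lebesgue"
proof -
  have "closed B" unfolding B_def
    by (intro closed_Collect_le continuous_intros continuous_on_compose2[OF f_cont]) auto
  then show ?thesis by (simp add: borel_closed)
qed

lemma om_measurable: "om_out \<in> borel_measurable (lebesgue_on B)" "om_in \<in> borel_measurable (lebesgue_on B)"
proof -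
  have m: "g \<in> borel_measurable (lebesgue_on B)" if "continuous_on B g" for g :: "real \<times> real \<Rightarrow> real"
    using that B_lebesgue by (rule continuous_imp_measurable_on_sets_lebesgue)
  have [measurable]: "moment e \<in> borel_measurable (lebesgue_on B)" "sine \<in> borel_measurable (lebesgue_on B)"
     "(\<lambda>x. k (snd x)) \<in> borel_measurable (lebesgue_on B)" for e
    using moment_cont[OF B_strip] sine_cont k_snd_cont by (auto intro: m)
  note w_meas[measurable]
  show "om_out \<in> borel_measurable (lebesgue_on B)"
    unfolding om_out_def[abs_def] rot_out_def dangle_def fst_conv snd_conv by measurable
  show "om_in \<in> borel_measurable (lebesgue_on B)"
    unfolding om_in_def[abs_def] rot_in_def dangle_def fst_conv snd_conv by measurable
qed

text \<open>
  On the piece of \<open>B\<close> over \<open>n\<close> periods the integrals of \<open>om_out\<close> and \<open>om_in\<close> are integrals of one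
  function over two sets of lines whose symmetric difference lies in two boxes independent of
  \<open>n\<close> up to translation.
\<close>

lemma increment_integral_bound:
  assumes M: "\<And>\<psi>. norm (P \<psi>) \<le> M"
  defines "S n \<equiv> {x :: real \<times> real. \<bar>fst x\<bar> \<le> f (snd x) \<and> 0 \<le> snd x \<and> snd x \<le> real n * L}"
  shows "(\<lambda>x. om_out x - om_in x) integrable_on S n"
    "integral (S n) (\<lambda>x. om_out x - om_in x) \<le> 8 * pi * M\<^sup>2"
proof -
  have M0: "M \<ge> 0" using M[of 0] norm_ge_zero order.trans by blast
  have SB: "S n \<subseteq> B" by (auto simp: S_def B_def)
  have cS: "compact (S n)" unfolding S_def by (intro compact_region_piece f_cont) (use f01 less_imp_le in blast)
  then have Sl: "S n \<in> sets lebesgue" by (simp add: borel_compact)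
  have Sstrip: "x \<in> strip" if "x \<in> S n" for x using that SB B_strip by blast
  have const: "(\<lambda>x. M) integrable_on S n"
    using cS by (intro integrable_on_const lmeasurable_compact)
  have ai: "om_out absolutely_integrable_on S n" "om_in absolutely_integrable_on S n"
    by (intro measurable_bounded_by_integrable_imp_absolutely_integrable[OF _ Sl const]
       measurable_restrict_mono[OF om_measurable(1) SB]  measurable_restrict_mono[OF om_measurable(2) SB],
       use SB om_bound[OF M] in auto)+
  then have i: "om_out integrable_on S n" "om_in integrable_on S n" by (auto simp: absolutely_integrable_on_def)
  then show "(\<lambda>x. om_out x - om_in x) integrable_on S n" by (rule integrable_diff)
  \<comment> \<open>The slope as a function on the space of lines, defined through the outgoing
    chart; invariance of the field makes it the same through the incoming one.\<close>
  define \<omega> where "\<omega> z = om_out (inv_into B (line 1) z)" for z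
  have inj1: "inj_on (line 1) B" and inj2: "inj_on (line (-1)) B"
    using inj_on_subset[OF line_out_inj B_strip] inj_on_subset[OF line_in_inj B_strip] by auto
  have \<omega>1: "\<omega> (line 1 x) = om_out x" if "x \<in> B" for x by (simp add: \<omega>_def inv_into_f_f[OF inj1 that])
  have \<omega>2: "\<omega> (line (-1) x) = om_in x" if x: "x \<in> B" for x
  proof -
    obtain y where y: "y \<in> B" "x = T y" using x T_B by blast
    then show ?thesis using line_T[of y] B_strip \<omega>1[OF y(1)] field_step(3)[OF y(1)] by auto
  qed
  have cov: "\<omega> absolutely_integrable_on (line e ` S n)" "integral (line e ` S n) \<omega> = integral (S n) (\<lambda>x. \<omega> (line e x))"
    if e: "e = 1 \<or> e = -1" for e
  proof -
    have e1: "(\<lambda>x. \<omega> (line e x)) absolutely_integrable_on S n"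
    proof -
      have "(\<lambda>x. \<omega> (line 1 x)) absolutely_integrable_on S n \<longleftrightarrow> om_out absolutely_integrable_on S n"
        using SB by (intro set_integrable_cong refl) (auto simp: \<omega>1 subset_iff)
      moreover have "(\<lambda>x. \<omega> (line (-1) x)) absolutely_integrable_on S n \<longleftrightarrow> om_in absolutely_integrable_on S n"
        using SB by (intro set_integrable_cong refl) (auto simp: \<omega>2 subset_iff)
      ultimately show ?thesis using e ai by auto
    qed
    have inj: "inj_on (line e) (S n)" using e inj_on_subset[OF inj1 SB] inj_on_subset[OF inj2 SB] by auto
    have der: "(line e has_derivative dline e x) (at x)" if "x \<in> S n" for x
      using line_deriv[OF Sstrip[OF that] e] .
    have det: "\<bar>fst (dline e x (1, 0)) * snd (dline e x (0, 1)) - fst (dline e x (0, 1)) * snd (dline e x (1, 0))\<bar> = 1"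
      if "x \<in> S n" for x
      using dline_cross[OF Sstrip[OF that] e, of "(1, 0)" "(0, 1)"] by simp
    show "\<omega> absolutely_integrable_on (line e ` S n)" "integral (line e ` S n) \<omega> = integral (S n) (\<lambda>x. \<omega> (line e x))"
      using change_of_variables_area_preserving[OF cS der inj det e1] by blast+
  qed
  define S1 where "S1 = line 1 ` S n"
  define S2 where "S2 = line (-1) ` S n"
  have I1: "(\<omega> has_integral integral (S n) om_out) S1"
  proof -
    have "integral (S n) (\<lambda>x. \<omega> (line 1 x)) = integral (S n) om_out"
      using SB by (intro integral_cong) (auto simp: \<omega>1 subset_iff)
    then show ?thesis using cov[of 1] unfolding S1_def absolutely_integrable_on_def
      by (metis has_integral_integral)
  qed
  have I2: "(\<omega> has_integral integral (S n) om_in) S2"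
  proof -
    have "integral (S n) (\<lambda>x. \<omega> (line (-1) x)) = integral (S n) om_in"
      using SB by (intro integral_cong) (auto simp: \<omega>2 subset_iff)
    then show ?thesis using cov[of "-1"] unfolding S2_def absolutely_integrable_on_def
      by (metis has_integral_integral)
  qed
  define t where "t = \<Theta> 0"
  define t' where "t' = \<Theta> 0 + 2 * pi * real n"
  have t': "\<Theta> (real n * L) = t'" using Theta_add_nat[of 0 n] by (simp add: t'_def)
  have memS: "x \<in> S n \<longleftrightarrow> x \<in> B \<and> t \<le> \<Theta> (snd x) \<and> \<Theta> (snd x) \<le> t'" for x
    unfolding t'[symmetric] t_def by (simp add: S_def B_def)
  \<comment> \<open>A line in \<open>S1\<close> outside \<open>S2\<close> exits beyond the right
    end, one in \<open>S2\<close> outside \<open>S1\<close> enters before the left end. The angle of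
    a line differs by less than \<open>pi\<close> from the normal angles at both its ends, whence
    the widths \<open>2 * pi\<close>.\<close>
  define Q1 where "Q1 = cbox (t' - pi, - M) (t' + pi, M)"
  define Q2 where "Q2 = cbox (t - pi, - M) (t + pi, M)"
  have d1: "z \<in> Q1 \<or> z \<in> S2" if zS: "z \<in> S1" for z
  proof -
    obtain x where x: "x \<in> S n" "z = line 1 x" using zS unfolding S1_def by blast
    have xs: "x \<in> strip" using Sstrip[OF x(1)] .
    have xB: "x \<in> B" using x(1) SB by blast
    have z2: "z = line (-1) (T x)" using x line_T[OF xs] by simp
    have TxB: "T x \<in> B" using xB T_B by blast
    have ch: "\<Theta> (snd x) < angle 1 x" "angle 1 x < \<Theta> (snd x) + pi"
       "angle 1 x < \<Theta> (snd (T x))" "\<Theta> (snd (T x)) < angle 1 x + pi"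
      using T_props(2)[OF xs] by (auto simp: chord_def)
    have fz: "fst z = angle 1 x" by (simp add: x line_def)
    have sz: "\<bar>snd z\<bar> \<le> M" unfolding x by (rule line_dist_bound[OF M])
    show ?thesis
    proof (cases "angle 1 x \<le> t' - pi")
      case True
      then have "T x \<in> S n" using TxB ch x(1) by (auto simp: memS)
      then show ?thesis using z2 by (auto simp: S2_def)
    next
      case False
      then have "z \<in> Q1" using fz sz ch x(1) by (cases z) (auto simp: Q1_def cbox_Pair_eq memS)
      then show ?thesis by blast
    qed
  qed
  have d2: "z \<in> Q2 \<or> z \<in> S1" if zS: "z \<in> S2" for z
  proof -
    obtain y where y: "y \<in> S n" "z = line (-1) y" using zS unfolding S2_def by blast
    obtain x where x: "x \<in> B" "y = T x" using y(1) SB T_B by blast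
    have xs: "x \<in> strip" using x(1) B_strip by blast
    have z2: "z = line 1 x" using x y line_T[OF xs] by simp
    have ch: "\<Theta> (snd x) < angle 1 x" "angle 1 x < \<Theta> (snd x) + pi"
       "angle 1 x < \<Theta> (snd y)" "\<Theta> (snd y) < angle 1 x + pi"
      using T_props(2)[OF xs] by (auto simp: chord_def x)
    have fz: "fst z = angle 1 x" by (simp add: z2 line_def)
    have sz: "\<bar>snd z\<bar> \<le> M" unfolding z2 by (rule line_dist_bound[OF M])
    show ?thesis
    proof (cases "t + pi \<le> angle 1 x")
      case True
      then have "x \<in> S n" using x(1) ch y(1) by (auto simp: memS)
      then show ?thesis using z2 by (auto simp: S1_def)
    next
      case False
      then have "z \<in> Q2" using fz sz ch y(1) by (cases z) (auto simp: Q2_def cbox_Pair_eq memS)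
      then show ?thesis by blast
    qed
  qed
  have \<omega>_bound: "\<bar>\<omega> z\<bar> \<le> M" if "z \<in> S1 \<or> z \<in> S2" for z
    using that om_bound[OF M] SB by (auto simp: S1_def S2_def \<omega>1 \<omega>2 subset_iff)
  have box: "((\<lambda>z. if z \<in> cbox (u - pi, - M) (u + pi, M) then M else 0) has_integral 4 * pi * M\<^sup>2) UNIV" for u
  proof -
    have "((\<lambda>z :: real \<times> real. M) has_integral measure lborel (cbox (u - pi, - M) (u + pi, M)) *\<^sub>R M)
        (cbox (u - pi, - M) (u + pi, M))"
      by (rule has_integral_const)
    moreover have "measure lborel (cbox (u - pi, - M) (u + pi, M)) = (2 * pi) * (2 * M)"
      using M0 by (simp add: content_Pair)
    ultimately have "((\<lambda>z :: real \<times> real. M) has_integral 4 * pi * M\<^sup>2) (cbox (u - pi, - M) (u + pi, M))"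
      by (simp add: power2_eq_square mult_ac)
    then show ?thesis by (simp add: has_integral_restrict_UNIV)
  qed
  have "((\<lambda>z. (if z \<in> S1 then \<omega> z else 0) - (if z \<in> S2 then \<omega> z else 0)) has_integral
      integral (S n) om_out - integral (S n) om_in) UNIV"
    using I1 I2 by (intro has_integral_diff) (simp_all add: has_integral_restrict_UNIV)
  moreover have "((\<lambda>z. (if z \<in> Q1 then M else 0) + (if z \<in> Q2 then M else 0)) has_integral
      4 * pi * M\<^sup>2 + 4 * pi * M\<^sup>2) UNIV"
    unfolding Q1_def Q2_def by (intro has_integral_add box)
  ultimately have "integral (S n) om_out - integral (S n) om_in \<le> 4 * pi * M\<^sup>2 + 4 * pi * M\<^sup>2"
  proof (rule has_integral_le)
    fix z
    show "(if z \<in> S1 then \<omega> z else 0) - (if z \<in> S2 then \<omega> z else 0) \<le>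
        (if z \<in> Q1 then M else 0) + (if z \<in> Q2 then M else 0)"
      using d1[of z] d2[of z] \<omega>_bound[of z] M0 by auto
  qed
  then show "integral (S n) (\<lambda>x. om_out x - om_in x) \<le> 8 * pi * M\<^sup>2"
    using i by (simp add: Henstock_Kurzweil_Integration.integral_diff)
qed

text \<open>Over \<open>n\<close> periods the left side is multiplied by \<open>n\<close>, while the
  bound from the two ends stays fixed.\<close>

lemma hopf_inequality:
  "integral {0..L} (\<lambda>s. (1 / k s - h (\<Theta> s)) * (2 * f s * sqrt (1 - (f s)\<^sup>2) + 2 * arcsin (f s))) \<le> 0"
proof -
  define a where "a s = 1 / k s - h (\<Theta> s)" for s
  define g where "g s = a s * (2 * f s * sqrt (1 - (f s)\<^sup>2) + 2 * arcsin (f s))" for s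
  have h_cont: "continuous_on A h" for A
    using h_deriv by (meson DERIV_isCont continuous_at_imp_continuous_on)
  have a_cont: "continuous_on UNIV a"
    unfolding a_def using k_pos
    by (intro continuous_intros k_cont continuous_on_compose2[OF h_cont[of UNIV] Theta_cont]) (auto simp: less_le)
  have f_bounds: "-1 \<le> f s" "f s \<le> 1" for s using f01[of s] by auto
  have g_cont: "continuous_on UNIV g"
    unfolding g_def by (intro continuous_intros a_cont f_cont) (use f_bounds in auto)
  have a_per: "a (s + L) = a s" for s
  proof -
    have "1 / k (s + L) = 1 / k s"
      using rho_half_period[of "\<Theta> s"] rho_half_period[of "\<Theta> s + pi"]
      by (simp add: \<rho>_def add.assoc sigma_period)
    moreover have "h (\<Theta> s + 2 * pi) = h (\<Theta> s)"
      using h_half_period(1)[of "\<Theta> s"] h_half_period(1)[of "\<Theta> s + pi"] by (simp add: add.assoc)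
    ultimately show ?thesis by (simp add: a_def Theta_period)
  qed
  have g_per: "g (s + L) = g s" for s by (simp add: g_def a_per f_per)
  obtain M where M: "M > 0" "\<And>\<psi>. norm (P \<psi>) \<le> M" using P_bounded by blast
  have bound: "real n * integral {0..L} g \<le> 8 * pi * M\<^sup>2" for n
  proof -
    let ?S = "{x :: real \<times> real. \<bar>fst x\<bar> \<le> f (snd x) \<and> 0 \<le> snd x \<and> snd x \<le> real n * L}"
    have nL: "0 \<le> real n * L" using L_pos by simp
    have "real n * integral {0..L} g = integral {0..real n * L} g"
      using integral_multiple_period[OF g_cont g_per] L_pos by simp
    also have "\<dots> = integral ?S (\<lambda>x. 2 * sine x * a (snd x))"
      unfolding g_def using integral_region_sine[OF f_cont f01 a_cont nL] by simp
    also have "\<dots> \<le> integral ?S (\<lambda>x. om_out x - om_in x)"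
    proof (rule integral_le)
      have "compact ?S" by (intro compact_region_piece f_cont) (use f01 less_imp_le in blast)
      then have "integrable lborel (\<lambda>x. indicator ?S x *\<^sub>R (2 * sine x * a (snd x)))"
        by (intro borel_integrable_compact continuous_intros sine_cont continuous_on_compose2[OF a_cont]) auto
      then show "(\<lambda>x. 2 * sine x * a (snd x)) integrable_on ?S"
        by (intro set_borel_integral_eq_integral(1)) (simp add: set_integrable_def)
    qed (use increment_integral_bound(1)[OF M(2)] om_increment in \<open>auto simp: a_def B_def\<close>)
    also have "\<dots> \<le> 8 * pi * M\<^sup>2" by (rule increment_integral_bound(2)[OF M(2)])
    finally show ?thesis .
  qed
  have "integral {0..L} g \<le> 0"
  proof (rule ccontr)
    assume "\<not> ?thesis"
    then obtain n where "8 * pi * M\<^sup>2 < real n * integral {0..L} g"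
      using reals_Archimedean3[of "integral {0..L} g"] by auto
    then show False using bound[of n] by simp
  qed
  then show ?thesis unfolding g_def a_def .
qed

end

end

section \<open>The normal angle of a convex curve\<close>

lemma real_antiderivative:
  fixes k :: "real \<Rightarrow> real"
  assumes "continuous_on UNIV k"
  obtains K where "K 0 = 0" "\<And>s. (K has_real_derivative k s) (at s)"
proof -
  define K where "K u = (LBINT y=ereal 0..ereal u. k y)" for u
  have "(K has_real_derivative k s) (at s)" for s
  proof -
    define b where "b = \<bar>s\<bar> + 1"
    have b: "- b < s" "s < b" "b > 0" by (auto simp: b_def)
    have "(K has_vector_derivative k s) (at s within {- b..b})"
      unfolding K_def[abs_def]
      by (rule interval_integral_FTC2) (use b in \<open>auto intro: continuous_on_subset[OF assms]\<close>)
    then show ?thesis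
      using at_within_Icc_at[OF b(1,2)] by (simp add: has_real_derivative_iff_has_vector_derivative)
  qed
  moreover have "K 0 = 0" by (simp add: K_def)
  ultimately show ?thesis using that by blast
qed

lemma local_min_derivative_zero:
  fixes u :: "real \<Rightarrow> real"
  assumes "(u has_real_derivative d) (at s)" "\<And>t. u s \<le> u t"
  shows "d = 0"
  using DERIV_local_min[OF assms(1), of 1] assms(2) by simp

lemma simple_closed_curve_simple_path:
  assumes "simple_closed_curve \<gamma> L" "continuous_on UNIV \<gamma>"
  shows "simple_path (\<lambda>t. \<gamma> (L * t))" "pathfinish (\<lambda>t. \<gamma> (L * t)) = pathstart (\<lambda>t. \<gamma> (L * t))"
    "path_image (\<lambda>t. \<gamma> (L * t)) = range \<gamma>"
proof -
  have L: "L > 0" and eq: "\<And>s t. \<gamma> s = \<gamma> t \<longleftrightarrow> (\<exists>k::int. t = s + of_int k * L)"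
    using assms(1) by (auto simp: simple_closed_curve_def)
  show "simple_path (\<lambda>t. \<gamma> (L * t))"
    unfolding simple_path_def loop_free_def
  proof (intro conjI ballI impI)
    show "path (\<lambda>t. \<gamma> (L * t))"
      unfolding path_def by (intro continuous_on_compose2[OF assms(2)] continuous_intros) auto
    fix x y :: real
    assume xy: "x \<in> {0..1}" "y \<in> {0..1}" "\<gamma> (L * x) = \<gamma> (L * y)"
    then obtain k :: int where "L * y = L * x + of_int k * L" using eq by blast
    then have "L * (y - x - of_int k) = 0" by (simp add: algebra_simps)
    then have k: "y = x + of_int k" using L by simp
    then have "- 1 \<le> (of_int k :: real)" "(of_int k :: real) \<le> 1" using xy by auto
    then have "-1 \<le> k" "k \<le> 1" by linarith+
    then have "k = -1 \<or> k = 0 \<or> k = 1" by linarith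
    then show "x = y \<or> x = 0 \<and> y = 1 \<or> x = 1 \<and> y = 0" using k xy by auto
  qed
  show "pathfinish (\<lambda>t. \<gamma> (L * t)) = pathstart (\<lambda>t. \<gamma> (L * t))"
    unfolding pathfinish_def pathstart_def eq by (intro exI[of _ "-1"]) simp
  have "\<gamma> s \<in> path_image (\<lambda>t. \<gamma> (L * t))" for s
  proof -
    have "s = L * frac (s / L) + of_int \<lfloor>s / L\<rfloor> * L"
      using L by (simp add: frac_def field_simps)
    then have "\<gamma> (L * frac (s / L)) = \<gamma> s" unfolding eq by blast
    moreover have "frac (s / L) \<in> {0..1}" using frac_ge_0[of "s / L"] frac_lt_1[of "s / L"] by simp
    ultimately show ?thesis unfolding path_image_def by (metis image_eqI)
  qed
  then show "path_image (\<lambda>t. \<gamma> (L * t)) = range \<gamma>" unfolding path_image_def by blast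
qed

text \<open>By the Jordan theorem the curve is the frontier of the open set it encloses; a
  hyperplane separating a boundary point from this convex set supports its closure.\<close>

lemma convex_curve_support:
  assumes "simple_closed_curve \<gamma> L" "continuous_on UNIV \<gamma>" "convex_curve \<gamma>"
  obtains a where "a \<noteq> 0" "\<And>t. a \<bullet> \<gamma> s \<le> a \<bullet> \<gamma> t"
proof -
  define I where "I = inside (range \<gamma>)"
  note J = Jordan_inside_outside[OF simple_closed_curve_simple_path(1,2)[OF assms(1,2)],
      unfolded simple_closed_curve_simple_path(3)[OF assms(1,2)], folded I_def]
  have I: "I \<noteq> {}" "open I" "frontier I = range \<gamma>" using J by auto
  have "\<gamma> s \<in> frontier I" using I by auto
  then have "\<gamma> s \<notin> I" using I(2) by (simp add: frontier_def interior_open)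
  moreover have "convex I" using assms(3) by (simp add: convex_curve_def I_def)
  ultimately obtain a b where ab: "a \<noteq> 0" "a \<bullet> \<gamma> s \<le> b" "\<And>x. x \<in> I \<Longrightarrow> a \<bullet> x \<ge> b"
    using separating_hyperplane_sets[of "{\<gamma> s}" I] I(1) by auto
  have "closure I \<subseteq> {x. a \<bullet> x \<ge> b}"
    using ab(3) by (intro closure_minimal closed_halfspace_ge) auto
  moreover have "range \<gamma> \<subseteq> closure I" unfolding I(3)[symmetric] by (simp add: frontier_def)
  ultimately have "b \<le> a \<bullet> \<gamma> t" for t by blast
  then have "a \<bullet> \<gamma> s \<le> a \<bullet> \<gamma> t" for t using ab(2) order.trans by blast
  with ab(1) show ?thesis by (rule that)
qed

text \<open>Integrating the curvature gives the normal angle; the delicate point is that it grows by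
  exactly \<open>2 * pi\<close> per period. This is deduced from the supporting lines and simplicity
  of the curve.\<close>

lemma oval_of_curve:
  fixes \<gamma> :: "real \<Rightarrow> complex"
  assumes scc: "simple_closed_curve \<gamma> L" and C2: "C2_curve \<gamma>"
    and arc: "arclength_parametrised \<gamma>" and conv: "convex_curve \<gamma>"
    and curv: "\<And>s. curvature \<gamma> s > 0" and sym: "centrally_symmetric (range \<gamma>)"
  obtains c \<Theta> where "oval \<gamma> L c \<Theta> (curvature \<gamma>)"
proof -
  define \<tau> where "\<tau> = tangent \<gamma>"
  define k where "k = curvature \<gamma>"
  have L: "L > 0" and eq: "\<And>s t. \<gamma> s = \<gamma> t \<longleftrightarrow> (\<exists>k::int. t = s + of_int k * L)"
    using scc by (auto simp: simple_closed_curve_def)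
  have d\<gamma>: "(\<gamma> has_vector_derivative \<tau> s) (at s)" for s
    using C2 vector_derivative_works[of \<gamma> "at s"] by (simp add: C2_curve_def \<tau>_def tangent_def)
  have d\<tau>: "(\<tau> has_vector_derivative acceleration \<gamma> s) (at s)" for s
    using C2 vector_derivative_works[of \<tau> "at s"] by (simp add: C2_curve_def \<tau>_def acceleration_def)
  have \<tau>1: "norm (\<tau> s) = 1" for s using arc by (simp add: arclength_parametrised_def \<tau>_def)
  have \<gamma>_cont: "continuous_on UNIV \<gamma>" and \<tau>_cont: "continuous_on UNIV \<tau>"
    using d\<gamma> d\<tau> by (meson has_vector_derivative_continuous continuous_at_imp_continuous_on)+
  have k_cont: "continuous_on UNIV k"
    unfolding k_def curvature_def \<tau>_def[symmetric]
    using C2 by (intro continuous_intros \<tau>_cont) (simp add: C2_curve_def)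
  have k_pos: "k s > 0" for s using curv by (simp add: k_def)
  have frame: "z = (z \<bullet> \<tau> s) *\<^sub>R \<tau> s + (z \<bullet> (\<i> * \<tau> s)) *\<^sub>R (\<i> * \<tau> s)" for z s
  proof -
    have "\<tau> s = cis (Arg (\<tau> s))"
      using Arg_eq[of "\<tau> s"] \<tau>1[of s] by (simp add: cis_conv_exp) (metis norm_zero zero_neq_one)
    then show ?thesis using cis_frame_decomposition[of z "Arg (\<tau> s)"] by simp
  qed
  have acc: "acceleration \<gamma> s = k s *\<^sub>R (\<i> * \<tau> s)" for s
  proof -
    have "((\<lambda>s. \<tau> s \<bullet> \<tau> s) has_vector_derivative
       (\<tau> s \<bullet> acceleration \<gamma> s + acceleration \<gamma> s \<bullet> \<tau> s)) (at s)"
      by (rule bounded_bilinear.has_vector_derivative[OF bounded_bilinear_inner d\<tau> d\<tau>])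
    moreover have "(\<lambda>s. \<tau> s \<bullet> \<tau> s) = (\<lambda>s. 1)" using \<tau>1 by (simp add: dot_square_norm)
    ultimately have "((\<lambda>s. 1 :: real) has_vector_derivative
       (\<tau> s \<bullet> acceleration \<gamma> s + acceleration \<gamma> s \<bullet> \<tau> s)) (at s)" by simp
    then have "\<tau> s \<bullet> acceleration \<gamma> s + acceleration \<gamma> s \<bullet> \<tau> s = 0"
      using has_vector_derivative_const vector_derivative_unique_at by blast
    then have "acceleration \<gamma> s \<bullet> \<tau> s = 0" by (simp add: inner_commute)
    then show ?thesis
      using frame[of "acceleration \<gamma> s" s] by (simp add: k_def curvature_def \<tau>_def)
  qed
  obtain K where K: "K 0 = 0" "\<And>s. (K has_real_derivative k s) (at s)"
    using real_antiderivative[OF k_cont] by blast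
  \<comment> \<open>The initial value comes from \<open>\<tau> = \<i> * cis \<Theta>\<close> at 0,
    that is, \<open>cis \<Theta> = - \<i> * \<tau>\<close>.\<close>
  define \<Theta> where "\<Theta> s = Arg (- \<i> * \<tau> 0) + K s" for s
  have d\<Theta>: "(\<Theta> has_real_derivative k s) (at s)" for s
    unfolding \<Theta>_def[abs_def] using K(2) by (auto intro!: derivative_eq_intros)
  have \<tau>_eq: "\<tau> s = \<i> * cis (\<Theta> s)" for s
  proof -
    have dcis: "((\<lambda>s. cis (- \<Theta> s)) has_vector_derivative ((- k s) *\<^sub>R (\<i> * cis (- \<Theta> s)))) (at s)" for s
    proof -
      have "((cis \<circ> (\<lambda>s. - \<Theta> s)) has_vector_derivative ((- k s) *\<^sub>R (\<i> * cis (- \<Theta> s)))) (at s)"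
        by (rule vector_diff_chain_at[OF _ cis_vector_derivative])
          (use DERIV_minus[OF d\<Theta>] in \<open>simp add: has_real_derivative_iff_has_vector_derivative\<close>)
      then show ?thesis by (simp add: o_def)
    qed
    have "((\<lambda>s. \<tau> s * cis (- \<Theta> s)) has_vector_derivative 0) (at s within UNIV)" for s
    proof -
      have "((\<lambda>s. \<tau> s * cis (- \<Theta> s)) has_vector_derivative
          (\<tau> s * ((- k s) *\<^sub>R (\<i> * cis (- \<Theta> s))) + acceleration \<gamma> s * cis (- \<Theta> s))) (at s)"
        by (rule bounded_bilinear.has_vector_derivative[OF bounded_bilinear_mult d\<tau> dcis])
      then show ?thesis by (simp add: acc scaleR_conv_of_real mult_ac)
    qed
    then obtain z where z: "\<And>s. \<tau> s * cis (- \<Theta> s) = z"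
      using has_vector_derivative_zero_constant[of UNIV "\<lambda>s. \<tau> s * cis (- \<Theta> s)"] by auto
    have "norm (- \<i> * \<tau> 0) = 1" using \<tau>1[of 0] by (simp add: norm_mult)
    then have "cis (Arg (- \<i> * \<tau> 0)) = - \<i> * \<tau> 0"
      using Arg_eq[of "- \<i> * \<tau> 0"] unfolding cis_conv_exp by (metis norm_zero of_real_1 mult_1 zero_neq_one)
    then have "cis (\<Theta> 0) = - \<i> * \<tau> 0" by (simp add: \<Theta>_def K(1))
    then have "\<tau> 0 = \<i> * cis (\<Theta> 0)" by (simp add: mult.assoc[symmetric])
    then have "z = \<i>" using z[of 0] by (simp add: mult.assoc cis_mult)
    then have "\<tau> s * (cis (- \<Theta> s) * cis (\<Theta> s)) = \<i> * cis (\<Theta> s)" using z[of s] by (simp flip: mult.assoc)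
    then show ?thesis by (simp add: cis_mult)
  qed
  have \<gamma>_per: "\<gamma> (s + L) = \<gamma> s" for s
  proof -
    have "\<gamma> s = \<gamma> (s + L)" unfolding eq by (intro exI[of _ 1]) simp
    then show ?thesis by simp
  qed
  have shift: "(g has_vector_derivative d) (at (s + L)) \<Longrightarrow> ((\<lambda>s. g (s + L)) has_vector_derivative d) (at s)"
    for g :: "real \<Rightarrow> complex" and d s
  proof -
    assume "(g has_vector_derivative d) (at (s + L))"
    moreover have "((\<lambda>s. s + L) has_vector_derivative 1) (at s)" by (auto intro!: derivative_eq_intros)
    ultimately show ?thesis using vector_diff_chain_at[of "\<lambda>s. s + L" 1 s g d] by (simp add: o_def)
  qed
  have \<tau>_per: "\<tau> (s + L) = \<tau> s" for s
    using shift[OF d\<gamma>[of "s + L"]] d\<gamma>[of s] by (simp add: \<gamma>_per) (metis vector_derivative_at)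
  have acc_per: "acceleration \<gamma> (s + L) = acceleration \<gamma> s" for s
    using shift[OF d\<tau>[of "s + L"]] d\<tau>[of s] by (simp add: \<tau>_per) (metis vector_derivative_at)
  have k_per: "k (s + L) = k s" for s
    by (simp add: k_def curvature_def acc_per \<tau>_per flip: \<tau>_def)
  have \<Theta>_mono: "\<Theta> s < \<Theta> t" if "s < t" for s t
    by (rule DERIV_pos_imp_increasing[OF that]) (use d\<Theta> k_pos in blast)
  have support: "(\<gamma> t - \<gamma> s) \<bullet> (\<i> * \<tau> s) \<ge> 0" for s t
  proof -
    obtain a where a: "a \<noteq> 0" "\<And>t. a \<bullet> \<gamma> s \<le> a \<bullet> \<gamma> t"
      using convex_curve_support[OF scc \<gamma>_cont conv] by blast
    have "((\<lambda>t. a \<bullet> \<gamma> t) has_real_derivative a \<bullet> \<tau> s) (at s)"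
      using bounded_linear.has_vector_derivative[OF bounded_linear_inner_right d\<gamma>]
      by (simp add: has_real_derivative_iff_has_vector_derivative)
    then have "a \<bullet> \<tau> s = 0" by (rule local_min_derivative_zero) (rule a(2))
    \<comment> \<open>The minimum at \<open>s\<close> makes \<open>a\<close> normal to the curve.
      Positive curvature makes \<open>v\<close> positive just after \<open>s\<close> and so decides
      the sign of \<beta>.\<close>
    define \<beta> where "\<beta> = a \<bullet> (\<i> * \<tau> s)"
    have a_eq: "a = \<beta> *\<^sub>R (\<i> * \<tau> s)" using frame[of a s] \<open>a \<bullet> \<tau> s = 0\<close> by (simp add: \<beta>_def)
    define v where "v t = (\<gamma> t - \<gamma> s) \<bullet> (\<i> * \<tau> s)" for t
    have \<beta>v: "0 \<le> \<beta> * v t" for t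
    proof -
      have "\<beta> * v t = a \<bullet> (\<gamma> t - \<gamma> s)"
        unfolding a_eq v_def inner_scaleR_left by (simp only: inner_commute)
      then show ?thesis using a(2)[of t] by (simp add: inner_diff_right)
    qed
    have dv: "(v has_real_derivative sin (\<Theta> t - \<Theta> s)) (at t)" for t
    proof -
      have "((\<lambda>t. (\<gamma> t - \<gamma> s) \<bullet> (\<i> * \<tau> s)) has_vector_derivative (\<tau> t - 0) \<bullet> (\<i> * \<tau> s)) (at t)"
        by (intro bounded_linear.has_vector_derivative[OF bounded_linear_inner_left]
             has_vector_derivative_diff d\<gamma> has_vector_derivative_const)
      moreover have "(\<tau> t - 0) \<bullet> (\<i> * \<tau> s) = sin (\<Theta> t - \<Theta> s)"
        by (simp add: \<tau>_eq inner_complex_def sin_diff)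
      ultimately show ?thesis
        by (simp add: has_real_derivative_iff_has_vector_derivative v_def[abs_def])
    qed
    have "((\<lambda>t. sin (\<Theta> t - \<Theta> s)) has_real_derivative cos (\<Theta> s - \<Theta> s) * (k s - 0)) (at s)"
      by (intro DERIV_chain2[OF DERIV_sin] DERIV_diff d\<Theta> DERIV_const)
    then have "((\<lambda>t. sin (\<Theta> t - \<Theta> s)) has_real_derivative k s) (at s)" by simp
    from DERIV_pos_inc_right[OF this k_pos] obtain d where
      d: "d > 0" "\<And>x. 0 < x \<Longrightarrow> x < d \<Longrightarrow> sin (\<Theta> (s + x) - \<Theta> s) > 0" by auto
    have "v s < v (s + d / 2)"
    proof (rule DERIV_pos_imp_increasing_open[where f = v])
      show "s < s + d / 2" using d by simp
      show "\<exists>y. (v has_real_derivative y) (at x) \<and> 0 < y" if "s < x" "x < s + d / 2" for x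
        using dv[of x] d(2)[of "x - s"] that by auto
      show "continuous_on {s..s + d / 2} v"
        using dv by (meson DERIV_isCont continuous_at_imp_continuous_on)
    qed
    then have "v (s + d / 2) > 0" by (simp add: v_def)
    then have "\<beta> \<ge> 0" using \<beta>v[of "s + d / 2"] by (simp add: zero_le_mult_iff)
    moreover have "\<beta> \<noteq> 0" using a(1) a_eq by auto
    ultimately have "v t \<ge> 0" using \<beta>v[of t] by (simp add: zero_le_mult_iff)
    then show ?thesis by (simp add: v_def)
  qed
  define D where "D = \<Theta> L - \<Theta> 0"
  have D: "\<Theta> (s + L) = \<Theta> s + D" for s
  proof -
    have "((\<lambda>s. \<Theta> (s + L) - \<Theta> s) has_real_derivative k (s + L) - k s) (at s)" for s
      using d\<Theta>[of "s + L"] by (intro DERIV_diff d\<Theta>) (simp add: DERIV_shift)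
    then have "\<forall>s. ((\<lambda>s. \<Theta> (s + L) - \<Theta> s) has_real_derivative 0) (at s)" by (simp add: k_per)
    from DERIV_isconst_all[OF this, of s 0] show ?thesis by (simp add: D_def)
  qed
  have "cis (\<Theta> 0 + D) = cis (\<Theta> 0)"
    using \<tau>_per[of 0] unfolding \<tau>_eq D by simp
  then have "cis (\<Theta> 0) * cis D = cis (\<Theta> 0) * 1" by (simp add: cis_mult)
  then have "cis D = 1" by (simp only: mult_cancel_left cis_neq_zero) simp
  then have "cos D = 1" by (simp add: complex_eq_iff)
  then obtain m :: int where m: "D = of_int m * 2 * pi" using cos_one_2pi_int by blast
  have "D > 0" using \<Theta>_mono[OF L] by (simp add: D_def)
  then have m1: "m \<ge> 1" unfolding m by (simp add: zero_less_mult_iff)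
  have "m = 1"
  proof (rule ccontr)
    assume "m \<noteq> 1"
    then have "m \<ge> 2" using m1 by simp
    then have "(2::real) \<le> of_int m" by linarith
    then have D4: "D \<ge> 2 * 2 * pi" unfolding m by (intro mult_right_mono) auto
    have "\<exists>s\<ge>0. s \<le> L \<and> \<Theta> s = \<Theta> 0 + 2 * pi"
    proof (rule IVT')
      show "\<Theta> 0 + 2 * pi \<le> \<Theta> L" using D4 pi_gt_zero unfolding D_def by linarith
      show "continuous_on {0..L} \<Theta>" using d\<Theta> by (meson DERIV_isCont continuous_at_imp_continuous_on)
    qed (use L in auto)
    then obtain s2 where s2: "0 \<le> s2" "s2 \<le> L" "\<Theta> s2 = \<Theta> 0 + 2 * pi" by blast
    have "s2 \<noteq> 0" using s2(3) pi_gt_zero by auto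
    moreover have "s2 \<noteq> L" using s2(3) D4 pi_gt_zero unfolding D_def by auto
    ultimately have s2': "0 < s2" "s2 < L" using s2 by auto
    have \<tau>2: "\<tau> s2 = \<tau> 0" by (simp add: \<tau>_eq s2(3) cis_plus_2pi)
    \<comment> \<open>Equal tangents at 0 and \<open>s2\<close> put both points on one supporting
      line, so \<open>g\<close> has its minimum 0 at 0. Its vanishing derivative removes the
      remaining tangential component of \<open>\<gamma> s2 - \<gamma> 0\<close>, contradicting
      simplicity.\<close>
    define g where "g s = (\<gamma> s2 - \<gamma> s) \<bullet> (\<i> * \<tau> s)" for s
    have g0: "g 0 = 0"
      using support[of s2 0] support[of 0 s2] by (simp add: g_def \<tau>2 inner_diff_left)
    have "(g has_real_derivative ((\<gamma> s2 - \<gamma> 0) \<bullet> (\<i> * acceleration \<gamma> 0) + (0 - \<tau> 0) \<bullet> (\<i> * \<tau> 0))) (at 0)"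
      unfolding g_def[abs_def] has_real_derivative_iff_has_vector_derivative
      by (intro bounded_bilinear.has_vector_derivative[OF bounded_bilinear_inner]
           bounded_linear.has_vector_derivative[OF bounded_linear_mult_right]
           has_vector_derivative_diff has_vector_derivative_const d\<gamma> d\<tau>)
    then have "(\<gamma> s2 - \<gamma> 0) \<bullet> (\<i> * acceleration \<gamma> 0) + (0 - \<tau> 0) \<bullet> (\<i> * \<tau> 0) = 0"
      by (rule local_min_derivative_zero) (use support in \<open>simp add: g0\<close>, simp add: g_def)
    moreover have "(0 - \<tau> 0) \<bullet> (\<i> * \<tau> 0) = 0" by (simp add: inner_complex_def)
    moreover have "\<i> * acceleration \<gamma> 0 = (- k 0) *\<^sub>R \<tau> 0" by (simp add: acc complex_eq_iff)
    ultimately have "(\<gamma> s2 - \<gamma> 0) \<bullet> \<tau> 0 = 0" using k_pos[of 0] by simp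
    then have "\<gamma> s2 - \<gamma> 0 = 0" using frame[of "\<gamma> s2 - \<gamma> 0" 0] g0 unfolding g_def by simp
    then have "\<gamma> 0 = \<gamma> s2" by simp
    then obtain j :: int where "s2 = of_int j * L" unfolding eq by auto
    then have "0 < of_int j * L" "of_int j * L < 1 * L" using s2' by auto
    then have "0 < (of_int j :: real)" "(of_int j :: real) < 1"
      using L zero_less_mult_pos2 mult_less_cancel_right_pos by blast+
    then show False by simp
  qed
  then have \<Theta>_per: "\<Theta> (s + L) = \<Theta> s + 2 * pi" for s using D[of s] by (simp add: m)
  obtain c where c: "(\<lambda>z. 2 * c - z) ` range \<gamma> = range \<gamma>"
    using sym by (auto simp: centrally_symmetric_def)
  have "oval \<gamma> L c \<Theta> k"
    by unfold_locales
      (use L d\<gamma> d\<Theta> k_pos k_cont \<gamma>_per \<Theta>_per c in \<open>simp_all add: \<tau>_eq\<close>)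
  then show ?thesis using that by (simp add: k_def)
qed

section \<open>Rigidity\<close>

lemma periodic_continuous_bound:
  fixes f :: "real \<Rightarrow> real"
  assumes cont: "continuous_on UNIV f" and per: "\<And>s. f (s + L) = f s" and L: "L > 0"
    and less: "\<And>s. f s < b"
  obtains m where "m < b" "\<And>s. f s \<le> m"
proof -
  obtain x where x: "\<And>s. s \<in> {0..L} \<Longrightarrow> f s \<le> f x"
    using continuous_attains_sup[OF compact_Icc _ continuous_on_subset[OF cont subset_UNIV], of 0 L] L
    by (auto simp del: atLeastAtMost_iff)
  have int: "f (s + of_int n * L) = f s" for s n
  proof (induction n rule: int_induct[where k = 0])
    case (step1 i)
    then show ?case using per[of "s + of_int i * L"] by (simp add: algebra_simps)
  next
    case (step2 i)
    then show ?case using per[of "s + of_int (i - 1) * L"] by (simp add: algebra_simps)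
  qed simp
  have "f s \<le> f x" for s
  proof -
    have "s = L * frac (s / L) + of_int \<lfloor>s / L\<rfloor> * L"
      using L by (simp add: frac_def field_simps)
    then have "f s = f (L * frac (s / L))" using int by metis
    also have "L * frac (s / L) \<in> {0..L}"
      using frac_ge_0[of "s / L"] frac_lt_1[of "s / L"] L by (simp add: mult_left_le)
    then have "f (L * frac (s / L)) \<le> f x" by (rule x)
    finally show ?thesis .
  qed
  then show ?thesis using that less by blast
qed

context oval
begin

lemma circle_of_constant_support:
  assumes "\<And>\<psi>. h' \<psi> = 0"
  shows "is_circle (range \<gamma>)"
proof -
  have "\<forall>\<psi>. (h has_real_derivative 0) (at \<psi>)" using h_deriv assms by metis
  then have const: "h \<psi> = h 0" for \<psi> using DERIV_isconst_all by blast
  have P: "P \<psi> = h 0 *\<^sub>R cis \<psi>" for \<psi>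
    using P_frame[of \<psi>] assms[of \<psi>] const[of \<psi>] by simp
  have "range \<gamma> = sphere c (h 0)"
  proof (intro equalityI subsetI)
    fix z assume "z \<in> range \<gamma>"
    then obtain s where "z = \<gamma> s" by blast
    then have "z - c = h 0 *\<^sub>R cis (\<Theta> s)" using P[of "\<Theta> s"] by (simp add: P_Theta)
    then have "norm (z - c) = h 0" using h_pos[of 0] by simp
    then show "z \<in> sphere c (h 0)" by (simp add: dist_norm norm_minus_commute)
  next
    fix z assume "z \<in> sphere c (h 0)"
    then have n: "norm (z - c) = h 0" by (simp add: dist_norm norm_minus_commute)
    define \<psi> where "\<psi> = Arg (z - c)"
    have "z - c \<noteq> 0" using n h_pos[of 0] by auto
    then have "z - c = h 0 *\<^sub>R cis \<psi>"
      using Arg_eq[of "z - c"] n by (simp add: \<psi>_def cis_conv_exp scaleR_conv_of_real)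
    then have "z - c = \<gamma> (\<sigma> \<psi>) - c" using P[of \<psi>] by (simp add: P_def)
    then have "z = \<gamma> (\<sigma> \<psi>)" by simp
    then show "z \<in> range \<gamma>" by blast
  qed
  then show ?thesis unfolding is_circle_def using h_pos by blast
qed

text \<open>The substitution \<open>s = \<sigma> \<psi>\<close>, with
  \<open>ds = \<rho> d\<psi>\<close> and \<open>f = cos \<delta>\<close>, brings Hopf's inequality
  into the form required by \<open>support_function_rigidity\<close>; the factor \<rho> becomes
  \<open>h'' + h\<close>.\<close>

lemma h'_eq_zero:
  fixes f :: "real \<Rightarrow> real"
  assumes f_cont: "continuous_on UNIV f" and f_range: "\<And>s. -1 < f s \<and> f s < 1"
    and ch: "\<And>\<psi>. chord \<psi> (\<psi> + arccos (f (\<sigma> \<psi>))) (\<psi> + pi / 2)"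
    and half: "\<And>\<psi>. arccos (f (\<sigma> (\<psi> + pi / 2))) = pi / 2 - arccos (f (\<sigma> \<psi>))"
    and le: "integral {0..L} (\<lambda>s. (1 / k s - h (\<Theta> s)) * (2 * f s * sqrt (1 - (f s)\<^sup>2) + 2 * arcsin (f s))) \<le> 0"
  shows "h' \<psi> = 0"
proof -
  define \<delta> where "\<delta> \<psi> = arccos (f (\<sigma> \<psi>))" for \<psi>
  obtain R where R: "R > 0" "\<And>\<psi>. (h \<psi>)\<^sup>2 + (h (\<psi> + pi / 2))\<^sup>2 = R\<^sup>2"
    "\<And>\<psi>. sin (\<delta> \<psi>) = h \<psi> / R" "\<And>\<psi>. cos (\<delta> \<psi>) = h (\<psi> + pi / 2) / R"
    using four_periodic_support[of \<delta>] ch half unfolding \<delta>_def by blast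
  define F where "F s = (1 / k s - h (\<Theta> s)) * (2 * f s * sqrt (1 - (f s)\<^sup>2) + 2 * arcsin (f s))" for s
  define G where "G \<psi> = (\<rho> \<psi> - h \<psi>) * ((\<rho> \<psi> - h \<psi>) + h \<psi>) *
      (pi - 2 * arcsin (h \<psi> / R) + 2 * (h \<psi> / R) * (h (\<psi> + pi / 2) / R))" for \<psi>
  have FG: "\<rho> \<psi> * F (\<sigma> \<psi>) = G \<psi>" for \<psi>
  proof -
    have \<delta>: "0 < \<delta> \<psi>" "\<delta> \<psi> < pi / 2"
      using ch[of \<psi>] half[of \<psi>] ch[of "\<psi> + pi / 2"] by (auto simp: \<delta>_def chord_def)
    have f: "f (\<sigma> \<psi>) = cos (\<delta> \<psi>)" using f_range[of "\<sigma> \<psi>"] by (simp add: \<delta>_def)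
    have s: "sqrt (1 - (f (\<sigma> \<psi>))\<^sup>2) = sin (\<delta> \<psi>)"
      using sin_gt_zero2[OF \<delta>] unfolding f by (simp add: real_sqrt_unique sin_squared_eq[symmetric])
    have a: "arcsin (f (\<sigma> \<psi>)) = pi / 2 - \<delta> \<psi>"
    proof -
      have "arcsin (sin (pi / 2 - \<delta> \<psi>)) = pi / 2 - \<delta> \<psi>" using \<delta> by (intro arcsin_sin) auto
      then show ?thesis by (simp add: f sin_diff)
    qed
    have d: "arcsin (h \<psi> / R) = \<delta> \<psi>"
      unfolding R(3)[symmetric] using \<delta> by (intro arcsin_sin) auto
    show ?thesis
      unfolding F_def G_def s a d unfolding f R(3)[of \<psi>, symmetric] R(4)[of \<psi>, symmetric]
      by (simp add: \<rho>_def algebra_simps)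
  qed
  have h_cont: "continuous_on A h" for A
    using h_deriv by (meson DERIV_isCont continuous_at_imp_continuous_on)
  have f_bounds: "-1 \<le> f s" "f s \<le> 1" for s using f_range[of s] by auto
  have F_cont: "continuous_on UNIV F"
    unfolding F_def using k_pos
    by (intro continuous_intros f_cont k_cont continuous_on_compose2[OF h_cont[of UNIV] Theta_cont])
      (auto simp: less_le f_bounds)
  have \<rho>h_cont: "continuous_on A (\<lambda>\<psi>. \<rho> \<psi> - h \<psi>)" for A
    by (intro continuous_intros rho_cont h_cont)
  have G_cont: "continuous_on UNIV G"
    unfolding FG[abs_def, symmetric]
    by (intro continuous_intros rho_cont continuous_on_compose2[OF F_cont sigma_cont]) auto
  have h_2pi: "h (\<psi> + 2 * pi) = h \<psi>" for \<psi>
    using h_half_period(1)[of \<psi>] h_half_period(1)[of "\<psi> + pi"] by (simp add: add.assoc)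
  have \<rho>_2pi: "\<rho> (\<psi> + 2 * pi) = \<rho> \<psi>" for \<psi>
    using rho_half_period[of \<psi>] rho_half_period[of "\<psi> + pi"] by (simp add: add.assoc)
  have G_per: "G (\<psi> + 2 * pi) = G \<psi>" for \<psi>
  proof -
    have "h (\<psi> + 2 * pi + pi / 2) = h (\<psi> + pi / 2)" using h_2pi[of "\<psi> + pi / 2"] by (simp add: add_ac)
    then show ?thesis unfolding G_def h_2pi \<rho>_2pi by simp
  qed
  define t where "t = \<Theta> 0"
  have "((\<lambda>\<psi>. \<rho> \<psi> *\<^sub>R F (\<sigma> \<psi>)) has_integral (integral {\<sigma> t..\<sigma> (t + 2 * pi)} F)) {t..t + 2 * pi}"
  proof (rule has_integral_substitution)
    have le: "\<sigma> a \<le> \<sigma> b" if "a \<le> b" for a b using that by (metis sigma_less_iff not_less)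
    show "\<sigma> t \<le> \<sigma> (t + 2 * pi)" by (rule le) simp
    show "\<sigma> ` {t..t + 2 * pi} \<subseteq> {\<sigma> t..\<sigma> (t + 2 * pi)}" using le by auto
    show "(\<sigma> has_real_derivative \<rho> x) (at x within {t..t + 2 * pi})" for x
      by (rule has_field_derivative_at_within[OF sigma_deriv])
  qed (auto intro: continuous_on_subset[OF F_cont])
  then have "(G has_integral (integral {0..L} F)) {t..t + 2 * pi}"
    by (simp add: FG sigma_period t_def)
  then have "integral {t..t + 2 * pi} G = integral {0..L} F" by (rule integral_unique)
  then have "integral {0..2 * pi} G \<le> 0"
    using integral_periodic_shift[OF G_cont G_per, of t] le unfolding F_def by simp
  then show ?thesis
    using support_function_rigidity[of h h' "\<lambda>\<psi>. \<rho> \<psi> - h \<psi>" R \<psi>, OF h_deriv h'_deriv \<rho>h_cont h_pos h_half_period(1) R(1,2)]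
    unfolding G_def by blast
qed

theorem circle_of_invariant_field:
  assumes rot: "rotational_curve L A" and TA: "T ` A = A"
    and rho: "has_rotation_number L T A (1/4)" and per4: "consists_of_periodic_orbits L T 4 A"
    and B: "B = region_bounded_by (A \<union> reverse_line \<gamma> L ` A)"
    and meas: "measurable_line_field L B l" and inv: "invariant_oriented_line_field T B l"
  shows "is_circle (range \<gamma>)"
proof -
  have A: "A \<subseteq> strip" using rot by (auto simp: rotational_curve_def)
  have AB: "A \<subseteq> B" unfolding B region_bounded_by_def by blast
  define w where "w x = slope (l x)" for x
  have nv: "nonvertical_line (l x)" if "x \<in> B" for x
    using meas that by (simp add: measurable_line_field_def)
  \<comment> \<open>Membership of \<open>T x\<close> in \<open>B\<close> is a premise because the
    invariance of \<open>B\<close> is established only after the curve is known to be a graph, and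
    that already uses the field on \<open>A\<close>.\<close>
  have field: "\<exists>r>0. dT x (w x, 1) = r *\<^sub>R (w (T x), 1)" if x: "x \<in> B" "x \<in> strip" "T x \<in> B" for x
  proof -
    have wl: "(w x, 1) \<in> l x" unfolding w_def by (rule nonvertical_slope(1)[OF nv[OF x(1)]])
    have "dT x ` l x = l (T x)" "\<forall>v\<in>l x. snd v > 0 \<longrightarrow> snd (dT x v) > 0"
      using inv x(1) unfolding invariant_oriented_line_field_def T_frechet[OF x(2), symmetric] by blast+
    then have "dT x (w x, 1) \<in> l (T x)" "snd (dT x (w x, 1)) > 0" using wl by (blast, force)
    then show ?thesis
      using nonvertical_slope(2)[OF nv[OF x(3)]] unfolding w_def by blast
  qed
  have per: "(T ^^ 4) x = x + (0, L)" if "x \<in> A" for x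
    by (rule period_from_rotation_number[OF that A rho per4])
  have D4: "D4 x < 0" if "x \<in> A" for x
    using that A TA AB by (intro D4_neg[where A = A and w = w] field) auto
  obtain f where f: "continuous_on UNIV f" "A = range (\<lambda>s. (f s, s))"
    using rotational_curve_graph[OF rot per D4] by blast
  have f_range: "-1 < f s \<and> f s < 1" for s
  proof -
    have "(f s, s) \<in> strip" using A unfolding f(2) by blast
    then show ?thesis by (simp add: strip_iff)
  qed
  note struct = four_periodic_structure[OF f A _ per]
  have ch: "chord \<psi> (\<psi> + arccos (f (\<sigma> \<psi>))) (\<psi> + pi / 2)" for \<psi>
    by (rule struct(2)) (use TA in auto)
  have half: "arccos (f (\<sigma> (\<psi> + pi / 2))) = pi / 2 - arccos (f (\<sigma> \<psi>))" for \<psi>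
    by (rule struct(1)) (use TA in auto)
  note facts = f_range ch half
  have f_pos: "0 < f s" for s by (rule graph_fun_pos[OF facts])
  have f_per: "f (s + L) = f s" for s by (rule graph_fun_period[OF facts])
  obtain m where m: "m < 1" "\<And>s. f s \<le> m"
    using periodic_continuous_bound[OF f(1) f_per L_pos, of 1] f_range by blast
  \<comment> \<open>Each reversed line is the flip of the image under \<open>T\<close>; since
    \<open>T\<close> maps \<open>A\<close> onto itself, the reversed curve is the mirror image of
    the graph.\<close>
  have "reverse_line \<gamma> L ` A = flip ` (T ` A)"
    unfolding image_image using A by (intro image_cong refl reverse_line_eq) auto
  also have "\<dots> = flip ` A" by (simp only: TA)
  also have "\<dots> = range (\<lambda>s. (- f s, s))" unfolding f(2) image_image flip_def by simp
  finally have B_eq: "B = {x. \<bar>fst x\<bar> \<le> f (snd x)}"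
    unfolding B f(2) using region_between_graphs[OF f(1) f_pos m(2,1)] by simp
  have TB: "T ` B = B"
  proof
    show "T ` B \<subseteq> B" unfolding B_eq using T_region[OF facts] by auto
    show "B \<subseteq> T ` B"
    proof
      fix y assume "y \<in> B"
      then obtain x where "\<bar>fst x\<bar> \<le> f (snd x)" "T x = y"
        unfolding B_eq using T_region_surj[OF facts, of y] by blast
      then show "y \<in> T ` B" unfolding B_eq by auto
    qed
  qed
  have w_meas: "w \<in> borel_measurable (lebesgue_on B)"
    using meas by (simp add: measurable_line_field_def w_def[abs_def])
  have f01: "0 < f s \<and> f s < 1" for s using f_pos f_range by blast
  have w_field: "\<exists>r>0. dT x (w x, 1) = r *\<^sub>R (w (T x), 1)" if "x \<in> B" for x
    using that TB region_strip[OF facts, of x] by (intro field) (auto simp: B_eq)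
  have "h' \<psi> = 0" for \<psi>
    by (rule h'_eq_zero[OF f(1) facts hopf_inequality[OF f(1) f01 f_per B_eq TB w_meas w_field]])
  then show ?thesis by (rule circle_of_constant_support)
qed

end

theorem corollary1p3:
  fixes \<gamma> :: "real \<Rightarrow> complex" and L :: real
    and T :: "real \<times> real \<Rightarrow> real \<times> real"
    and \<alpha> \<alpha>_bar B :: "(real \<times> real) set"
    and l :: "real \<times> real \<Rightarrow> (real \<times> real) set"
  defines "T \<equiv> billiard_map \<gamma> L"
    and "\<alpha>_bar \<equiv> reverse_line \<gamma> L ` \<alpha>"
    and "B \<equiv> region_bounded_by (\<alpha> \<union> \<alpha>_bar)"
  assumes "simple_closed_curve \<gamma> L"
    and "C2_curve \<gamma>"
    and "arclength_parametrised \<gamma>"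
    and "counterclockwise \<gamma> L"
    and "convex_curve \<gamma>"
    and "\<And>s. curvature \<gamma> s > 0"
    and "centrally_symmetric (range \<gamma>)"
    and "rotational_curve L \<alpha>"
    and "T ` \<alpha> = \<alpha>"
    and "has_rotation_number L T \<alpha> (1/4)"
    and "consists_of_periodic_orbits L T 4 \<alpha>"
    and "measurable_line_field L B l"
    and "invariant_oriented_line_field T B l"
  shows "is_circle (range \<gamma>)"
proof -
  obtain c \<Theta> where "oval \<gamma> L c \<Theta> (curvature \<gamma>)"
    using oval_of_curve[of \<gamma> L] assms(4,5,6,8,9,10) by blast
  then interpret oval \<gamma> L c \<Theta> "curvature \<gamma>" .
  show ?thesis
    by (rule circle_of_invariant_field[of \<alpha> B l]) (use assms in auto)
qed

end
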